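(* Let $G$ be an infinite $\omega$-bounded group (in particular, $G$ may be any infinite compact group). Then for every function $f:\mathbb N\to\mathbb N\setminus\{0\}$ the group $G$ has an unconditionally $f$-productive sequence.
   Context: All topological groups are Hausdorff; $\mathbb N=\{0,1,2,\dots\}$. A topological group $G$ is $\omega$-bounded if the closure of every countable subset of $G$ is compact. Products are ordered: $\prod_{n=0}^m b_n=b_0b_1\cdots b_m$. A sequence $\{b_n:n\in\mathbb N\}$ in a topological group $G$ is productive if $\{\prod_{n=0}^m b_n:m\in\mathbb N\}$ converges to some element of $G$. For $f:\mathbb N\to\mathbb N\setminus\{0\}$, a sequence $\{a_n:n\in\mathbb N\}$ of elements of $G$ is $f$-productive if it is faithfully indexed ($a_n\ne a_m$ for $n\neq m$) and $\{a_n^{z(n)}:n\in\mathbb N\}$ is productive in $G$ for every $z:\mathbb N\to\mathbb Z$ with $|z(n)|\le f(n)$ for all $n\in\mathbb N$. It is unconditionally $f$-productive if it is faithfully indexed and $\{a_{\varphi(n)}:n\in\mathbb N\}$ is $(f\circ\varphi)$-productive for every bijection $\varphi:\mathbb N\to\mathbb N$. *)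

theory Defs
  imports "HOL-Algebra.Group" "HOL-Analysis.T1_Spaces"
begin

locale hausdorff_topological_group = group G for G (structure) +
  fixes T :: "'a topology"
  assumes topspace_eq_carrier: "topspace T = carrier G"
    and Hausdorff: "Hausdorff_space T"
    and continuous_mult: "continuous_map (prod_topology T T) T (\<lambda>(x, y). x \<otimes> y)"
    and continuous_inv: "continuous_map T T (\<lambda>x. inv x)"

definition omega_bounded :: "('a, 'b) monoid_scheme \<Rightarrow> 'a topology \<Rightarrow> bool" where
  "omega_bounded G T \<longleftrightarrow>
    (\<forall>A. A \<subseteq> carrier G \<and> countable A \<longrightarrow> compactin T (T closure_of A))"

(* The group need not be commutative, so finprod does not apply. *)
primrec ordered_prod :: "('a, 'b) monoid_scheme \<Rightarrow> (nat \<Rightarrow> 'a) \<Rightarrow> nat \<Rightarrow> 'a" where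
  "ordered_prod G b 0 = b 0"
| "ordered_prod G b (Suc m) = ordered_prod G b m \<otimes>\<^bsub>G\<^esub> b (Suc m)"

definition productive :: "('a, 'b) monoid_scheme \<Rightarrow> 'a topology \<Rightarrow> (nat \<Rightarrow> 'a) \<Rightarrow> bool" where
  "productive G T b \<longleftrightarrow>
    range b \<subseteq> carrier G \<and> (\<exists>l. limitin T (ordered_prod G b) l sequentially)"

definition f_productive ::
    "('a, 'b) monoid_scheme \<Rightarrow> 'a topology \<Rightarrow> (nat \<Rightarrow> nat) \<Rightarrow> (nat \<Rightarrow> 'a) \<Rightarrow> bool" where
  "f_productive G T f a \<longleftrightarrow>
    range a \<subseteq> carrier G \<and> inj a \<and>
    (\<forall>z :: nat \<Rightarrow> int. (\<forall>n. \<bar>z n\<bar> \<le> int (f n)) \<longrightarrow>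
      productive G T (\<lambda>n. a n [^]\<^bsub>G\<^esub> z n))"

definition unconditionally_f_productive ::
    "('a, 'b) monoid_scheme \<Rightarrow> 'a topology \<Rightarrow> (nat \<Rightarrow> nat) \<Rightarrow> (nat \<Rightarrow> 'a) \<Rightarrow> bool" where
  "unconditionally_f_productive G T f a \<longleftrightarrow>
    range a \<subseteq> carrier G \<and> inj a \<and>
    (\<forall>\<phi> :: nat \<Rightarrow> nat. bij \<phi> \<longrightarrow> f_productive G T (f \<circ> \<phi>) (a \<circ> \<phi>))"

end

theory Submission
  imports Defs "HOL-Analysis.Analysis" "HOL-Algebra.Generated_Groups"
begin

text \<open>
  The closure of a countable subgroup of an \<open>\<omega>\<close>-bounded group is compact, so \<open>G\<close> may be assumed
  compact. It suffices to find distinct \<open>a n\<close> such that all finite products of the allowed powers of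
  far-out terms, in any order, are close to \<open>\<one>\<close>.

  If some \<open>x\<close> has infinite order, Bogoliubov's lemma shows that the topology induced on the powers of
  \<open>x\<close> is coarser than the Bohr topology of the integers. With a Hamel basis of the reals over the
  rationals and Kronecker's theorem this yields either a nontrivial one-parameter subgroup of \<open>G\<close>, and
  then \<open>a n\<close> is taken along a rapidly decreasing sequence of parameters, or the powers \<open>x [^] (n + 1)!\<close>
  eventually enter arbitrarily small subgroups.

  If \<open>G\<close> is a torsion group, a weak form of the Peter-Weyl theorem (an eigenspace of a convolution
  operator, with respect to the invariant mean) gives a nontrivial norm-continuous isometric
  representation of the identity component unless the latter is trivial. A torsion group has no
  one-parameter subgroups, so the kernel of the representation is a proper open subgroup of the
  component, which is absurd. Hence \<open>G\<close> has arbitrarily small open subgroups, and it is enough to find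
  a nontrivial sequence converging to \<open>\<one>\<close>. One exists in a metrizable quotient and is lifted by Zorn's
  lemma through quotients with ever smaller kernels.
\<close>

section \<open>Ultrafilters and limits in compact spaces\<close>

text \<open>Order and exponents of the factors are handled once, in \<open>small_tails\<close>;
  compactness turns this Cauchy condition into convergence. For \<open>x\<close> of infinite order,
  the obstacle is to find one-parameter subgroups although the continuous characters of the closure
  of the powers of \<open>x\<close> are not given. Once \<open>n \<mapsto> x [^] n\<close> is
  continuous for the Bohr topology, every rational coordinate functional of the reals that kills the
  rationals gives, multiplied by a real \<open>t\<close>, a point of the Bohr compactification, and
  these points form a one-parameter group. If all such groups are sent to \<open>\<one>\<close>,
  only the rational characters survive, so the powers look profinite; this is the origin of the
  factorials. In the torsion case the spectral argument stays within continuous functions, where the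
  inner product is incomplete; equicontinuity of the image of the convolution operator takes the
  place of completeness. The orders of the elements have no common bound in advance, hence an
  uncountable family of parameters from which two close ones with a common exponent are
  extracted.\<close>

definition ultra :: "'a filter \<Rightarrow> bool" where
  "ultra U \<longleftrightarrow> U \<noteq> bot \<and> (\<forall>P. eventually P U \<or> eventually (\<lambda>x. \<not> P x) U)"

lemma ultra_neq_bot: "ultra U \<Longrightarrow> U \<noteq> bot"
  by (simp add: ultra_def)

text \<open>A property that holds eventually for \<open>Inf \<C>\<close> is already witnessed by a
  finite subfamily, and a nonempty finite subfamily of a chain has its infimum in the chain.\<close>

lemma chain_Inf_not_bot:
  fixes \<C> :: "'a filter set"
  assumes "\<And>F G. F \<in> \<C> \<Longrightarrow> G \<in> \<C> \<Longrightarrow> F \<le> G \<or> G \<le> F" "bot \<notin> \<C>"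
  shows "Inf \<C> \<noteq> bot"
proof
  assume "Inf \<C> = bot"
  then have "eventually (\<lambda>_. False) (Inf \<C>)"
    by simp
  from eventually_Inf[THEN iffD1, OF this]
  obtain X where X: "X \<subseteq> \<C>" "finite X" "eventually (\<lambda>_. False) (Inf X)"
    by blast
  have "Inf X = Orderings.top \<or> Inf X \<in> \<C>"
    using X(2,1)
  proof (induction X rule: finite_induct)
    case (insert F X)
    then have F: "F \<in> \<C>" and "Inf X = Orderings.top \<or> Inf X \<in> \<C>" by auto
    then have "inf F (Inf X) = F \<or> inf F (Inf X) = Inf X \<and> Inf X \<in> \<C>"
      using assms(1)[of F "Inf X"] inf_absorb1[of F "Inf X"] inf_absorb2[of "Inf X" F] inf_top_right[of F]
      by metis
    then show ?case
      unfolding Inf_insert using F by auto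
  qed simp
  moreover have "Inf X = bot"
    using X(3) by (simp only: eventually_False)
  moreover have "(Orderings.top :: 'a filter) \<noteq> bot"
    unfolding top_eq_principal_UNIV principal_eq_bot_iff by simp
  ultimately show False
    using assms(2) by metis
qed

text \<open>Ultrafilters are the minimal filters above \<open>bot\<close>, so Zorn's lemma is
  applied to the reversed order. Intersecting a minimal filter with \<open>{x. P x}\<close> either
  gives \<open>bot\<close> or changes nothing, which is the dichotomy in
  \<open>ultra\<close>.\<close>

lemma ultra_exists:
  assumes "F \<noteq> bot"
  shows "\<exists>U. U \<le> F \<and> ultra U"
proof -
  define A where "A = {U. U \<le> F \<and> U \<noteq> bot}"
  have "\<exists>m\<in>A. \<forall>a\<in>A. m \<ge> a \<longrightarrow> a = m"
  proof (rule predicate_Zorn)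
    show "partial_order_on A (relation_of (\<ge>) A)"
      by (intro partial_order_on_relation_ofI) auto
  next
    fix C assume C: "C \<in> Chains (relation_of (\<ge>) A)"
    show "\<exists>u\<in>A. \<forall>a\<in>C. a \<ge> u"
    proof (cases "C = {}")
      case True
      then show ?thesis using assms by (auto simp: A_def)
    next
      case False
      have CC: "(F, G) \<in> relation_of (\<ge>) A \<or> (G, F) \<in> relation_of (\<ge>) A" if "F \<in> C" "G \<in> C" for F G
        using C that unfolding Chains_def by auto
      have *: "F \<in> A" if "F \<in> C" for F
        using CC[OF that that] unfolding relation_of_def by simp
      have "F \<le> G \<or> G \<le> F" if "F \<in> C" "G \<in> C" for F G
        using CC[OF that] unfolding relation_of_def by auto
      then have "Inf C \<noteq> bot"
        by (rule chain_Inf_not_bot) (use * in \<open>auto simp: A_def\<close>)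
      moreover have "Inf C \<le> F"
        using False * by (auto simp: A_def intro: Inf_lower2)
      ultimately show ?thesis
        by (auto simp: A_def intro!: bexI[of _ "Inf C"] Inf_lower)
    qed
  qed
  then obtain U where U: "U \<le> F" "U \<noteq> bot" and min: "\<And>V. V \<le> U \<Longrightarrow> V \<noteq> bot \<Longrightarrow> V = U"
    by (auto simp: A_def)
  have "eventually P U \<or> eventually (\<lambda>x. \<not> P x) U" for P
  proof (cases "inf U (principal {x. P x}) = bot")
    case True
    then have "eventually (\<lambda>_. False) (inf U (principal {x. P x}))" by simp
    then show ?thesis by (simp add: eventually_inf_principal)
  next
    case False
    then have "inf U (principal {x. P x}) = U" by (intro min) auto
    moreover have "eventually P (inf U (principal {x. P x}))"
      by (simp add: eventually_inf_principal)
    ultimately show ?thesis by simp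
  qed
  then show ?thesis using U by (auto simp: ultra_def)
qed

text \<open>If no point of \<open>K\<close> were a limit, each would have a neighbourhood that
  \<open>f\<close> eventually avoids, since \<open>U\<close> decides every predicate; finitely many
  of these neighbourhoods cover \<open>K\<close>.\<close>

lemma ultra_limitin_compact:
  assumes "ultra U" "compactin X K" "eventually (\<lambda>i. f i \<in> K) U"
  shows "\<exists>l\<in>K. limitin X f l U"
proof (rule ccontr)
  assume "\<not> ?thesis"
  then have "\<exists>W. openin X W \<and> l \<in> W \<and> \<not> eventually (\<lambda>i. f i \<in> W) U" if "l \<in> K" for l
    using that compactin_subset_topspace[OF assms(2)] by (auto simp: limitin_def)
  then obtain W where W: "\<And>l. l \<in> K \<Longrightarrow> openin X (W l) \<and> l \<in> W l \<and> \<not> eventually (\<lambda>i. f i \<in> W l) U"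
    by metis
  obtain L where L: "finite L" "L \<subseteq> W ` K" "K \<subseteq> \<Union>L"
    using compactinD[OF assms(2), of "W ` K"] W by fastforce
  have "eventually (\<lambda>i. \<forall>V\<in>L. f i \<notin> V) U"
    using L(1,2) W assms(1) by (auto simp: eventually_ball_finite_distrib ultra_def)
  then have "eventually (\<lambda>i. False) U"
    using assms(3) by eventually_elim (use L(3) in auto)
  then show False
    using assms(1) by (simp add: ultra_def)
qed

lemma ultra_tendsto_bounded:
  fixes f :: "'a \<Rightarrow> real"
  assumes "ultra U" "eventually (\<lambda>i. f i \<in> {a..b}) U"
  shows "\<exists>l\<in>{a..b}. (f \<longlongrightarrow> l) U"
  using ultra_limitin_compact[of U euclideanreal "{a..b}" f] assms by auto

section \<open>Topological groups\<close>

context hausdorff_topological_group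
begin

lemma openin_carrier: "openin T U \<Longrightarrow> U \<subseteq> carrier G"
  using openin_subset topspace_eq_carrier by metis

lemma openin_carrier_self [simp]: "openin T (carrier G)"
  using topspace_eq_carrier by (metis openin_topspace)

lemma continuous_map_mult [continuous_intros]:
  assumes "continuous_map X T f" "continuous_map X T g"
  shows "continuous_map X T (\<lambda>x. f x \<otimes> g x)"
proof -
  have "continuous_map X (prod_topology T T) (\<lambda>x. (f x, g x))"
    using assms by (simp add: continuous_map_pairedI)
  from continuous_map_compose[OF this continuous_mult] show ?thesis
    by (simp add: o_def)
qed

lemma continuous_map_inv [continuous_intros]:
  assumes "continuous_map X T f"
  shows "continuous_map X T (\<lambda>x. inv (f x))"
  using continuous_map_compose[OF assms continuous_inv] by (simp add: o_def)

lemma continuous_map_id' [continuous_intros]: "continuous_map T T (\<lambda>x. x)"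
  using continuous_map_id by (simp add: id_def)

lemma continuous_map_const' [continuous_intros]: "g \<in> carrier G \<Longrightarrow> continuous_map X T (\<lambda>x. g)"
  by (simp add: topspace_eq_carrier)

lemma openin_preimage:
  assumes "continuous_map T T f" "openin T U"
  shows "openin T {x \<in> carrier G. f x \<in> U}"
  using openin_continuous_map_preimage[OF assms] by (simp add: topspace_eq_carrier)

lemma closedin_preimage:
  assumes "continuous_map T T f" "closedin T U"
  shows "closedin T {x \<in> carrier G. f x \<in> U}"
  using closedin_continuous_map_preimage[OF assms] by (simp add: topspace_eq_carrier)

lemma continuous_map_left: "g \<in> carrier G \<Longrightarrow> continuous_map T T (\<lambda>x. g \<otimes> x)"
  by (intro continuous_map_mult continuous_map_const' continuous_map_id')

lemma continuous_map_right: "g \<in> carrier G \<Longrightarrow> continuous_map T T (\<lambda>x. x \<otimes> g)"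
  by (intro continuous_map_mult continuous_map_const' continuous_map_id')

lemma openin_left_translate:
  assumes "openin T U" "g \<in> carrier G"
  shows "openin T ((\<lambda>x. g \<otimes> x) ` U)"
proof -
  have "(\<lambda>x. g \<otimes> x) ` U = {x \<in> carrier G. inv g \<otimes> x \<in> U}"
    using openin_carrier[OF assms(1)] assms(2)
    by (auto simp: m_assoc[symmetric] intro!: image_eqI[where x="inv g \<otimes> x" for x])
  then show ?thesis
    using openin_preimage[OF continuous_map_left assms(1), of "inv g"] assms(2) by simp
qed

lemma openin_right_translate:
  assumes "openin T U" "g \<in> carrier G"
  shows "openin T ((\<lambda>x. x \<otimes> g) ` U)"
proof -
  have "(\<lambda>x. x \<otimes> g) ` U = {x \<in> carrier G. x \<otimes> inv g \<in> U}"
    using openin_carrier[OF assms(1)] assms(2)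
    by (auto simp: m_assoc intro!: image_eqI[where x="x \<otimes> inv g" for x])
  then show ?thesis
    using openin_preimage[OF continuous_map_right assms(1), of "inv g"] assms(2) by simp
qed

lemma mult_nhds:
  assumes "openin T W" "x \<in> carrier G" "y \<in> carrier G" "x \<otimes> y \<in> W"
  obtains U V where "openin T U" "openin T V" "x \<in> U" "y \<in> V" "\<And>u v. u \<in> U \<Longrightarrow> v \<in> V \<Longrightarrow> u \<otimes> v \<in> W"
proof -
  let ?P = "{z \<in> topspace (prod_topology T T). (case z of (x, y) \<Rightarrow> x \<otimes> y) \<in> W}"
  have "openin (prod_topology T T) ?P"
    by (rule openin_continuous_map_preimage[OF continuous_mult assms(1)])
  moreover have "(x, y) \<in> ?P"
    using assms by (simp add: topspace_eq_carrier)
  ultimately obtain U V where "openin T U" "openin T V" "x \<in> U" "y \<in> V" "U \<times> V \<subseteq> ?P"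
    unfolding openin_prod_topology_alt by meson
  note UV = this(1-4) and sub = this(5)
  have "u \<otimes> v \<in> W" if "u \<in> U" "v \<in> V" for u v
    using subsetD[OF sub, of "(u, v)"] that by simp
  with UV show thesis
    by (rule that)
qed

lemma one_nhd_shrink:
  assumes "openin T U" "\<one> \<in> U"
  obtains V where "openin T V" "\<one> \<in> V" "V \<subseteq> U" "\<And>u. u \<in> V \<Longrightarrow> inv u \<in> V"
    "\<And>u v. u \<in> V \<Longrightarrow> v \<in> V \<Longrightarrow> u \<otimes> v \<in> U"
proof -
  obtain A B where AB: "openin T A" "openin T B" "\<one> \<in> A" "\<one> \<in> B"
    "\<And>u v. u \<in> A \<Longrightarrow> v \<in> B \<Longrightarrow> u \<otimes> v \<in> U"
    using mult_nhds[OF assms(1), of \<one> \<one>] assms(2) by auto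
  define C where "C = A \<inter> B \<inter> U"
  have C: "openin T C" "\<one> \<in> C"
    using AB assms by (auto simp: C_def)
  define V where "V = C \<inter> {x \<in> carrier G. inv x \<in> C}"
  have "openin T V"
    unfolding V_def using C by (intro openin_Int openin_preimage continuous_intros)
  moreover have "\<one> \<in> V" using C by (simp add: V_def)
  moreover have "inv u \<in> V" if "u \<in> V" for u
    using that openin_carrier[OF C(1)] by (auto simp: V_def)
  ultimately show thesis
    using that[of V] AB by (auto simp: V_def C_def)
qed

text \<open>Four factors match the representation \<open>a - b + (c - d)\<close> that Bogoliubov's
  lemma delivers in \<open>bohr_nhd\<close>.\<close>

lemma one_nhd_shrink2:
  assumes "openin T U" "\<one> \<in> U"
  obtains V where "openin T V" "\<one> \<in> V" "V \<subseteq> U" "\<And>u. u \<in> V \<Longrightarrow> inv u \<in> V"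
    "\<And>a b c d. a \<in> V \<Longrightarrow> b \<in> V \<Longrightarrow> c \<in> V \<Longrightarrow> d \<in> V \<Longrightarrow> (a \<otimes> b) \<otimes> (c \<otimes> d) \<in> U"
proof -
  obtain V where V: "openin T V" "\<one> \<in> V" "V \<subseteq> U" "\<And>u. u \<in> V \<Longrightarrow> inv u \<in> V"
    "\<And>u v. u \<in> V \<Longrightarrow> v \<in> V \<Longrightarrow> u \<otimes> v \<in> U"
    using one_nhd_shrink[OF assms] by metis
  obtain W where W: "openin T W" "\<one> \<in> W" "W \<subseteq> V" "\<And>u. u \<in> W \<Longrightarrow> inv u \<in> W"
    "\<And>u v. u \<in> W \<Longrightarrow> v \<in> W \<Longrightarrow> u \<otimes> v \<in> V"
    using one_nhd_shrink[OF V(1,2)] by metis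
  show thesis
    by (rule that[of W]) (use V W in auto)
qed

text \<open>If \<open>y\<close> lies in the closure of a symmetric \<open>V\<close>, then the
  translate of \<open>V\<close> by \<open>y\<close> meets \<open>V\<close>, so \<open>y\<close> is a
  product of two elements of \<open>V\<close>.\<close>

lemma closure_in_nhd:
  assumes "openin T U" "\<one> \<in> U"
  obtains V where "openin T V" "\<one> \<in> V" "V \<subseteq> U" "T closure_of V \<subseteq> U"
proof -
  obtain V where V: "openin T V" "\<one> \<in> V" "V \<subseteq> U" "\<And>u. u \<in> V \<Longrightarrow> inv u \<in> V"
    "\<And>u v. u \<in> V \<Longrightarrow> v \<in> V \<Longrightarrow> u \<otimes> v \<in> U"
    using one_nhd_shrink[OF assms] by metis
  have "y \<in> U" if yV: "y \<in> T closure_of V" for y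
  proof -
    have y: "y \<in> carrier G"
      using yV by (metis closure_of_subset_topspace subsetD topspace_eq_carrier)
    have "openin T ((\<lambda>x. y \<otimes> x) ` V)" "y \<in> (\<lambda>x. y \<otimes> x) ` V"
      using V y by (auto intro!: openin_left_translate image_eqI[of _ _ \<one>])
    then obtain w where "w \<in> V" "w \<in> (\<lambda>x. y \<otimes> x) ` V"
      using yV unfolding in_closure_of by metis
    then obtain v where v: "v \<in> V" "y \<otimes> v \<in> V"
      by (elim imageE) simp
    have "(y \<otimes> v) \<otimes> inv v = y"
      using y v openin_carrier[OF V(1)] by (auto simp: m_assoc)
    then show ?thesis
      using V v by metis
  qed
  then have "T closure_of V \<subseteq> U" by blast
  with V(1-3) show thesis
    by (rule that)
qed

lemma subgroup_closure_of:
  assumes "subgroup H G"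
  shows "subgroup (T closure_of H) G"
proof -
  interpret H: subgroup H G by fact
  have sub: "T closure_of H \<subseteq> carrier G"
    using closure_of_subset_topspace topspace_eq_carrier by metis
  have H: "H \<subseteq> T closure_of H"
    by (simp add: closure_of_subset topspace_eq_carrier H.subset)
  have "continuous_map (prod_topology T T) T (\<lambda>z. fst z \<otimes> snd z)"
    using continuous_mult by (simp add: case_prod_beta')
  from continuous_map_image_closure_subset[OF this, of "H \<times> H"]
  have *: "x \<otimes> y \<in> T closure_of H" if "x \<in> T closure_of H" "y \<in> T closure_of H" for x y
  proof -
    have "(\<lambda>z. fst z \<otimes> snd z) ` (H \<times> H) \<subseteq> H"
      by auto
    then have "T closure_of (\<lambda>z. fst z \<otimes> snd z) ` (H \<times> H) \<subseteq> T closure_of H"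
      by (rule closure_of_mono)
    moreover have "(x, y) \<in> prod_topology T T closure_of (H \<times> H)"
      using that by (simp add: closure_of_Times)
    ultimately show ?thesis
      using \<open>_ ` (prod_topology T T closure_of (H \<times> H)) \<subseteq> _\<close> by fastforce
  qed
  have **: "inv x \<in> T closure_of H" if "x \<in> T closure_of H" for x
  proof -
    have "(\<lambda>z. inv z) ` H \<subseteq> H"
      by auto
    then have "T closure_of (\<lambda>z. inv z) ` H \<subseteq> T closure_of H"
      by (rule closure_of_mono)
    then show ?thesis
      using continuous_map_image_closure_subset[OF continuous_inv, of H] that by blast
  qed
  show ?thesis
  proof (rule subgroupI)
    show "T closure_of H \<noteq> {}" using H H.one_closed by blast
  qed (use sub * ** in auto)
qed

lemma subgroup_topological_group:
  assumes "subgroup H G"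
  shows "hausdorff_topological_group (G\<lparr>carrier := H\<rparr>) (subtopology T H)"
proof -
  interpret H: subgroup H G by fact
  interpret GH: group "G\<lparr>carrier := H\<rparr>" by (rule H.subgroup_is_group) (rule is_group)
  have inv: "inv\<^bsub>G\<lparr>carrier := H\<rparr>\<^esub> x = inv x" if "x \<in> H" for x
    using that assms m_inv_consistent by blast
  have sub: "topspace (subtopology T H) = H"
    using H.subset by (auto simp: topspace_eq_carrier)
  show ?thesis
  proof (unfold_locales)
    show "topspace (subtopology T H) = carrier (G\<lparr>carrier := H\<rparr>)"
      using sub by simp
    show "Hausdorff_space (subtopology T H)"
      by (simp add: Hausdorff Hausdorff_space_subtopology)
    have "continuous_map (subtopology (prod_topology T T) (H \<times> H)) T (\<lambda>(x, y). x \<otimes> y)"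
      by (rule continuous_map_from_subtopology[OF continuous_mult])
    then show "continuous_map (prod_topology (subtopology T H) (subtopology T H)) (subtopology T H)
        (\<lambda>(x, y). x \<otimes>\<^bsub>G\<lparr>carrier := H\<rparr>\<^esub> y)"
      by (auto simp: continuous_map_in_subtopology subtopology_Times)
    have "continuous_map (subtopology T H) (subtopology T H) (\<lambda>x. inv x)"
      using continuous_map_from_subtopology[OF continuous_inv, of H]
      by (auto simp: continuous_map_in_subtopology)
    then show "continuous_map (subtopology T H) (subtopology T H) (\<lambda>x. inv\<^bsub>G\<lparr>carrier := H\<rparr>\<^esub> x)"
      by (rule continuous_map_eq) (use inv in \<open>auto simp: sub\<close>)
  qed
qed

end

locale compact_topological_group = hausdorff_topological_group +
  assumes compact: "compact_space T"
begin

lemma closedin_compactin: "closedin T C \<Longrightarrow> compactin T C"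
  using compact closedin_compact_space by blast

lemma ultra_limitin:
  assumes "ultra U" "\<And>i. f i \<in> carrier G"
  obtains l where "l \<in> carrier G" "limitin T f l U"
  using ultra_limitin_compact[of U T "topspace T" f] assms compact
  by (auto simp: compact_space_def topspace_eq_carrier)

end

lemma (in hausdorff_topological_group) compact_subgroup:
  assumes "subgroup K G" "compactin T K"
  shows "compact_topological_group (G\<lparr>carrier := K\<rparr>) (subtopology T K)"
  using subgroup_topological_group[OF assms(1)] compact_space_subtopology[OF assms(2)]
  by (simp add: compact_topological_group_def compact_topological_group_axioms_def)

section \<open>Sequences all of whose tails have small products\<close>

text \<open>Lists record an arbitrary finite selection of indices in an arbitrary order, whereas
  \<open>ordered_prod\<close> only sees initial segments.\<close>

primrec lprod :: "('a, 'b) monoid_scheme \<Rightarrow> (nat \<Rightarrow> 'a) \<Rightarrow> nat list \<Rightarrow> 'a" where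
  "lprod G b [] = \<one>\<^bsub>G\<^esub>"
| "lprod G b (n # ns) = b n \<otimes>\<^bsub>G\<^esub> lprod G b ns"

text \<open>A Cauchy condition uniform in the exponents and in the order of the factors. Both
  uniformities are needed for it to survive a permutation of the sequence.\<close>

definition small_tails :: "('a, 'b) monoid_scheme \<Rightarrow> 'a topology \<Rightarrow> (nat \<Rightarrow> nat) \<Rightarrow> (nat \<Rightarrow> 'a) \<Rightarrow> bool" where
  "small_tails G T f a \<longleftrightarrow>
    (\<forall>U. openin T U \<and> \<one>\<^bsub>G\<^esub> \<in> U \<longrightarrow>
      (\<exists>m. \<forall>z :: nat \<Rightarrow> int. \<forall>ns. (\<forall>n. \<bar>z n\<bar> \<le> int (f n)) \<longrightarrow> distinct ns \<longrightarrow> set ns \<subseteq> {m..} \<longrightarrow>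
        lprod G (\<lambda>n. a n [^]\<^bsub>G\<^esub> z n) ns \<in> U))"

context group
begin

lemma lprod_closed: "(\<And>n. n \<in> set ns \<Longrightarrow> b n \<in> carrier G) \<Longrightarrow> lprod G b ns \<in> carrier G"
  by (induction ns) auto

lemma lprod_append:
  "(\<And>n. n \<in> set (ms @ ns) \<Longrightarrow> b n \<in> carrier G) \<Longrightarrow> lprod G b (ms @ ns) = lprod G b ms \<otimes> lprod G b ns"
  by (induction ms) (auto simp: lprod_closed m_assoc)

lemma lprod_map: "lprod G b (map \<phi> ns) = lprod G (b \<circ> \<phi>) ns"
  by (induction ns) auto

lemma ordered_prod_closed: "(\<And>n. b n \<in> carrier G) \<Longrightarrow> ordered_prod G b m \<in> carrier G"
  by (induction m) auto

lemma ordered_prod_split: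
  assumes "\<And>n. b n \<in> carrier G" "k \<le> m"
  shows "ordered_prod G b m = ordered_prod G b k \<otimes> lprod G b [Suc k..<Suc m]"
  using assms(2)
proof (induction rule: dec_induct)
  case base
  then show ?case by (simp add: ordered_prod_closed assms)
next
  case (step n)
  then have "lprod G b [Suc k..<Suc (Suc n)] = lprod G b [Suc k..<Suc n] \<otimes> b (Suc n)"
    using assms by (auto simp: lprod_append lprod_closed)
  with step show ?case
    by (simp add: ordered_prod_closed lprod_closed assms m_assoc del: upt_Suc)
qed

end

text \<open>Compactness supplies a limit \<open>l\<close> of the partial products along an
  ultrafilter. One late partial product close to \<open>l\<close>, multiplied by a small tail, keeps
  all later ones close to \<open>l\<close>, so the limit is an ordinary one.\<close>

lemma (in compact_topological_group) small_tails_imp_productive: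
  assumes "small_tails G T f a" "range a \<subseteq> carrier G" "inj a"
  shows "unconditionally_f_productive G T f a"
  unfolding unconditionally_f_productive_def f_productive_def
proof (intro conjI assms allI impI)
  fix \<phi> :: "nat \<Rightarrow> nat" assume \<phi>: "bij \<phi>"
  show "range (a \<circ> \<phi>) \<subseteq> carrier G" using assms by auto
  show "inj (a \<circ> \<phi>)" using assms \<phi> by (auto simp: bij_def intro: inj_compose)
  fix z :: "nat \<Rightarrow> int" assume z: "\<forall>n. \<bar>z n\<bar> \<le> int ((f \<circ> \<phi>) n)"
  define b where "b n = (a \<circ> \<phi>) n [^] z n" for n
  have b: "b n \<in> carrier G" for n
    using assms by (auto simp: b_def)
  define p where "p = ordered_prod G b"
  have p: "p n \<in> carrier G" for n
    by (simp add: p_def ordered_prod_closed b)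
  obtain \<U> where \<U>: "\<U> \<le> sequentially" "ultra \<U>"
    using ultra_exists[of "sequentially"] by auto
  obtain l where l: "l \<in> carrier G" "limitin T p l \<U>"
    using ultra_limitin[OF \<U>(2), of p] p by metis
  have "limitin T p l sequentially"
    unfolding limitin_def
  proof (intro conjI allI impI)
    show "l \<in> topspace T" using l by (simp add: topspace_eq_carrier)
    fix W assume W: "openin T W \<and> l \<in> W"
    obtain V U where VU: "openin T V" "openin T U" "l \<in> V" "\<one> \<in> U"
      "\<And>u v. u \<in> V \<Longrightarrow> v \<in> U \<Longrightarrow> u \<otimes> v \<in> W"
      using mult_nhds[of W l \<one>] W l by auto
    obtain m where m: "\<And>z ns. (\<forall>n. \<bar>z n\<bar> \<le> int (f n)) \<Longrightarrow> distinct ns \<Longrightarrow> set ns \<subseteq> {m..} \<Longrightarrow>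
        lprod G (\<lambda>n. a n [^] (z n :: int)) ns \<in> U"
      using assms(1) VU unfolding small_tails_def by meson
    \<comment> \<open>Beyond some position the permuted sequence uses only indices at least
      \<open>m\<close>.\<close>
    have "finite (\<phi> -` {..<m})"
      using \<phi> by (simp add: bij_def finite_vimageI)
    then obtain m1 where m1: "\<phi> -` {..<m} \<subseteq> {..<m1}"
      by (metis finite_nat_iff_bounded)
    have "eventually (\<lambda>k. p k \<in> V) \<U>"
      using l VU by (simp add: limitin_def)
    moreover have "eventually (\<lambda>k. k \<ge> m1) \<U>"
      using \<U>(1) eventually_ge_at_top filter_leD by blast
    ultimately have "\<exists>k. p k \<in> V \<and> k \<ge> m1"
      using eventually_happens'[OF ultra_neq_bot[OF \<U>(2)] eventually_conj] by blast
    then obtain k where k: "p k \<in> V" "k \<ge> m1" by blast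
    have "p j \<in> W" if "j \<ge> k" for j
    proof -
      \<comment> \<open>The exponents are given by position in the permuted sequence;
        \<open>z'\<close> reindexes them by the original index, where the bound is
        \<open>f\<close>.\<close>
      define z' where "z' = z \<circ> inv_into UNIV \<phi>"
      have z': "\<bar>z' n\<bar> \<le> int (f n)" for n
        using z \<phi> by (metis z'_def bij_inv_eq_iff comp_apply)
      have eq: "b = (\<lambda>n. a n [^] z' n) \<circ> \<phi>"
        using \<phi> by (auto simp: b_def z'_def bij_def)
      have "lprod G b [Suc k..<Suc j] = lprod G (\<lambda>n. a n [^] z' n) (map \<phi> [Suc k..<Suc j])"
        unfolding eq lprod_map ..
      also have "\<dots> \<in> U"
      proof (rule m)
        show "distinct (map \<phi> [Suc k..<Suc j])"
          using \<phi> inj_on_subset[of \<phi> UNIV] by (auto simp: distinct_map bij_def simp del: upt_Suc)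
        have "\<phi> i \<ge> m" if "i \<ge> Suc k" for i
          using m1 k(2) that by (meson Suc_leD leD le_trans lessThan_iff linorder_le_less_linear subsetD vimageI)
        then show "set (map \<phi> [Suc k..<Suc j]) \<subseteq> {m..}"
          by auto
      qed (use z' in auto)
      finally show ?thesis
        using VU(5) k(1) ordered_prod_split[of b k j] b that by (auto simp: p_def)
    qed
    then show "eventually (\<lambda>j. p j \<in> W) sequentially"
      by (auto simp: eventually_sequentially)
  qed
  then show "productive G T (\<lambda>n. (a \<circ> \<phi>) n [^] z n)"
    using b unfolding productive_def p_def b_def by auto
qed

text \<open>A subgroup absorbs all powers and all products, so a subgroup inside \<open>U\<close>
  that contains a tail of \<open>a\<close> settles the condition for every \<open>f\<close> at
  once.\<close>

lemma (in group) small_tails_subgroups: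
  assumes a: "range a \<subseteq> carrier G"
    and *: "\<And>U. openin T U \<Longrightarrow> \<one> \<in> U \<Longrightarrow> \<exists>H. subgroup H G \<and> H \<subseteq> U \<and> eventually (\<lambda>n. a n \<in> H) sequentially"
  shows "small_tails G T f a"
  unfolding small_tails_def
proof (intro allI impI)
  fix U assume "openin T U \<and> \<one> \<in> U"
  then obtain H m where H: "subgroup H G" "H \<subseteq> U" and m: "\<And>n. n \<ge> m \<Longrightarrow> a n \<in> H"
    using *[of U] unfolding eventually_sequentially by blast
  have pow: "a n [^] (k::int) \<in> H" if "n \<ge> m" for n k
    using subgroup_int_pow_closed[OF H(1) m[OF that]] .
  have "lprod G (\<lambda>n. a n [^] z n) ns \<in> H" if "set ns \<subseteq> {m..}" for ns and z :: "nat \<Rightarrow> int"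
    using that by (induction ns) (auto simp: pow subgroup.one_closed[OF H(1)] subgroup.m_closed[OF H(1)])
  then show "\<exists>m. \<forall>z :: nat \<Rightarrow> int. \<forall>ns. (\<forall>n. \<bar>z n\<bar> \<le> int (f n)) \<longrightarrow> distinct ns \<longrightarrow> set ns \<subseteq> {m..} \<longrightarrow>
        lprod G (\<lambda>n. a n [^] z n) ns \<in> U"
    using H(2) by blast
qed

lemma (in hausdorff_topological_group) productive_from_subgroup:
  assumes K: "subgroup K G" and a: "unconditionally_f_productive (G\<lparr>carrier := K\<rparr>) (subtopology T K) f a"
  shows "unconditionally_f_productive G T f a"
proof -
  have sub: "K \<subseteq> carrier G" using K by (simp add: subgroup.subset)
  have prod: "ordered_prod (G\<lparr>carrier := K\<rparr>) b m = ordered_prod G b m" for b m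
    by (induction m) auto
  have productive: "productive G T b" if "productive (G\<lparr>carrier := K\<rparr>) (subtopology T K) b" for b
    using that sub unfolding productive_def by (auto simp: limitin_subtopology prod[abs_def])
  have pow: "a n [^]\<^bsub>G\<lparr>carrier := K\<rparr>\<^esub> (k::int) = a n [^] k" for n k
  proof -
    have "a n \<in> K" using a by (auto simp: unconditionally_f_productive_def)
    then show ?thesis using int_pow_consistent[OF K] by metis
  qed
  show ?thesis
    using a sub unfolding unconditionally_f_productive_def f_productive_def
    by (auto simp: pow intro: productive)
qed

section \<open>Compact groups with small open subgroups\<close>

text \<open>The finite intersection property is automatic here: a nonempty finite subfamily of a
  chain has its intersection in the chain.\<close>

lemma compact_space_chain_Inter:
  assumes "compact_space X" "\<C> \<noteq> {}" "\<And>C. C \<in> \<C> \<Longrightarrow> closedin X C \<and> C \<noteq> {}"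
    and chain: "\<And>C D. C \<in> \<C> \<Longrightarrow> D \<in> \<C> \<Longrightarrow> C \<subseteq> D \<or> D \<subseteq> C"
  shows "\<Inter>\<C> \<noteq> {}"
proof -
  have "\<Inter>F \<noteq> {}" if "finite F" "F \<subseteq> \<C>" for F
  proof (cases "F = {}")
    case False
    have "\<Inter>F \<in> \<C>"
      using that(1) False that(2)
    proof (induction F rule: finite_ne_induct)
      case (insert C F)
      then have "C \<in> \<C>" "\<Inter>F \<in> \<C>" by auto
      then have "C \<inter> \<Inter>F = C \<or> C \<inter> \<Inter>F = \<Inter>F"
        using chain by blast
      with \<open>C \<in> \<C>\<close> \<open>\<Inter>F \<in> \<C>\<close> show ?case
        by auto
    qed auto
    then show ?thesis using assms(3) by auto
  qed auto
  then show ?thesis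
    using assms(1)[unfolded compact_space_fip, rule_format, of \<C>] assms(3) by auto
qed

context group
begin

lemma left_coset_rebase:
  assumes "subgroup N G" "b \<in> carrier G" "y \<in> (\<lambda>x. b \<otimes> x) ` N"
  shows "(\<lambda>x. b \<otimes> x) ` N = (\<lambda>x. y \<otimes> x) ` N"
proof -
  interpret N: subgroup N G by fact
  obtain n where n: "n \<in> N" "y = b \<otimes> n" using assms(3) by blast
  have "b \<otimes> x \<in> (\<lambda>x. y \<otimes> x) ` N" if "x \<in> N" for x
    using n that assms(2) N.mem_carrier
    by (intro image_eqI[of _ _ "inv n \<otimes> x"]) (auto simp: m_assoc m_assoc[of n "inv n" x, symmetric])
  moreover have "y \<otimes> x \<in> (\<lambda>x. b \<otimes> x) ` N" if "x \<in> N" for x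
    using n that assms(2) N.subset
    by (intro image_eqI[of _ _ "n \<otimes> x"]) (auto simp: m_assoc subset_iff)
  ultimately show ?thesis by blast
qed

lemma mem_left_coset: "subgroup N G \<Longrightarrow> b \<in> carrier G \<Longrightarrow> b \<in> (\<lambda>x. b \<otimes> x) ` N"
  using subgroup.one_closed by (force intro: image_eqI[of _ _ \<one>])

lemma left_coset_Int_subgroup:
  assumes "subgroup N G" "subgroup Q G" "b \<in> Q"
  shows "(\<lambda>x. b \<otimes> x) ` N \<inter> Q = (\<lambda>x. b \<otimes> x) ` (N \<inter> Q)"
proof -
  interpret N: subgroup N G by fact
  interpret Q: subgroup Q G by fact
  have "x \<in> Q" if "x \<in> N" "b \<otimes> x \<in> Q" for x
  proof -
    have "inv b \<otimes> (b \<otimes> x) \<in> Q"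
      using that assms(3) by auto
    moreover have "inv b \<otimes> (b \<otimes> x) = x"
      using that assms(3) N.mem_carrier Q.mem_carrier by (simp add: m_assoc[symmetric])
    ultimately show ?thesis by simp
  qed
  then show ?thesis using assms(3) by auto
qed

end

context hausdorff_topological_group
begin

lemma open_subgroup_closed:
  assumes "subgroup H G" "openin T H"
  shows "closedin T H"
proof -
  interpret H: subgroup H G by fact
  have "carrier G - H = (\<Union>g\<in>carrier G - H. (\<lambda>x. g \<otimes> x) ` H)"
  proof (intro equalityI subsetI)
    fix g assume "g \<in> carrier G - H"
    then show "g \<in> (\<Union>g\<in>carrier G - H. (\<lambda>x. g \<otimes> x) ` H)"
      using mem_left_coset[OF assms(1), of g] by blast
  next
    fix y assume "y \<in> (\<Union>g\<in>carrier G - H. (\<lambda>x. g \<otimes> x) ` H)"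
    then obtain g h where gh: "g \<in> carrier G - H" "h \<in> H" "y = g \<otimes> h" by blast
    have "g = y \<otimes> inv h" using gh H.mem_carrier by (simp add: m_assoc)
    then show "y \<in> carrier G - H"
      using gh H.mem_carrier by (metis DiffD1 DiffD2 DiffI H.m_closed H.m_inv_closed m_closed)
  qed
  then have "openin T (carrier G - H)"
    using assms(2) openin_left_translate by (metis (no_types, lifting) DiffD1 imageE openin_Union)
  then show ?thesis
    using H.subset by (simp add: closedin_def topspace_eq_carrier)
qed

lemma openin_mult_right_set:
  assumes "openin T Q" "N \<subseteq> carrier G"
  shows "openin T {q \<otimes> n |q n. q \<in> Q \<and> n \<in> N}"
proof -
  have "{q \<otimes> n |q n. q \<in> Q \<and> n \<in> N} = (\<Union>n\<in>N. (\<lambda>x. x \<otimes> n) ` Q)" by blast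
  then show ?thesis
    using assms by (auto intro!: openin_right_translate)
qed

lemma closedin_left_translate:
  assumes "closedin T U" "g \<in> carrier G"
  shows "closedin T ((\<lambda>x. g \<otimes> x) ` U)"
proof -
  have "(\<lambda>x. g \<otimes> x) ` U = {x \<in> carrier G. inv g \<otimes> x \<in> U}"
    using closedin_subset[OF assms(1)] assms(2)
    by (auto simp: m_assoc[symmetric] topspace_eq_carrier intro!: image_eqI[where x="inv g \<otimes> x" for x])
  then show ?thesis
    using closedin_preimage[OF continuous_map_left assms(1), of "inv g"] assms(2) by simp
qed

lemma Hausdorff_separate_one:
  assumes "y \<in> carrier G" "y \<noteq> \<one>"
  obtains U where "openin T U" "\<one> \<in> U" "y \<notin> U"
  using Hausdorff assms unfolding Hausdorff_space_def topspace_eq_carrier disjnt_def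
  by (metis disjoint_iff one_closed)

end

context compact_topological_group
begin

lemma finite_if_open_one:
  assumes "openin T {\<one>}"
  shows "finite (carrier G)"
proof -
  have "openin T {x}" if "x \<in> carrier G" for x
    using openin_left_translate[OF assms that] that by simp
  moreover have "compactin T (carrier G)"
    using compact by (simp add: compact_space_def topspace_eq_carrier)
  ultimately have "\<exists>F. finite F \<and> F \<subseteq> (\<lambda>x. {x}) ` carrier G \<and> carrier G \<subseteq> \<Union>F"
    by (intro compactinD) auto
  then obtain F where F: "finite F" "F \<subseteq> (\<lambda>x. {x}) ` carrier G" "carrier G \<subseteq> \<Union>F"
    by blast
  then have "finite (\<Union>F)" by (intro finite_Union) auto
  then show ?thesis using F(3) finite_subset by blast
qed

text \<open>Otherwise the sets \<open>C - W\<close> form a chain of nonempty closed sets, and a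
  common point of them would lie in \<open>\<Inter>\<C>\<close> but outside
  \<open>W\<close>.\<close>

lemma chain_subset_open:
  assumes "\<C> \<noteq> {}" "\<And>C. C \<in> \<C> \<Longrightarrow> closedin T C" "\<And>C D. C \<in> \<C> \<Longrightarrow> D \<in> \<C> \<Longrightarrow> C \<subseteq> D \<or> D \<subseteq> C"
    and "openin T W" "\<Inter>\<C> \<subseteq> W"
  shows "\<exists>C\<in>\<C>. C \<subseteq> W"
proof (rule ccontr)
  assume *: "\<not> ?thesis"
  have chain: "C \<subseteq> D \<or> D \<subseteq> C" if "C \<in> (\<lambda>C. C - W) ` \<C>" "D \<in> (\<lambda>C. C - W) ` \<C>" for C D
  proof -
    obtain C' D' where "C = C' - W" "D = D' - W" "C' \<in> \<C>" "D' \<in> \<C>" using \<open>C \<in> _\<close> \<open>D \<in> _\<close> by auto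
    then show ?thesis using assms(3)[of C' D'] by auto
  qed
  have "\<Inter>((\<lambda>C. C - W) ` \<C>) \<noteq> {}"
  proof (rule compact_space_chain_Inter[OF compact])
    show "closedin T C \<and> C \<noteq> {}" if "C \<in> (\<lambda>C. C - W) ` \<C>" for C
      using * that assms(2,4) by (auto intro!: closedin_diff)
  qed (use assms chain in auto)
  then show False using assms(1,5) by auto
qed

text \<open>An element of the family below encodes a closed subgroup \<open>N = c 0\<close> together with a
  sequence \<open>c (Suc n)\<close> of left cosets converging to @N@. A minimal element has trivial \<open>N\<close>.\<close>

lemma profinite_sequence:
  assumes inf: "infinite (carrier G)"
    and small: "\<And>U. openin T U \<Longrightarrow> \<one> \<in> U \<Longrightarrow> \<exists>H. subgroup H G \<and> openin T H \<and> H \<subseteq> U"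
  shows "\<exists>a. range a \<subseteq> carrier G \<and> inj a \<and>
    (\<forall>U. openin T U \<longrightarrow> \<one> \<in> U \<longrightarrow> (\<exists>H. subgroup H G \<and> H \<subseteq> U \<and> eventually (\<lambda>n::nat. a n \<in> H) sequentially))"
proof -
  have shrink: "\<exists>H'. (subgroup H' G \<and> openin T H') \<and> H' \<subset> H" if H: "subgroup H G \<and> openin T H" for H
  proof -
    have "\<one> \<in> H" using H by (simp add: subgroup.one_closed)
    moreover have "H \<noteq> {\<one>}" using H finite_if_open_one inf by auto
    ultimately obtain y where y: "y \<in> H" "y \<noteq> \<one>" by blast
    obtain U where U: "openin T U" "\<one> \<in> U" "y \<notin> U"
      using Hausdorff_separate_one[of y] y H openin_carrier by blast
    then obtain H' where "subgroup H' G" "openin T H'" "H' \<subseteq> U \<inter> H"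
      using small[of "U \<inter> H"] H \<open>\<one> \<in> H\<close> by blast
    then show ?thesis using U y by blast
  qed
  \<comment> \<open>The shells \<open>Q n - Q (Suc n)\<close> of this strictly descending chain are
    disjoint. Keeping the n-th coset inside the n-th shell makes the final sequence
    injective.\<close>
  have "\<exists>Q. \<forall>n::nat. (subgroup (Q n) G \<and> openin T (Q n)) \<and> Q (Suc n) \<subset> Q n"
  proof (rule dependent_nat_choice)
    show "\<exists>H. subgroup H G \<and> openin T H" using subgroup_self openin_carrier_self by blast
  qed (use shrink in blast)
  then obtain Q :: "nat \<Rightarrow> 'a set"
    where Q: "\<And>n. subgroup (Q n) G" "\<And>n. openin T (Q n)" "\<And>n. Q (Suc n) \<subset> Q n" by metis
  have Qanti: "Q n \<subseteq> Q m" if "m \<le> n" for m n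
    using that Q(3) by (metis lift_Suc_antimono_le psubset_imp_subset)
  \<comment> \<open>The last clause expresses convergence in the coset space: a left coset of
    \<open>c 0\<close> meets the open subgroup \<open>H\<close> exactly when it is contained in the
    product set of \<open>H\<close> and \<open>c 0\<close>.\<close>
  define A where "A = {c :: nat \<Rightarrow> 'a set. closedin T (c 0) \<and> subgroup (c 0) G \<and>
     (\<forall>n. (\<exists>b\<in>carrier G. c (Suc n) = (\<lambda>x. b \<otimes> x) ` c 0) \<and> c (Suc n) \<subseteq> Q n - Q (Suc n)) \<and>
     (\<forall>H. subgroup H G \<longrightarrow> openin T H \<longrightarrow> eventually (\<lambda>n. c (Suc n) \<inter> H \<noteq> {}) sequentially)}"
  have A0: "closedin T (c 0)" "subgroup (c 0) G" if "c \<in> A" for c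
    using that by (simp_all add: A_def)
  have Acoset: "\<exists>b\<in>carrier G. c (Suc n) = (\<lambda>x. b \<otimes> x) ` c 0" if "c \<in> A" for c n
    using that by (simp add: A_def)
  have rebase: "c (Suc n) = (\<lambda>x. y \<otimes> x) ` c 0" if "c \<in> A" "y \<in> c (Suc n)" for c n y
    using Acoset[OF that(1), of n] A0(2)[OF that(1)] left_coset_rebase that(2) by metis
  have nonempty: "c (Suc n) \<noteq> {}" if "c \<in> A" for c n
    using Acoset[OF that, of n] A0(2)[OF that] subgroup.one_closed by fastforce
  have closed: "closedin T (c n)" if "c \<in> A" for c n
  proof (cases n)
    case (Suc k)
    then show ?thesis using Acoset[OF that, of k] A0(1)[OF that] closedin_left_translate by metis
  qed (use A0 that in auto)
  \<comment> \<open>The initial coset sequence lives over the metrizable quotient by the intersection of the \<open>Q n\<close>.\<close>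
  have "\<exists>c. c \<in> A"
  proof -
    define N where "N = (\<Inter>n. Q n)"
    have N: "closedin T N" "subgroup N G"
      unfolding N_def using Q open_subgroup_closed by (auto intro!: closedin_Inter subgroups_Inter)
    have "\<forall>n. \<exists>b. b \<in> Q n - Q (Suc n)" using Q(3) by blast
    then obtain b where b: "\<And>n. b n \<in> Q n - Q (Suc n)" by metis
    have bc: "b n \<in> carrier G" for n using b Q(2) openin_carrier by blast
    define c where "c = case_nat N (\<lambda>n. (\<lambda>x. b n \<otimes> x) ` N)"
    have "b n \<otimes> x \<in> Q n - Q (Suc n)" if "x \<in> N" for n x
    proof -
      have x: "x \<in> Q n" "x \<in> Q (Suc n)" "x \<in> carrier G" using that Q(2) openin_carrier by (auto simp: N_def)
      have "(b n \<otimes> x) \<otimes> inv x = b n" using x bc by (simp add: m_assoc)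
      then have "b n \<otimes> x \<notin> Q (Suc n)"
        using x b Q(1) by (metis DiffD2 subgroup.m_closed subgroup.m_inv_closed)
      then show ?thesis using x b Q(1) subgroup.m_closed by fast
    qed
    moreover have "eventually (\<lambda>n. (\<lambda>x. b n \<otimes> x) ` N \<inter> H \<noteq> {}) sequentially"
      if H: "subgroup H G" "openin T H" for H
    proof -
      \<comment> \<open>The product set of \<open>H\<close> and \<open>N\<close> is open and
        contains \<open>N\<close>, the intersection of the chain, so it contains some
        \<open>Q k\<close> and with it all later \<open>b n\<close>.\<close>
      have "\<exists>C\<in>range Q. C \<subseteq> {q \<otimes> n |q n. q \<in> H \<and> n \<in> N}"
      proof (rule chain_subset_open)
        show "C \<subseteq> D \<or> D \<subseteq> C" if "C \<in> range Q" "D \<in> range Q" for C D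
          using that Qanti by (metis imageE linorder_le_cases)
        show "openin T {q \<otimes> n |q n. q \<in> H \<and> n \<in> N}"
          using openin_mult_right_set[OF H(2)] N(2) subgroup.subset by blast
        show "\<Inter> (range Q) \<subseteq> {q \<otimes> n |q n. q \<in> H \<and> n \<in> N}"
        proof
          fix x assume "x \<in> \<Inter> (range Q)"
          then have "x \<in> N" by (simp add: N_def)
          then have "x \<in> N" "x = \<one> \<otimes> x" using subgroup.mem_carrier[OF N(2)] by simp_all
          then show "x \<in> {q \<otimes> n |q n. q \<in> H \<and> n \<in> N}"
            using subgroup.one_closed[OF H(1)] by blast
        qed
      qed (use Q open_subgroup_closed in auto)
      then obtain k where k: "Q k \<subseteq> {q \<otimes> n |q n. q \<in> H \<and> n \<in> N}" by auto
      have "(\<lambda>x. b n \<otimes> x) ` N \<inter> H \<noteq> {}" if "n \<ge> k" for n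
      proof -
        have "b n \<in> Q k" using b[of n] Qanti[OF that] by auto
        then obtain q x where q: "b n = q \<otimes> x" "q \<in> H" "x \<in> N" using k by blast
        then have "b n \<otimes> inv x = q" "inv x \<in> N"
          using H(1) N(2) by (auto simp: m_assoc subgroup.mem_carrier subgroup.m_inv_closed)
        then show ?thesis using q by blast
      qed
      then show ?thesis by (auto simp: eventually_sequentially)
    qed
    ultimately have "c \<in> A"
      using N bc by (auto simp: A_def c_def)
    then show ?thesis by blast
  qed
  then obtain c0 where c0: "c0 \<in> A" by blast
  have "\<exists>m\<in>A. \<forall>a\<in>A. m \<ge> a \<longrightarrow> a = m"
  proof (rule predicate_Zorn)
    show "partial_order_on A (relation_of (\<ge>) A)"
      by (intro partial_order_on_relation_ofI) auto
  next
    fix C assume C: "C \<in> Chains (relation_of (\<ge>) A)"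
    show "\<exists>u\<in>A. \<forall>a\<in>C. a \<ge> u"
    proof (cases "C = {}")
      case True
      then show ?thesis using c0 by auto
    next
      case False
      have CC: "(c, d) \<in> relation_of (\<ge>) A \<or> (d, c) \<in> relation_of (\<ge>) A" if "c \<in> C" "d \<in> C" for c d
        using C that unfolding Chains_def by auto
      have CA: "c \<in> A" if "c \<in> C" for c
        using CC[OF that that] unfolding relation_of_def by simp
      have chain: "c n \<subseteq> d n \<or> d n \<subseteq> c n" if "c \<in> C" "d \<in> C" for c d n
        using CC[OF that] unfolding relation_of_def by (auto simp: le_fun_def)
      \<comment> \<open>The lower bound of a chain is the pointwise intersection. Compactness keeps
        its terms nonempty, and any common element represents all the cosets involved, so each term
        is again a coset of \<open>d 0\<close>.\<close>
      define d where "d n = (\<Inter>c\<in>C. c n)" for n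
      have d0: "closedin T (d 0)" "subgroup (d 0) G"
        unfolding d_def using False CA by (auto intro!: closedin_Inter subgroups_Inter simp: A_def)
      have d0sub: "d 0 \<subseteq> c 0" if "c \<in> C" for c
        using that by (auto simp: d_def)
      have dn: "\<exists>b\<in>d (Suc n). True" for n
      proof -
        have "\<Inter>((\<lambda>c. c (Suc n)) ` C) \<noteq> {}"
        proof (rule compact_space_chain_Inter[OF compact])
          show "D \<subseteq> E \<or> E \<subseteq> D" if "D \<in> (\<lambda>c. c (Suc n)) ` C" "E \<in> (\<lambda>c. c (Suc n)) ` C" for D E
            using that chain by blast
        qed (use False CA nonempty closed in auto)
        then show ?thesis by (auto simp: d_def)
      qed
      have dcoset: "d (Suc n) = (\<lambda>x. b \<otimes> x) ` d 0" "b \<in> carrier G" if b: "b \<in> d (Suc n)" for n b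
      proof -
        obtain c1 where c1: "c1 \<in> C" using False by blast
        show bc: "b \<in> carrier G"
          using b c1 closed[OF CA[OF c1], of "Suc n"] closedin_subset by (fastforce simp: d_def topspace_eq_carrier)
        have "c (Suc n) = (\<lambda>x. b \<otimes> x) ` c 0" if "c \<in> C" for c
          using rebase[OF CA[OF that]] b that by (auto simp: d_def)
        then have "d (Suc n) = (\<Inter>c\<in>C. (\<lambda>x. b \<otimes> x) ` c 0)"
          by (auto simp: d_def)
        also have "\<dots> = (\<lambda>x. b \<otimes> x) ` (\<Inter>c\<in>C. c 0)"
        proof (rule image_INT[symmetric, of _ "carrier G"])
          show "inj_on ((\<otimes>) b) (carrier G)" using bc by (rule inj_on_cmult)
          show "\<forall>c\<in>C. c 0 \<subseteq> carrier G" using CA subgroup.subset by (fastforce simp: A_def)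
        qed (rule c1)
        finally show "d (Suc n) = (\<lambda>x. b \<otimes> x) ` d 0" by (simp add: d_def)
      qed
      have "eventually (\<lambda>n. d (Suc n) \<inter> H \<noteq> {}) sequentially" if H: "subgroup H G" "openin T H" for H
      proof -
        \<comment> \<open>Convergence passes to the intersection: one \<open>c 0\<close> of the
          chain already lies in the product set of \<open>H\<close> and \<open>d 0\<close>. Given
          \<open>q\<close> in \<open>c (Suc n) \<inter> H\<close>, a representative \<open>b\<close>
          of \<open>d (Suc n)\<close> has the form \<open>q \<otimes> (h \<otimes> y)\<close>, and
          \<open>b \<otimes> inv y = q \<otimes> h\<close> is the required common element.\<close>
        have "\<exists>D\<in>(\<lambda>c. c 0) ` C. D \<subseteq> {q \<otimes> n |q n. q \<in> H \<and> n \<in> d 0}"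
        proof (rule chain_subset_open)
          show "D \<subseteq> E \<or> E \<subseteq> D" if "D \<in> (\<lambda>c. c 0) ` C" "E \<in> (\<lambda>c. c 0) ` C" for D E
            using that chain by blast
          show "openin T {q \<otimes> n |q n. q \<in> H \<and> n \<in> d 0}"
            using openin_mult_right_set[OF H(2)] d0(2) subgroup.subset by blast
          show "\<Inter> ((\<lambda>c. c 0) ` C) \<subseteq> {q \<otimes> n |q n. q \<in> H \<and> n \<in> d 0}"
          proof
            fix x assume "x \<in> \<Inter> ((\<lambda>c. c 0) ` C)"
            then have "x \<in> d 0" by (simp add: d_def)
            then have "x \<in> d 0" "x = \<one> \<otimes> x" using subgroup.mem_carrier[OF d0(2)] by simp_all
            then show "x \<in> {q \<otimes> n |q n. q \<in> H \<and> n \<in> d 0}"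
              using subgroup.one_closed[OF H(1)] by blast
          qed
        qed (use False CA closed in auto)
        then obtain c where c: "c \<in> C" "c 0 \<subseteq> {q \<otimes> n |q n. q \<in> H \<and> n \<in> d 0}" by auto
        have "eventually (\<lambda>n. c (Suc n) \<inter> H \<noteq> {}) sequentially"
          using CA[OF c(1)] H by (simp add: A_def)
        then show ?thesis
        proof eventually_elim
          case (elim n)
          then obtain q where q: "q \<in> c (Suc n)" "q \<in> H" by blast
          obtain b where b: "b \<in> d (Suc n)" using dn by blast
          have "b \<in> c (Suc n)" using b c by (auto simp: d_def)
          then obtain x where "b = q \<otimes> x" "x \<in> c 0"
            using rebase[OF CA[OF c(1)] q(1)] by blast
          then obtain h y where hy: "b = q \<otimes> (h \<otimes> y)" "h \<in> H" "y \<in> d 0" using c by blast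
          have carr: "q \<in> carrier G" "h \<in> carrier G" "y \<in> carrier G"
            using q hy H(1) d0(2) by (auto simp: subgroup.mem_carrier)
          have "b \<otimes> inv y = q \<otimes> h" "inv y \<in> d 0"
            using hy carr d0(2) by (auto simp: m_assoc subgroup.m_inv_closed)
          moreover have "q \<otimes> h \<in> H" using q hy H(1) by (simp add: subgroup.m_closed)
          moreover have "b \<otimes> inv y \<in> d (Suc n)" using dcoset(1)[OF b] \<open>inv y \<in> d 0\<close> by blast
          ultimately show ?case by auto
        qed
      qed
      moreover have "(\<exists>b\<in>carrier G. d (Suc n) = (\<lambda>x. b \<otimes> x) ` d 0)" for n
        using dn[of n] dcoset by blast
      moreover have "d (Suc n) \<subseteq> Q n - Q (Suc n)" for n
      proof -
        obtain c where c: "c \<in> C" using False by blast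
        then have "d (Suc n) \<subseteq> c (Suc n)" by (auto simp: d_def)
        also have "\<dots> \<subseteq> Q n - Q (Suc n)" using CA[OF c] by (simp add: A_def)
        finally show ?thesis .
      qed
      ultimately have "d \<in> A"
        using d0 unfolding A_def by (intro CollectI conjI allI impI) assumption+
      moreover have "d \<le> c" if "c \<in> C" for c
        using that by (auto simp: d_def le_fun_def)
      ultimately show ?thesis by blast
    qed
  qed
  then obtain m where m: "m \<in> A" and min: "\<And>c. c \<in> A \<Longrightarrow> c \<le> m \<Longrightarrow> c = m" by blast
  have m0: "closedin T (m 0)" "subgroup (m 0) G" using m by (auto simp: A_def)
  have "m 0 = {\<one>}"
  proof (rule ccontr)
    assume "m 0 \<noteq> {\<one>}"
    then obtain y where y: "y \<in> m 0" "y \<noteq> \<one>" using m0(2) subgroup.one_closed by blast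
    obtain U where U: "openin T U" "\<one> \<in> U" "y \<notin> U"
      using Hausdorff_separate_one[of y] y m0(2) subgroup.mem_carrier by metis
    then obtain H where H: "subgroup H G" "openin T H" "H \<subseteq> U" using small by blast
    \<comment> \<open>Taking the representative in \<open>H\<close> whenever possible makes the
      refined coset equal to \<open>m (Suc n) \<inter> H\<close> for almost all \<open>n\<close>, so
      the refinement still converges and contradicts minimality.\<close>
    have "\<forall>n. \<exists>b. b \<in> m (Suc n) \<and> (m (Suc n) \<inter> H \<noteq> {} \<longrightarrow> b \<in> H)"
      using nonempty[OF m] by blast
    then obtain b where b: "\<And>n. b n \<in> m (Suc n)" "\<And>n. m (Suc n) \<inter> H \<noteq> {} \<Longrightarrow> b n \<in> H" by metis
    define c where "c = case_nat (m 0 \<inter> H) (\<lambda>n. (\<lambda>x. b n \<otimes> x) ` (m 0 \<inter> H))"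
    have bc: "b n \<in> carrier G" for n
      using b(1) closed[OF m, of "Suc n"] closedin_subset by (fastforce simp: topspace_eq_carrier)
    have sub: "c n \<subseteq> m n" for n
      using rebase[OF m b(1)] by (cases n) (auto simp: c_def)
    have "eventually (\<lambda>n. c (Suc n) \<inter> K \<noteq> {}) sequentially" if K: "subgroup K G" "openin T K" for K
    proof -
      have "eventually (\<lambda>n. m (Suc n) \<inter> (H \<inter> K) \<noteq> {}) sequentially"
        using m H K by (auto simp: A_def intro: subgroups_Inter_pair)
      then show ?thesis
      proof eventually_elim
        case (elim n)
        then have "b n \<in> H" using b(2) by blast
        then have "m (Suc n) \<inter> H = c (Suc n)"
          using left_coset_Int_subgroup[OF m0(2) H(1)] rebase[OF m b(1)] by (simp add: c_def)
        then show ?case using elim by blast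
      qed
    qed
    moreover have "c (Suc n) \<subseteq> Q n - Q (Suc n)" for n
      using sub[of "Suc n"] m by (auto simp: A_def)
    ultimately have "c \<in> A"
      using m0 H bc by (auto simp: A_def c_def intro: subgroups_Inter_pair open_subgroup_closed)
    moreover have "c \<le> m" using sub by (simp add: le_fun_def)
    ultimately have "c 0 = m 0" using min by metis
    then show False using y U H by (auto simp: c_def)
  qed
  have "\<forall>n. \<exists>a. a \<in> carrier G \<and> m (Suc n) = {a}"
  proof
    fix n
    obtain b where "b \<in> carrier G" "m (Suc n) = (\<lambda>x. b \<otimes> x) ` m 0" using Acoset[OF m] by blast
    then show "\<exists>a. a \<in> carrier G \<and> m (Suc n) = {a}" using \<open>m 0 = {\<one>}\<close> by simp
  qed
  then obtain a where a: "\<And>n. a n \<in> carrier G" "\<And>n. m (Suc n) = {a n}" by metis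
  have aQ: "a n \<in> Q n" "a n \<notin> Q (Suc n)" for n
    using m a(2) by (auto simp: A_def)
  have "a i \<noteq> a j" if "i < j" for i j
    using aQ(1)[of j] aQ(2)[of i] Qanti[of "Suc i" j] that by auto
  then have "inj a" by (metis injI linorder_neqE_nat)
  moreover have "\<exists>H. subgroup H G \<and> H \<subseteq> U \<and> eventually (\<lambda>n. a n \<in> H) sequentially"
    if U: "openin T U" "\<one> \<in> U" for U
  proof -
    obtain H where H: "subgroup H G" "openin T H" "H \<subseteq> U" using small U by blast
    then have "eventually (\<lambda>n. m (Suc n) \<inter> H \<noteq> {}) sequentially" using m by (simp add: A_def)
    then show ?thesis using H a(2) by auto
  qed
  ultimately show ?thesis using a(1) by (intro exI[of _ a]) auto
qed

end

section \<open>Difference sets of syndetic sets of integers\<close>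

definition circ :: "real \<Rightarrow> complex" where
  "circ t = cis (2 * pi * t)"

lemma circ_0 [simp]: "circ 0 = 1" and circ_add: "circ (s + t) = circ s * circ t"
  and cmod_circ [simp]: "cmod (circ t) = 1" and cnj_circ: "cnj (circ t) = circ (- t)"
  by (simp_all add: circ_def cis_mult distrib_left cis_cnj)

lemma circ_eq_1_iff: "circ t = 1 \<longleftrightarrow> t \<in> \<int>"
proof
  assume "circ t = 1"
  then have "cos (2 * pi * t) = 1"
    by (simp add: circ_def complex_eq_iff)
  then obtain n :: int where "2 * pi * t = of_int n * (2 * pi)"
    unfolding cos_one_2pi_int by (auto simp: mult_ac)
  then have "t = of_int n" by simp
  then show "t \<in> \<int>" by simp
next
  assume "t \<in> \<int>"
  then show "circ t = 1" by (auto elim!: Ints_cases simp: circ_def cis_multiple_2pi)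
qed

lemma circ_of_int [simp]: "circ (of_int n) = 1"
  by (simp add: circ_eq_1_iff)

lemma circ_power: "circ t ^ n = circ (of_nat n * t)"
  by (simp add: circ_def Complex.DeMoivre mult_ac)

lemma continuous_circ: "isCont circ t"
  unfolding circ_def cis_conv_exp by (intro continuous_intros)

lemma tendsto_circ [tendsto_intros]: "(f \<longlongrightarrow> t) F \<Longrightarrow> ((\<lambda>x. circ (f x)) \<longlongrightarrow> circ t) F"
  by (rule isCont_tendsto_compose[OF continuous_circ])

lemma cmod_circ_add_diff: "cmod (circ (s + t) - circ (s' + t')) \<le> cmod (circ s - circ s') + cmod (circ t - circ t')"
proof -
  have "circ (s + t) - circ (s' + t') = (circ s - circ s') * circ t + circ s' * (circ t - circ t')"
    by (simp add: circ_add algebra_simps)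
  then show ?thesis
    using norm_triangle_ineq[of "(circ s - circ s') * circ t" "circ s' * (circ t - circ t')"]
    by (simp add: norm_mult)
qed

lemma cmod_circ_minus_diff: "cmod (circ (- s) - circ (- t)) = cmod (circ s - circ t)"
  by (metis cnj_circ complex_cnj_diff complex_mod_cnj)

lemma sum_circ_eq_0:
  fixes k :: int
  assumes "N > 0" "\<not> int N dvd k"
  shows "(\<Sum>\<xi><N. circ (of_int k * of_nat \<xi> / of_nat N)) = 0"
proof -
  define w where "w = circ (of_int k / of_nat N)"
  have "w \<noteq> 1"
  proof
    assume "w = 1"
    then obtain m :: int where "of_int k / of_nat N = (of_int m :: real)"
      unfolding w_def circ_eq_1_iff by (auto elim: Ints_cases)
    then have "(of_int k :: real) = of_int (m * int N)"
      using assms(1) by (simp add: field_simps)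
    then have "k = m * int N" by (simp only: of_int_eq_iff)
    then show False using assms(2) by simp
  qed
  moreover have "w ^ N = 1"
    unfolding w_def circ_power using assms(1) by simp
  ultimately have "(\<Sum>\<xi><N. w ^ \<xi>) = 0"
    using geometric_sum[of w N] by simp
  moreover have "w ^ \<xi> = circ (of_int k * of_nat \<xi> / of_nat N)" for \<xi>
    unfolding w_def circ_power by (simp add: mult_ac)
  ultimately show ?thesis by simp
qed

text \<open>\<open>F\<close> is the Fourier transform of the indicator of \<open>B\<close> on the
  integers modulo \<open>N\<close>. The fourth power of its modulus counts representations
  \<open>a - b + (c - d)\<close>; the bound on \<open>N\<close> excludes wrap-around. The frequency
  0 outweighs the small coefficients, whose total Parseval controls, and the large ones do no harm
  when \<open>n\<close> nearly annihilates their frequencies. Parseval also bounds the number of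
  large coefficients.\<close>

lemma finite_bogoliubov:
  fixes B :: "int set" and n :: int and N :: nat and \<eta> :: real
  defines "F \<equiv> \<lambda>\<xi>. \<Sum>a\<in>B. circ (of_int a * of_nat \<xi> / of_nat N)"
  assumes B: "finite B" "B \<subseteq> {-R..R}" and N: "4 * R + \<bar>n\<bar> < int N" and \<eta>: "0 < \<eta>" "\<eta> \<le> 1" "\<eta> * N < card B"
    and n: "\<And>\<xi>. \<xi> < N \<Longrightarrow> \<eta> * (card B)\<^sup>2 \<le> (cmod (F \<xi>))\<^sup>2 \<Longrightarrow>
      cmod (circ (of_int n * (of_nat \<xi> / of_nat N)) - 1) < 1/2"
  shows "\<exists>a\<in>B. \<exists>b\<in>B. \<exists>c\<in>B. \<exists>d\<in>B. n = a - b + (c - d)"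
    and "card {\<xi>. \<xi> < N \<and> \<eta> * (card B)\<^sup>2 \<le> (cmod (F \<xi>))\<^sup>2} * (\<eta> * card B) \<le> N"
proof -
  have B0: "card B > 0"
  proof -
    have "0 \<le> \<eta> * N" using \<eta>(1) by simp
    then have "0 < real (card B)" using \<eta>(3) by linarith
    then show ?thesis by simp
  qed
  then obtain a0 where "a0 \<in> B" by (metis card_gt_0_iff ex_in_conv)
  then have R: "R \<ge> 0" using B(2) by fastforce
  have N0: "N > 0" using N R by auto
  have sq: "F \<xi> * cnj (F \<xi>) = (\<Sum>(a, b)\<in>B \<times> B. circ (of_int (a - b) * of_nat \<xi> / of_nat N))" for \<xi>
    unfolding F_def cnj_sum sum_product sum.cartesian_product cnj_circ circ_add[symmetric]
    by (intro sum.cong refl) (auto simp: algebra_simps diff_divide_distrib)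
  have ortho: "(\<Sum>\<xi><N. circ (of_int k * of_nat \<xi> / of_nat N)) = (if k = 0 then of_nat N else 0)"
    if "\<bar>k\<bar> < int N" for k
  proof (cases "k = 0")
    case False
    then have "\<not> int N dvd k" using that dvd_imp_le_int[of k "int N"] by auto
    then show ?thesis using sum_circ_eq_0[OF N0] False by simp
  qed simp
  have parseval: "(\<Sum>\<xi><N. (cmod (F \<xi>))\<^sup>2) = N * card B"
  proof -
    have "complex_of_real (\<Sum>\<xi><N. (cmod (F \<xi>))\<^sup>2) = (\<Sum>\<xi><N. F \<xi> * cnj (F \<xi>))"
      by (simp only: of_real_sum complex_norm_square)
    also have "\<dots> = (\<Sum>(a, b)\<in>B \<times> B. \<Sum>\<xi><N. circ (of_int (a - b) * of_nat \<xi> / of_nat N))"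
      unfolding sq by (subst sum.swap) (simp add: case_prod_beta)
    also have "\<dots> = (\<Sum>(a, b)\<in>B \<times> B. if a = b then of_nat N else 0)"
    proof (intro sum.cong refl, clarify)
      fix a b assume "a \<in> B" "b \<in> B"
      then have "a \<in> {-R..R}" "b \<in> {-R..R}" using B(2) by auto
      then have "\<bar>a - b\<bar> < int N" using N R by auto
      from ortho[OF this] show "(\<Sum>\<xi><N. circ (of_int (a - b) * of_nat \<xi> / of_nat N)) = (if a = b then of_nat N else 0)"
        by simp
    qed
    also have "\<dots> = (\<Sum>a\<in>B. of_nat N)"
      unfolding sum.cartesian_product[symmetric] using B(1) by (intro sum.cong refl) simp
    also have "\<dots> = complex_of_real (N * card B)" by simp
    finally show ?thesis by (simp only: of_real_eq_iff)
  qed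
  define L where "L = {\<xi>. \<xi> < N \<and> \<eta> * (card B)\<^sup>2 \<le> (cmod (F \<xi>))\<^sup>2}"
  have L: "finite L" "L \<subseteq> {..<N}" by (auto simp: L_def)
  have "card L * (\<eta> * (card B)\<^sup>2) \<le> (\<Sum>\<xi>\<in>L. (cmod (F \<xi>))\<^sup>2)"
    using sum_bounded_below[of L "\<eta> * (card B)\<^sup>2" "\<lambda>\<xi>. (cmod (F \<xi>))\<^sup>2"] by (simp add: L_def)
  also have "\<dots> \<le> (\<Sum>\<xi><N. (cmod (F \<xi>))\<^sup>2)"
    using L by (intro sum_mono2) auto
  finally have "card L * (\<eta> * card B) * card B \<le> N * card B"
    unfolding parseval by (simp add: power2_eq_square mult_ac)
  then show "card L * (\<eta> * card B) \<le> N"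
    using B0 by simp
  show "\<exists>a\<in>B. \<exists>b\<in>B. \<exists>c\<in>B. \<exists>d\<in>B. n = a - b + (c - d)"
  proof (rule ccontr)
    assume neg: "\<not> ?thesis"
    \<comment> \<open>By orthogonality, \<open>S\<close> is \<open>N\<close> times the number of
      representations of \<open>n\<close>, hence zero under the assumption
      \<open>neg\<close>.\<close>
    define S where "S = (\<Sum>\<xi><N. (F \<xi> * cnj (F \<xi>)) * (F \<xi> * cnj (F \<xi>)) * circ (of_int (- n) * of_nat \<xi> / of_nat N))"
    have "S = (\<Sum>\<xi><N. \<Sum>(p, q)\<in>(B \<times> B) \<times> (B \<times> B). circ (of_int (fst p - snd p + (fst q - snd q) - n) * of_nat \<xi> / of_nat N))"
      unfolding S_def
    proof (rule sum.cong[OF refl])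
      fix \<xi>
      show "F \<xi> * cnj (F \<xi>) * (F \<xi> * cnj (F \<xi>)) * circ (of_int (- n) * of_nat \<xi> / of_nat N) =
          (\<Sum>(p, q)\<in>(B \<times> B) \<times> (B \<times> B). circ (of_int (fst p - snd p + (fst q - snd q) - n) * of_nat \<xi> / of_nat N))"
        unfolding sq sum_product
        unfolding sum_distrib_right sum.cartesian_product
        by (intro sum.cong refl) (auto simp: circ_add[symmetric] algebra_simps diff_divide_distrib add_divide_distrib)
    qed
    also have "\<dots> = (\<Sum>(p, q)\<in>(B \<times> B) \<times> (B \<times> B). \<Sum>\<xi><N. circ (of_int (fst p - snd p + (fst q - snd q) - n) * of_nat \<xi> / of_nat N))"
      by (subst sum.swap) (simp add: case_prod_beta)
    also have "\<dots> = 0"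
    proof (intro sum.neutral ballI, clarify)
      fix a b c d assume *: "a \<in> B" "b \<in> B" "c \<in> B" "d \<in> B"
      then have "a \<in> {-R..R}" "b \<in> {-R..R}" "c \<in> {-R..R}" "d \<in> {-R..R}" using B(2) by auto
      then have "\<bar>a - b + (c - d) - n\<bar> < int N" using N by auto
      from ortho[OF this] show "(\<Sum>\<xi><N. circ (of_int (fst (a, b) - snd (a, b) + (fst (c, d) - snd (c, d)) - n) * of_nat \<xi> / of_nat N)) = 0"
        using neg * by auto
    qed
    finally have S0: "S = 0" .
    define g where "g \<xi> = (cmod (F \<xi>))\<^sup>2" for \<xi>
    define c where "c \<xi> = Re (circ (of_int n * (of_nat \<xi> / of_nat N)))" for \<xi> :: nat
    have "Re S = (\<Sum>\<xi><N. g \<xi> * g \<xi> * c \<xi>)"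
    proof -
      have "Re (circ (of_int (- n) * of_nat \<xi> / of_nat N)) = c \<xi>" for \<xi>
        using cnj_circ[of "of_int n * (of_nat \<xi> / of_nat N)"] by (simp add: c_def complex_eq_iff)
      moreover have "F \<xi> * cnj (F \<xi>) * (F \<xi> * cnj (F \<xi>)) = of_real (g \<xi> * g \<xi>)" for \<xi>
        by (simp only: g_def complex_norm_square of_real_mult)
      ultimately show ?thesis by (simp add: S_def)
    qed
    \<comment> \<open>Termwise lower bound: the frequency 0 contributes \<open>card B ^ 4\<close>;
      on the large spectrum the cosine is nonnegative because the character is within 1/2 of 1;
      elsewhere one factor \<open>g \<xi>\<close> is at most the threshold.\<close>
    moreover have "(\<Sum>\<xi><N. (if \<xi> = 0 then real (card B) ^ 4 else 0) - \<eta> * (card B)\<^sup>2 * g \<xi>) \<le> (\<Sum>\<xi><N. g \<xi> * g \<xi> * c \<xi>)"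
    proof (rule sum_mono)
      fix \<xi> assume "\<xi> \<in> {..<N}"
      then have \<xi>: "\<xi> < N" by simp
      have g0: "g \<xi> \<ge> 0" by (simp add: g_def)
      consider "\<xi> = 0" | "\<xi> \<in> L" "\<xi> \<noteq> 0" | "\<xi> \<notin> L" "\<xi> \<noteq> 0" by blast
      then show "(if \<xi> = 0 then real (card B) ^ 4 else 0) - \<eta> * (card B)\<^sup>2 * g \<xi> \<le> g \<xi> * g \<xi> * c \<xi>"
      proof cases
        case 1
        then have "g \<xi> = (card B)\<^sup>2" "c \<xi> = 1" by (simp_all add: g_def c_def F_def)
        then show ?thesis using 1 \<eta>(1) by (simp add: power2_eq_square power4_eq_xxxx)
      next
        case 2
        have "cmod (circ (of_int n * (of_nat \<xi> / of_nat N)) - 1) < 1/2"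
          by (rule n) (use 2 in \<open>auto simp: L_def\<close>)
        then have "\<bar>c \<xi> - 1\<bar> < 1/2"
          using abs_Re_le_cmod[of "circ (of_int n * (of_nat \<xi> / of_nat N)) - 1"] by (simp add: c_def)
        then have "c \<xi> \<ge> 0" by linarith
        then have "0 \<le> g \<xi> * g \<xi> * c \<xi>" using g0 by simp
        moreover have "0 \<le> \<eta> * (card B)\<^sup>2 * g \<xi>" using g0 \<eta>(1) by simp
        ultimately show ?thesis using 2 by simp
      next
        case 3
        then have *: "g \<xi> \<le> \<eta> * (card B)\<^sup>2" using \<xi> by (simp add: L_def g_def)
        have "\<bar>c \<xi>\<bar> \<le> 1"
          using abs_Re_le_cmod[of "circ (of_int n * (of_nat \<xi> / of_nat N))"] by (simp add: c_def)
        then have "- 1 \<le> c \<xi>" by linarith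
        then have "g \<xi> * g \<xi> * (- 1) \<le> g \<xi> * g \<xi> * c \<xi>"
          using g0 by (intro mult_left_mono) auto
        moreover have "g \<xi> * g \<xi> \<le> \<eta> * (card B)\<^sup>2 * g \<xi>"
          using * g0 by (intro mult_right_mono) auto
        ultimately show ?thesis using 3 by simp
      qed
    qed
    moreover have "(\<Sum>\<xi><N. (if \<xi> = 0 then real (card B) ^ 4 else 0) - \<eta> * (card B)\<^sup>2 * g \<xi>)
        = (card B)^4 - \<eta> * (card B)\<^sup>2 * (N * card B)"
      using N0 parseval by (simp add: sum_subtractf sum_distrib_left[symmetric] g_def)
    moreover have "(card B)^4 - \<eta> * (card B)\<^sup>2 * (N * card B) = (card B)^3 * (card B - \<eta> * N)"
      by (simp add: algebra_simps power2_eq_square power3_eq_cube power4_eq_xxxx)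
    moreover have "(card B)^3 * (card B - \<eta> * N) > 0"
      using B0 \<eta>(3) by simp
    ultimately have "Re S > 0" by linarith
    then show False using S0 by simp
  qed
qed

text \<open>The finite version is applied to windows of growing length. The number of relevant
  frequencies is bounded independently of the window, so they can be listed in a fixed number of
  slots and passed to the limit along an ultrafilter.\<close>

lemma bogoliubov:
  fixes E F :: "int set"
  assumes F: "finite F" and E: "\<And>n. \<exists>i\<in>F. n - i \<in> E"
  shows "\<exists>A :: real set. finite A \<and>
    (\<forall>n. (\<forall>\<alpha>\<in>A. cmod (circ (of_int n * \<alpha>) - 1) < 1/2) \<longrightarrow> (\<exists>a\<in>E. \<exists>b\<in>E. \<exists>c\<in>E. \<exists>d\<in>E. n = a - b + (c - d)))"
proof -
  define k where "k = card F"
  have "F \<noteq> {}" using E by blast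
  then have k: "k > 0" using F by (simp add: k_def card_gt_0_iff)
  define L where "L = Max (abs ` F)"
  have L: "\<bar>i\<bar> \<le> L" if "i \<in> F" for i
    using that F by (simp add: L_def)
  \<comment> \<open>The window has radius \<open>2 * M\<close> so that translates by elements of
    \<open>F\<close>, of size at most \<open>L \<le> M\<close>, still cover
    \<open>{- M..<M}\<close>.\<close>
  define B where "B M = E \<inter> {- 2 * int M..2 * int M}" for M
  \<comment> \<open>With modulus \<open>100 * M\<close> the product of \<open>\<eta>\<close> and the
    modulus is \<open>M / k\<close>, below the lower bound \<open>2 * M / k\<close> for
    \<open>card (B M)\<close>. The factor 100 also leaves room for
    \<open>4 * (2 * M) + M\<close>.\<close>
  define \<eta> where "\<eta> = 1 / (100 * real k)"
  define N where "N M = 100 * M" for M :: nat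
  define f where "f M \<xi> = (\<Sum>a\<in>B M. circ (of_int a * of_nat \<xi> / of_nat (N M)))" for M \<xi>
  define \<Lambda> where "\<Lambda> M = {\<xi>. \<xi> < N M \<and> \<eta> * (card (B M))\<^sup>2 \<le> (cmod (f M \<xi>))\<^sup>2}" for M
  \<comment> \<open>The bound on the spectrum is \<open>N M / (\<eta> * card (B M))\<close>, at most
    \<open>100 * M * 100 * k\<close> divided by \<open>2 * M / k\<close>.\<close>
  define r where "r = 5000 * k * k"
  have \<eta>: "0 < \<eta>" "\<eta> \<le> 1" using k by (simp_all add: \<eta>_def)
  have finB: "finite (B M)" for M by (simp add: B_def)
  have density: "2 * M \<le> k * card (B M)" if M: "int M \<ge> L" for M
  proof -
    have "{- int M..<int M} \<subseteq> (\<Union>i\<in>F. (\<lambda>b. b + i) ` B M)"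
    proof
      fix n assume n: "n \<in> {- int M..<int M}"
      obtain i where i: "i \<in> F" "n - i \<in> E" using E by blast
      have "\<bar>i\<bar> \<le> int M" using L[OF i(1)] M by simp
      then have "n - i \<in> B M" using n i by (auto simp: B_def)
      then show "n \<in> (\<Union>i\<in>F. (\<lambda>b. b + i) ` B M)" using i by force
    qed
    then have "card {- int M..<int M} \<le> card (\<Union>i\<in>F. (\<lambda>b. b + i) ` B M)"
      using F finB by (intro card_mono) auto
    also have "\<dots> \<le> (\<Sum>i\<in>F. card ((\<lambda>b. b + i) ` B M))"
      using F by (rule card_UN_le)
    also have "\<dots> \<le> (\<Sum>i\<in>F. card (B M))"
      using finB by (intro sum_mono card_image_le) auto
    finally show ?thesis by (simp add: k_def)
  qed
  have stage: "card (\<Lambda> M) \<le> r"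
    "\<And>n. \<bar>n\<bar> \<le> int M \<Longrightarrow> (\<And>\<xi>. \<xi> \<in> \<Lambda> M \<Longrightarrow> cmod (circ (of_int n * (of_nat \<xi> / of_nat (N M))) - 1) < 1/2) \<Longrightarrow>
      (\<exists>a\<in>E. \<exists>b\<in>E. \<exists>c\<in>E. \<exists>d\<in>E. n = a - b + (c - d))"
    if M: "int M \<ge> L" "M > 0" for M
  proof -
    have d: "2 * real M \<le> k * card (B M)"
      using density[OF M(1)] by (metis of_nat_le_iff of_nat_mult of_nat_numeral)
    have dens: "\<eta> * N M < card (B M)"
    proof -
      have "\<eta> * N M * real k = real M" using k by (simp add: \<eta>_def N_def)
      moreover have "2 * real M \<le> real (card (B M)) * real k" using d by (simp add: mult_ac)
      ultimately have "\<eta> * N M * real k < real (card (B M)) * real k" using M(2) by simp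
      then show ?thesis by (rule mult_right_less_imp_less) simp
    qed
    have main: "\<exists>a\<in>B M. \<exists>b\<in>B M. \<exists>c\<in>B M. \<exists>d\<in>B M. n = a - b + (c - d)"
         "card (\<Lambda> M) * (\<eta> * card (B M)) \<le> N M"
      if n: "\<bar>n\<bar> \<le> int M" "\<And>\<xi>. \<xi> \<in> \<Lambda> M \<Longrightarrow> cmod (circ (of_int n * (of_nat \<xi> / of_nat (N M))) - 1) < 1/2" for n
    proof -
      have *: "finite (B M)" "B M \<subseteq> {- (2 * int M)..2 * int M}" "4 * (2 * int M) + \<bar>n\<bar> < int (N M)"
        using n(1) M finB by (auto simp: B_def N_def)
      note fb = finite_bogoliubov[OF * \<eta> dens]
      show "\<exists>a\<in>B M. \<exists>b\<in>B M. \<exists>c\<in>B M. \<exists>d\<in>B M. n = a - b + (c - d)"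
        by (rule fb(1)) (use n(2) in \<open>auto simp: \<Lambda>_def f_def\<close>)
      show "card (\<Lambda> M) * (\<eta> * card (B M)) \<le> N M"
        unfolding \<Lambda>_def f_def by (rule fb(2)) (use n(2) in \<open>auto simp: \<Lambda>_def f_def\<close>)
    qed
    show "\<exists>a\<in>E. \<exists>b\<in>E. \<exists>c\<in>E. \<exists>d\<in>E. n = a - b + (c - d)"
      if "\<bar>n\<bar> \<le> int M" "\<And>\<xi>. \<xi> \<in> \<Lambda> M \<Longrightarrow> cmod (circ (of_int n * (of_nat \<xi> / of_nat (N M))) - 1) < 1/2" for n
      using main(1)[OF that] by (auto simp: B_def)
    have "card (\<Lambda> M) * (\<eta> * card (B M)) \<le> N M"
      \<comment> \<open>The cardinality bound carries no \<open>n\<close>; the choice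
        \<open>n = 0\<close> meets the spectral hypothesis trivially.\<close>
      by (rule main(2)[of 0]) auto
    then have e: "real (card (\<Lambda> M)) * real (card (B M)) \<le> 10000 * real M * real k"
      using k by (simp add: \<eta>_def N_def field_simps)
    have "real (card (\<Lambda> M)) * (2 * real M) \<le> real (card (\<Lambda> M)) * (real k * real (card (B M)))"
      using d by (intro mult_left_mono) auto
    also have "\<dots> = real (card (\<Lambda> M)) * real (card (B M)) * real k" by simp
    also have "\<dots> \<le> 10000 * real M * real k * real k"
      using e by (intro mult_right_mono) auto
    also have "\<dots> = real r * (2 * real M)" by (simp add: r_def)
    finally have "real (card (\<Lambda> M)) \<le> real r"
      by (rule mult_right_le_imp_le) (use M in simp)
    then show "card (\<Lambda> M) \<le> r" by simp
  qed
  \<comment> \<open>The frequencies are padded with zeros to a sequence in the unit interval, so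
    that limits can be taken slot by slot.\<close>
  have "\<exists>a :: nat \<Rightarrow> real. (\<forall>i. a i \<in> {0..1}) \<and> (card (\<Lambda> M) \<le> r \<longrightarrow> (\<forall>\<xi>\<in>\<Lambda> M. \<exists>i<r. a i = of_nat \<xi> / of_nat (N M)))" for M
  proof -
    have "finite (\<Lambda> M)" by (simp add: \<Lambda>_def)
    then obtain h where h: "bij_betw h {0..<card (\<Lambda> M)} (\<Lambda> M)"
      using ex_bij_betw_nat_finite by blast
    define a where "a i = (if i < card (\<Lambda> M) then real (h i) / real (N M) else 0)" for i
    have "h i < N M" if "i < card (\<Lambda> M)" for i
      using h that by (auto simp: bij_betw_def \<Lambda>_def)
    then have "a i \<in> {0..1}" for i
      by (auto simp: a_def divide_le_eq_1 less_imp_le)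
    moreover have "\<exists>i<r. a i = of_nat \<xi> / of_nat (N M)" if "\<xi> \<in> \<Lambda> M" "card (\<Lambda> M) \<le> r" for \<xi>
    proof -
      have "\<xi> \<in> h ` {0..<card (\<Lambda> M)}" using h that by (simp add: bij_betw_def)
      then obtain i where "i < card (\<Lambda> M)" "h i = \<xi>" by auto
      then show ?thesis using that by (intro exI[of _ i]) (auto simp: a_def)
    qed
    ultimately show ?thesis by blast
  qed
  then obtain a :: "nat \<Rightarrow> nat \<Rightarrow> real" where a: "\<And>M i. a M i \<in> {0..1}"
    "\<And>M \<xi>. card (\<Lambda> M) \<le> r \<Longrightarrow> \<xi> \<in> \<Lambda> M \<Longrightarrow> \<exists>i<r. a M i = of_nat \<xi> / of_nat (N M)"
    by metis
  obtain \<U> :: "nat filter" where \<U>: "\<U> \<le> sequentially" "ultra \<U>"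
    using ultra_exists[of "sequentially"] by auto
  have "\<exists>l. ((\<lambda>M. a M i) \<longlongrightarrow> l) \<U>" for i
    using ultra_tendsto_bounded[OF \<U>(2), of "\<lambda>M. a M i" 0 1] a(1) by auto
  then obtain \<alpha> where \<alpha>: "\<And>i. ((\<lambda>M. a M i) \<longlongrightarrow> \<alpha> i) \<U>" by metis
  have "\<exists>a\<in>E. \<exists>b\<in>E. \<exists>c\<in>E. \<exists>d\<in>E. n = a - b + (c - d)"
    if n: "\<forall>\<beta>\<in>\<alpha> ` {..<r}. cmod (circ (of_int n * \<beta>) - 1) < 1/2" for n
  proof -
    \<comment> \<open>The strict inequality at the limit frequencies is an open condition, so it
      holds at the frequencies of a late window; that window is also chosen large enough to contain
      \<open>n\<close>.\<close>
    have ev: "eventually (\<lambda>M. \<forall>i\<in>{..<r}. cmod (circ (of_int n * a M i) - 1) < 1/2) \<U>"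
    proof (rule eventually_ball_finite)
      show "\<forall>i\<in>{..<r}. eventually (\<lambda>M. cmod (circ (of_int n * a M i) - 1) < 1/2) \<U>"
      proof
        fix i assume "i \<in> {..<r}"
        have "((\<lambda>M. cmod (circ (of_int n * a M i) - 1)) \<longlongrightarrow> cmod (circ (of_int n * \<alpha> i) - 1)) \<U>"
          by (intro tendsto_intros \<alpha>)
        then show "eventually (\<lambda>M. cmod (circ (of_int n * a M i) - 1) < 1/2) \<U>"
          by (rule order_tendstoD(2)) (use n \<open>i \<in> {..<r}\<close> in auto)
      qed
    qed auto
    have "eventually (\<lambda>M. M \<ge> nat L + nat \<bar>n\<bar> + 1) \<U>"
      using \<U>(1) eventually_ge_at_top filter_leD by blast
    with ev have "eventually (\<lambda>M. M \<ge> nat L + nat \<bar>n\<bar> + 1 \<and> (\<forall>i<r. cmod (circ (of_int n * a M i) - 1) < 1/2)) \<U>"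
      by eventually_elim auto
    then obtain M where M: "M \<ge> nat L + nat \<bar>n\<bar> + 1" "\<And>i. i < r \<Longrightarrow> cmod (circ (of_int n * a M i) - 1) < 1/2"
      using eventually_happens'[OF ultra_neq_bot[OF \<U>(2)]] by blast
    have M': "int M \<ge> L" "M > 0" "\<bar>n\<bar> \<le> int M" using M(1) by linarith+
    show ?thesis
    proof (rule stage(2)[OF M'])
      fix \<xi> assume "\<xi> \<in> \<Lambda> M"
      then obtain i where "i < r" "a M i = of_nat \<xi> / of_nat (N M)"
        using a(2)[OF stage(1)[OF M'(1,2)]] by blast
      then show "cmod (circ (of_int n * (of_nat \<xi> / of_nat (N M))) - 1) < 1/2"
        using M(2)[of i] by simp
    qed
  qed
  then show ?thesis by (intro exI[of _ "\<alpha> ` {..<r}"]) auto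
qed

section \<open>Rational coordinates of real numbers\<close>

text \<open>\<open>H\<close> is a Hamel basis of the reals over the rationals containing \<open>1\<close>, and \<open>c \<alpha> b\<close> is the coordinate of
  \<open>\<alpha>\<close> at \<open>b\<close>. Only the finite consequences used with Kronecker's theorem are recorded.\<close>

definition rational_coordinates :: "real set \<Rightarrow> (real \<Rightarrow> real \<Rightarrow> real) \<Rightarrow> bool" where
  "rational_coordinates H c \<longleftrightarrow> 1 \<in> H \<and>
    (\<forall>D u. finite D \<longrightarrow> D \<subseteq> H \<longrightarrow> (\<Sum>d\<in>D. of_int (u d) * d) = 0 \<longrightarrow> (\<forall>d\<in>D. u d = (0::int))) \<and>
    (\<forall>A. finite A \<longrightarrow> (\<exists>B q. finite B \<and> B \<subseteq> H - {1} \<and> q > (0::int) \<and>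
       (\<forall>\<alpha>\<in>A. \<alpha> = c \<alpha> 1 + (\<Sum>b\<in>B. c \<alpha> b * b) \<and> (\<forall>b. of_int q * c \<alpha> b \<in> \<int>) \<and> (\<forall>b. b \<noteq> 1 \<longrightarrow> b \<notin> B \<longrightarrow> c \<alpha> b = 0))))"

lemma rational_coordinates_exist: "\<exists>H c. rational_coordinates H c"
proof -
  interpret Q: vector_space "\<lambda>(r::rat) (x::real). of_rat r * x"
    by unfold_locales (auto simp: algebra_simps of_rat_add of_rat_mult)
  have "Q.independent {1}" by simp
  define H where "H = Q.extend_basis {1}"
  have H: "Q.independent H" "1 \<in> H" "Q.span H = UNIV"
    using Q.independent_extend_basis[OF \<open>Q.independent {1}\<close>] Q.extend_basis_superset[OF \<open>Q.independent {1}\<close>]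
      Q.span_extend_basis[OF \<open>Q.independent {1}\<close>] by (auto simp: H_def)
  define c where "c \<alpha> b = real_of_rat (Q.representation H \<alpha> b)" for \<alpha> b
  have "rational_coordinates H c"
    unfolding rational_coordinates_def
  proof (intro conjI allI impI)
    show "1 \<in> H" by fact
  next
    fix D and u :: "real \<Rightarrow> int" assume D: "finite D" "D \<subseteq> H" "(\<Sum>d\<in>D. of_int (u d) * d) = 0"
    have "(\<Sum>d\<in>D. of_rat (of_int (u d)) * d) = 0" using D(3) by simp
    from Q.independentD[OF H(1) D(1,2) this] have "\<forall>d\<in>D. (of_int (u d) :: rat) = 0"
      by blast
    then show "\<forall>d\<in>D. u d = 0" by simp
  next
    fix A :: "real set" assume A: "finite A"
    define S where "S = (\<Union>\<alpha>\<in>A. {b. Q.representation H \<alpha> b \<noteq> 0})"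
    have S: "finite S" "S \<subseteq> H"
      using A Q.finite_representation Q.representation_ne_zero by (auto simp: S_def)
    define P where "P = (\<lambda>(\<alpha>, b). Q.representation H \<alpha> b) ` (A \<times> S)"
    \<comment> \<open>A common denominator of all coordinates of all elements of
      \<open>A\<close>.\<close>
    define q where "q = (\<Prod>r\<in>P. snd (quotient_of r))"
    have "finite P" using A S by (simp add: P_def)
    have q: "q > 0" unfolding q_def by (intro prod_pos) (auto simp: quotient_of_denom_pos')
    have qint: "of_int q * real_of_rat r \<in> \<int>" if "r \<in> P" for r
    proof -
      have "q = snd (quotient_of r) * (\<Prod>r\<in>P - {r}. snd (quotient_of r))"
        unfolding q_def using \<open>finite P\<close> that by (rule prod.remove)
      moreover have "of_int (snd (quotient_of r)) * r = of_int (fst (quotient_of r))"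
      proof -
        have *: "of_int b * s = of_int a" if "s = of_int a / of_int b" "b > 0" for s :: rat and a b :: int
          using that by simp
        show ?thesis
          by (rule *) (rule quotient_of_div, simp, rule quotient_of_denom_pos')
      qed
      ultimately have "of_int q * r = of_int (fst (quotient_of r) * (\<Prod>r\<in>P - {r}. snd (quotient_of r)))"
        by (simp add: mult_ac)
      then obtain z where "of_int q * r = of_int z" by blast
      then have "real_of_rat (of_int q * r) = of_int z" by simp
      then show ?thesis by (simp add: of_rat_mult)
    qed
    show "\<exists>B q. finite B \<and> B \<subseteq> H - {1} \<and> q > (0::int) \<and>
       (\<forall>\<alpha>\<in>A. \<alpha> = c \<alpha> 1 + (\<Sum>b\<in>B. c \<alpha> b * b) \<and> (\<forall>b. of_int q * c \<alpha> b \<in> \<int>) \<and> (\<forall>b. b \<noteq> 1 \<longrightarrow> b \<notin> B \<longrightarrow> c \<alpha> b = 0))"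
    proof (intro exI[of _ "S - {1}"] exI[of _ q] conjI ballI allI impI)
      fix \<alpha> assume \<alpha>: "\<alpha> \<in> A"
      have zero: "c \<alpha> b = 0" if "b \<notin> S" for b
        using that \<alpha> by (auto simp: S_def c_def)
      have "\<alpha> = (\<Sum>b | Q.representation H \<alpha> b \<noteq> 0. c \<alpha> b * b)"
        using Q.sum_nonzero_representation_eq[OF H(1), of \<alpha>] H(3) by (simp add: c_def)
      also have "\<dots> = (\<Sum>b\<in>insert 1 S. c \<alpha> b * b)"
        using S \<alpha> by (intro sum.mono_neutral_left) (auto simp: S_def c_def)
      also have "\<dots> = c \<alpha> 1 * 1 + (\<Sum>b\<in>S - {1}. c \<alpha> b * b)"
        using S by (subst sum.insert_remove) auto
      finally show "\<alpha> = c \<alpha> 1 + (\<Sum>b\<in>S - {1}. c \<alpha> b * b)" by simp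
      show "of_int q * c \<alpha> b \<in> \<int>" for b
      proof (cases "b \<in> S")
        case True
        then have "Q.representation H \<alpha> b \<in> P" using \<alpha> by (auto simp: P_def)
        then show ?thesis using qint by (simp add: c_def)
      qed (simp add: zero)
      show "c \<alpha> b = 0" if "b \<noteq> 1" "b \<notin> S - {1}" for b
        using zero that by auto
    qed (use S q in auto)
  qed
  then show ?thesis by blast
qed

lemma rational_coordinatesE:
  assumes "rational_coordinates H c" "finite A"
  obtains B q where "finite B" "B \<subseteq> H - {1}" "q > (0::int)"
    "\<And>\<alpha>. \<alpha> \<in> A \<Longrightarrow> \<alpha> = c \<alpha> 1 + (\<Sum>b\<in>B. c \<alpha> b * b)"
    "\<And>\<alpha> b. \<alpha> \<in> A \<Longrightarrow> of_int q * c \<alpha> b \<in> \<int>"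
    "\<And>\<alpha> b. \<alpha> \<in> A \<Longrightarrow> b \<noteq> 1 \<Longrightarrow> b \<notin> B \<Longrightarrow> c \<alpha> b = 0"
proof -
  have "\<exists>B q. finite B \<and> B \<subseteq> H - {1} \<and> q > (0::int) \<and>
       (\<forall>\<alpha>\<in>A. \<alpha> = c \<alpha> 1 + (\<Sum>b\<in>B. c \<alpha> b * b) \<and> (\<forall>b. of_int q * c \<alpha> b \<in> \<int>) \<and> (\<forall>b. b \<noteq> 1 \<longrightarrow> b \<notin> B \<longrightarrow> c \<alpha> b = 0))"
    using assms unfolding rational_coordinates_def by blast
  then obtain B and q :: int where *: "finite B" "B \<subseteq> H - {1}" "q > 0"
    "\<forall>\<alpha>\<in>A. \<alpha> = c \<alpha> 1 + (\<Sum>b\<in>B. c \<alpha> b * b) \<and> (\<forall>b. of_int q * c \<alpha> b \<in> \<int>) \<and> (\<forall>b. b \<noteq> 1 \<longrightarrow> b \<notin> B \<longrightarrow> c \<alpha> b = 0)"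
    by blast
  show thesis by (rule that[OF *(1-3)]) (use *(4) in blast)+
qed

lemma kronecker_finite_set:
  fixes B :: "real set" and \<theta> :: "real \<Rightarrow> real"
  assumes B: "finite B" "1 \<notin> B" "\<epsilon> > 0"
    and ind: "\<And>D u. finite D \<Longrightarrow> D \<subseteq> insert 1 B \<Longrightarrow> (\<Sum>d\<in>D. of_int (u d) * d) = 0 \<Longrightarrow> \<forall>d\<in>D. u d = (0::int)"
  shows "\<exists>k::int. \<exists>m :: real \<Rightarrow> int. \<forall>b\<in>B. \<bar>of_int k * b - of_int (m b) - \<theta> b\<bar> < \<epsilon>"
proof -
  interpret Z: module "\<lambda>(r::int) (x::real). of_int r * x"
    by unfold_locales (auto simp: algebra_simps)
  obtain h where h: "bij_betw h {0..<card B} B"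
    using ex_bij_betw_nat_finite[OF B(1)] by blast
  define n where "n = card B"
  \<comment> \<open>Kronecker's theorem is applied to an enumerated family whose last member is 1,
    so index \<open>n\<close> is reserved for 1 and the lower indices enumerate
    \<open>B\<close>.\<close>
  define g where "g i = (if i < n then h i else 1)" for i
  have gim: "g ` {..n} = insert 1 B"
  proof -
    have "{..n} = insert n {0..<n}" by auto
    moreover have "g ` {0..<n} = h ` {0..<n}" by (intro image_cong) (auto simp: g_def)
    ultimately show ?thesis using h by (simp add: bij_betw_def n_def[symmetric]) (simp add: g_def)
  qed
  have inj: "inj_on g {..n}"
    using h B(2) by (auto simp: g_def n_def bij_betw_def inj_on_def)
  have "Z.independent (g ` {..n})"
    unfolding gim Z.dependent_explicit using ind by blast
  then obtain k m where km: "\<And>i. i < n \<Longrightarrow> \<bar>of_int k * g i - of_int (m i) - \<theta> (g i)\<bar> < \<epsilon>"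
    using Kronecker_thm_2[of g n \<epsilon> "\<lambda>i. \<theta> (g i)"] inj B(3) by (auto simp: g_def)
  have "\<bar>of_int k * b - of_int (m (inv_into {0..<card B} h b)) - \<theta> b\<bar> < \<epsilon>" if "b \<in> B" for b
  proof -
    have "inv_into {0..<card B} h b < n" "h (inv_into {0..<card B} h b) = b"
      using h that by (auto simp: n_def bij_betw_def f_inv_into_f intro: inv_into_into[of b h "{0..<card B}", simplified])
    then show ?thesis using km[of "inv_into {0..<card B} h b"] by (simp add: g_def)
  qed
  then show ?thesis
    by (intro exI[of _ k] exI[of _ "\<lambda>b. m (inv_into {0..<card B} h b)"]) blast
qed

section \<open>Compact groups with an element of infinite order\<close>

context hausdorff_topological_group
begin

text \<open>A function \<open>h\<close> stands for the point of the Bohr compactification of the integers at which the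
  character \<open>n \<mapsto> circ (n * \<alpha>)\<close> takes the value \<open>circ (h \<alpha>)\<close>; \<open>bohr_limits x h\<close> is its image under
  the extension of \<open>n \<mapsto> x [^] n\<close>.\<close>

definition bohr_limits :: "'a \<Rightarrow> (real \<Rightarrow> real) \<Rightarrow> 'a set" where
  "bohr_limits x h = {y \<in> carrier G. \<forall>A \<epsilon> U. finite A \<longrightarrow> \<epsilon> > 0 \<longrightarrow> openin T U \<longrightarrow> y \<in> U \<longrightarrow>
     (\<exists>n::int. (\<forall>\<alpha>\<in>A. cmod (circ (of_int n * \<alpha>) - circ (h \<alpha>)) < \<epsilon>) \<and> x [^] n \<in> U)}"

lemma bohr_limits_carrier: "y \<in> bohr_limits x h \<Longrightarrow> y \<in> carrier G"
  by (simp add: bohr_limits_def)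

lemma bohr_limitsD:
  assumes "y \<in> bohr_limits x h" "finite A" "\<epsilon> > 0" "openin T U" "y \<in> U"
  obtains n :: int where "\<And>\<alpha>. \<alpha> \<in> A \<Longrightarrow> cmod (circ (of_int n * \<alpha>) - circ (h \<alpha>)) < \<epsilon>" "x [^] n \<in> U"
proof -
  have "\<exists>n::int. (\<forall>\<alpha>\<in>A. cmod (circ (of_int n * \<alpha>) - circ (h \<alpha>)) < \<epsilon>) \<and> x [^] n \<in> U"
    using assms unfolding bohr_limits_def by simp
  then show thesis using that by blast
qed

lemma bohr_limits_pow: "x \<in> carrier G \<Longrightarrow> x [^] (n::int) \<in> bohr_limits x (\<lambda>\<alpha>. of_int n * \<alpha>)"
  by (auto simp: bohr_limits_def intro!: exI[of _ n])

lemma bohr_limits_one: "x \<in> carrier G \<Longrightarrow> \<one> \<in> bohr_limits x (\<lambda>\<alpha>. 0)"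
  using bohr_limits_pow[of x 0] by simp

text \<open>Together with \<open>bohr_limits_one\<close> and \<open>bohr_limits_inv\<close> this
  makes the pairs of a Bohr point and its limit a group under addition and multiplication, the graph
  of a homomorphism once single-valuedness is known.\<close>

lemma bohr_limits_mult:
  assumes x: "x \<in> carrier G" and y: "y \<in> bohr_limits x h" "y' \<in> bohr_limits x h'"
  shows "y \<otimes> y' \<in> bohr_limits x (\<lambda>\<alpha>. h \<alpha> + h' \<alpha>)"
  unfolding bohr_limits_def
proof (intro CollectI conjI allI impI)
  show "y \<otimes> y' \<in> carrier G" using y bohr_limits_carrier by simp
  fix A :: "real set" and \<epsilon> :: real and W
  assume *: "finite A" "\<epsilon> > 0" "openin T W" "y \<otimes> y' \<in> W"
  obtain U V where UV: "openin T U" "openin T V" "y \<in> U" "y' \<in> V" "\<And>u v. u \<in> U \<Longrightarrow> v \<in> V \<Longrightarrow> u \<otimes> v \<in> W"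
    using mult_nhds[OF *(3) _ _ *(4)] y bohr_limits_carrier by metis
  obtain n where n: "\<And>\<alpha>. \<alpha> \<in> A \<Longrightarrow> cmod (circ (of_int n * \<alpha>) - circ (h \<alpha>)) < \<epsilon> / 2" "x [^] n \<in> U"
    using bohr_limitsD[OF y(1) *(1) _ UV(1,3), of "\<epsilon> / 2"] *(2) by auto
  obtain n' where n': "\<And>\<alpha>. \<alpha> \<in> A \<Longrightarrow> cmod (circ (of_int n' * \<alpha>) - circ (h' \<alpha>)) < \<epsilon> / 2" "x [^] n' \<in> V"
    using bohr_limitsD[OF y(2) *(1) _ UV(2,4), of "\<epsilon> / 2"] *(2) by auto
  have "cmod (circ (of_int (n + n') * \<alpha>) - circ (h \<alpha> + h' \<alpha>)) < \<epsilon>" if "\<alpha> \<in> A" for \<alpha>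
    using cmod_circ_add_diff[of "of_int n * \<alpha>" "of_int n' * \<alpha>" "h \<alpha>" "h' \<alpha>"] n(1)[OF that] n'(1)[OF that]
    by (simp add: algebra_simps)
  moreover have "x [^] (n + n') \<in> W"
    using UV(5)[OF n(2) n'(2)] x by (simp add: int_pow_mult)
  ultimately show "\<exists>n::int. (\<forall>\<alpha>\<in>A. cmod (circ (of_int n * \<alpha>) - circ (h \<alpha> + h' \<alpha>)) < \<epsilon>) \<and> x [^] n \<in> W"
    by blast
qed

lemma bohr_limits_inv:
  assumes x: "x \<in> carrier G" and y: "y \<in> bohr_limits x h"
  shows "inv y \<in> bohr_limits x (\<lambda>\<alpha>. - h \<alpha>)"
  unfolding bohr_limits_def
proof (intro CollectI conjI allI impI)
  show "inv y \<in> carrier G" using y bohr_limits_carrier by simp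
  fix A :: "real set" and \<epsilon> :: real and W
  assume *: "finite A" "\<epsilon> > 0" "openin T W" "inv y \<in> W"
  have "openin T {z \<in> carrier G. inv z \<in> W}" using openin_preimage[OF continuous_inv *(3)] .
  moreover have "y \<in> {z \<in> carrier G. inv z \<in> W}" using y bohr_limits_carrier * by auto
  ultimately obtain n where n: "\<And>\<alpha>. \<alpha> \<in> A \<Longrightarrow> cmod (circ (of_int n * \<alpha>) - circ (h \<alpha>)) < \<epsilon>"
    "x [^] n \<in> {z \<in> carrier G. inv z \<in> W}"
    using bohr_limitsD[OF y *(1,2)] by metis
  have "cmod (circ (of_int (- n) * \<alpha>) - circ (- h \<alpha>)) < \<epsilon>" if "\<alpha> \<in> A" for \<alpha>
    using n(1)[OF that] cmod_circ_minus_diff[of "of_int n * \<alpha>" "h \<alpha>"] by simp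
  moreover have "x [^] (- n) \<in> W"
    using n(2) x by (simp add: int_pow_neg)
  ultimately show "\<exists>n::int. (\<forall>\<alpha>\<in>A. cmod (circ (of_int n * \<alpha>) - circ (- h \<alpha>)) < \<epsilon>) \<and> x [^] n \<in> W"
    by blast
qed

lemma bohr_limits_nat_pow:
  assumes x: "x \<in> carrier G" and y: "y \<in> bohr_limits x h"
  shows "y [^] (n::nat) \<in> bohr_limits x (\<lambda>\<alpha>. of_nat n * h \<alpha>)"
proof (induction n)
  case 0
  then show ?case using bohr_limits_one[OF x] by simp
next
  case (Suc n)
  then show ?case using bohr_limits_mult[OF x Suc y] by (simp add: algebra_simps)
qed

lemma bohr_limits_int_pow:
  assumes x: "x \<in> carrier G" and y: "y \<in> bohr_limits x h"
  shows "y [^] (n::int) \<in> bohr_limits x (\<lambda>\<alpha>. of_int n * h \<alpha>)"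
proof (cases "n \<ge> 0")
  case True
  then show ?thesis
    using bohr_limits_nat_pow[OF assms, of "nat n"] int_pow_int[of G y "nat n"] by simp
next
  case False
  then have "y [^] n = inv (y [^] nat (- n))"
    unfolding int_pow_def2 by simp
  then show ?thesis
    using bohr_limits_inv[OF x bohr_limits_nat_pow[OF assms, of "nat (- n)"]] False by simp
qed

end

section \<open>Continuity of the powers of an element for the Bohr topology\<close>

context compact_topological_group
begin

text \<open>Finitely many left translates of a small \<open>W\<close> cover the group. Two powers of
  \<open>x\<close> in the same translate differ by an element of the form
  \<open>inv v \<otimes> w\<close> with \<open>v\<close> and \<open>w\<close> in \<open>W\<close>,
  so one exponent per translate suffices.\<close>

lemma powers_syndetic:
  assumes x: "x \<in> carrier G" and V: "openin T V" "\<one> \<in> V"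
  shows "\<exists>F :: int set. finite F \<and> (\<forall>n. \<exists>i\<in>F. x [^] (n - i) \<in> V)"
proof -
  obtain W where W: "openin T W" "\<one> \<in> W" "W \<subseteq> V" "\<And>u. u \<in> W \<Longrightarrow> inv u \<in> W"
    "\<And>u v. u \<in> W \<Longrightarrow> v \<in> W \<Longrightarrow> u \<otimes> v \<in> V"
    using one_nhd_shrink[OF V] by metis
  have Wc: "W \<subseteq> carrier G" using W(1) openin_carrier by simp
  have "compactin T (carrier G)"
    using compact by (simp add: compact_space_def topspace_eq_carrier)
  moreover have "carrier G \<subseteq> \<Union>((\<lambda>g. (\<lambda>w. g \<otimes> w) ` W) ` carrier G)"
    using W(2) by (force intro: image_eqI[of _ _ \<one>])
  ultimately have "\<exists>\<F>. finite \<F> \<and> \<F> \<subseteq> (\<lambda>g. (\<lambda>w. g \<otimes> w) ` W) ` carrier G \<and> carrier G \<subseteq> \<Union>\<F>"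
    using W(1) openin_left_translate by (intro compactinD) auto
  then obtain \<F> where \<F>: "finite \<F>" "\<F> \<subseteq> (\<lambda>g. (\<lambda>w. g \<otimes> w) ` W) ` carrier G" "carrier G \<subseteq> \<Union>\<F>" by blast
  \<comment> \<open>For a translate that contains no power of \<open>x\<close> the value is
    arbitrary, which is harmless since only translates that contain some \<open>x [^] n\<close> are
    consulted.\<close>
  define pick where "pick C = (SOME i::int. x [^] i \<in> C)" for C
  have "\<exists>i\<in>pick ` \<F>. x [^] (n - i) \<in> V" for n :: int
  proof -
    have "x [^] n \<in> \<Union>\<F>" using \<F>(3) x by auto
    then obtain C where C: "C \<in> \<F>" "x [^] n \<in> C" by blast
    then obtain g where g: "g \<in> carrier G" "C = (\<lambda>w. g \<otimes> w) ` W" using \<F>(2) by blast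
    have "x [^] pick C \<in> C" unfolding pick_def using C(2) by (rule someI)
    then obtain v w where vw: "v \<in> W" "w \<in> W" "x [^] pick C = g \<otimes> v" "x [^] n = g \<otimes> w"
      using C g by auto
    then have carr: "v \<in> carrier G" "w \<in> carrier G" using Wc by auto
    have "x [^] (n - pick C) = inv (x [^] pick C) \<otimes> x [^] n"
      using x by (simp add: int_pow_mult[symmetric] int_pow_neg[symmetric])
    also have "\<dots> = inv v \<otimes> w"
      unfolding vw using carr g by (simp add: inv_mult_group m_assoc) (simp add: m_assoc[symmetric])
    finally show ?thesis using C(1) W(5)[OF W(4)[OF vw(1)] vw(2)]
      by (intro bexI[of _ "pick C"]) auto
  qed
  then show ?thesis using \<F>(1) by blast
qed

text \<open>The exponents whose powers lie in a small \<open>V\<close> form a syndetic set, so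
  Bogoliubov's lemma finds a Bohr neighbourhood of 0 inside its double difference set, and four
  factors from \<open>V\<close> stay in \<open>U\<close>.\<close>

lemma bohr_nhd:
  assumes x: "x \<in> carrier G" and U: "openin T U" "\<one> \<in> U"
  shows "\<exists>A :: real set. finite A \<and> (\<forall>n::int. (\<forall>\<alpha>\<in>A. cmod (circ (of_int n * \<alpha>) - 1) < 1/2) \<longrightarrow> x [^] n \<in> U)"
proof -
  obtain V where V: "openin T V" "\<one> \<in> V" "V \<subseteq> U" "\<And>u. u \<in> V \<Longrightarrow> inv u \<in> V"
    "\<And>a b c d. a \<in> V \<Longrightarrow> b \<in> V \<Longrightarrow> c \<in> V \<Longrightarrow> d \<in> V \<Longrightarrow> (a \<otimes> b) \<otimes> (c \<otimes> d) \<in> U"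
    using one_nhd_shrink2[OF U] by metis
  define E where "E = {n::int. x [^] n \<in> V}"
  obtain F :: "int set" where "finite F" "\<And>n. \<exists>i\<in>F. n - i \<in> E"
    using powers_syndetic[OF x V(1,2)] unfolding E_def by auto
  then obtain A :: "real set" where A: "finite A"
    "\<And>n. (\<forall>\<alpha>\<in>A. cmod (circ (of_int n * \<alpha>) - 1) < 1/2) \<Longrightarrow> (\<exists>a\<in>E. \<exists>b\<in>E. \<exists>c\<in>E. \<exists>d\<in>E. n = a - b + (c - d))"
    using bogoliubov by metis
  have "x [^] n \<in> U" if "\<forall>\<alpha>\<in>A. cmod (circ (of_int n * \<alpha>) - 1) < 1/2" for n :: int
  proof -
    obtain a b c d where E: "a \<in> E" "b \<in> E" "c \<in> E" "d \<in> E" "n = a - b + (c - d)"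
      using A(2)[OF \<open>\<forall>\<alpha>\<in>A. _\<close>] by blast
    then have "x [^] n = (x [^] a \<otimes> inv (x [^] b)) \<otimes> (x [^] c \<otimes> inv (x [^] d))"
      using x by (simp add: int_pow_mult int_pow_neg int_pow_diff)
    then show ?thesis using E V by (simp add: E_def)
  qed
  then show ?thesis using A(1) by blast
qed

text \<open>Extension by closure: the limit of powers lying in \<open>V\<close> stays in the closure
  of \<open>V\<close>. The radius drops from 1/2 to 1/4 to absorb the approximation of
  \<open>h\<close> by an integer.\<close>

lemma bohr_limits_nhd:
  assumes x: "x \<in> carrier G" and U: "openin T U" "\<one> \<in> U"
  obtains A :: "real set" where "finite A"
    "\<And>h y. y \<in> bohr_limits x h \<Longrightarrow> (\<And>\<alpha>. \<alpha> \<in> A \<Longrightarrow> cmod (circ (h \<alpha>) - 1) < 1/4) \<Longrightarrow> y \<in> U"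
proof -
  obtain V where V: "openin T V" "\<one> \<in> V" "T closure_of V \<subseteq> U"
    using closure_in_nhd[OF U] by metis
  obtain A :: "real set" where A: "finite A" "\<And>n::int. (\<forall>\<alpha>\<in>A. cmod (circ (of_int n * \<alpha>) - 1) < 1/2) \<Longrightarrow> x [^] n \<in> V"
    using bohr_nhd[OF x V(1,2)] by blast
  show thesis
  proof (rule that[OF A(1)])
    fix h y assume y: "y \<in> bohr_limits x h" and h: "\<And>\<alpha>. \<alpha> \<in> A \<Longrightarrow> cmod (circ (h \<alpha>) - 1) < 1/4"
    show "y \<in> U"
    proof (rule ccontr)
      assume "y \<notin> U"
      define W where "W = carrier G - T closure_of V"
      have W: "openin T W" "y \<in> W"
        using V(3) \<open>y \<notin> U\<close> bohr_limits_carrier[OF y] by (auto simp: W_def openin_diff)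
      obtain n :: int where n: "\<And>\<alpha>. \<alpha> \<in> A \<Longrightarrow> cmod (circ (of_int n * \<alpha>) - circ (h \<alpha>)) < 1/4" "x [^] n \<in> W"
        using bohr_limitsD[OF y A(1) _ W, of "1/4"] by auto
      have "cmod (circ (of_int n * \<alpha>) - 1) < 1/2" if "\<alpha> \<in> A" for \<alpha>
        using norm_triangle_ineq[of "circ (of_int n * \<alpha>) - circ (h \<alpha>)" "circ (h \<alpha>) - 1"] n(1)[OF that] h[OF that]
        by simp
      then have "x [^] n \<in> V" using A(2) by blast
      then have "x [^] n \<in> T closure_of V"
        using closure_of_subset[of V T] openin_subset[OF V(1)] by blast
      then show False using n(2) by (simp add: W_def)
    qed
  qed
qed

text \<open>Single-valuedness at the trivial Bohr point; applied to a quotient of two limits it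
  shows that each \<open>h\<close> has at most one limit.\<close>

lemma bohr_limits_trivial:
  assumes x: "x \<in> carrier G" and y: "y \<in> bohr_limits x h" and h: "\<And>\<alpha>. circ (h \<alpha>) = 1"
  shows "y = \<one>"
proof (rule ccontr)
  assume "y \<noteq> \<one>"
  then obtain U where U: "openin T U" "\<one> \<in> U" "y \<notin> U"
    using Hausdorff_separate_one[OF bohr_limits_carrier[OF y]] by blast
  obtain A :: "real set" where "\<And>h y. y \<in> bohr_limits x h \<Longrightarrow> (\<And>\<alpha>. \<alpha> \<in> A \<Longrightarrow> cmod (circ (h \<alpha>) - 1) < 1/4) \<Longrightarrow> y \<in> U"
    using bohr_limits_nhd[OF x U(1,2)] by metis
  from this[OF y] show False using U(3) h by simp
qed

text \<open>The hypothesis says that \<open>h\<close> is approximable by integers, that is, a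
  genuine Bohr point. Closures of the sets of powers that meet finitely many constraints have the
  finite intersection property.\<close>

lemma bohr_limits_nonempty:
  assumes x: "x \<in> carrier G"
    and approx: "\<And>A \<epsilon>. finite A \<Longrightarrow> \<epsilon> > 0 \<Longrightarrow> \<exists>n::int. \<forall>\<alpha>\<in>A. cmod (circ (of_int n * \<alpha>) - circ (h \<alpha>)) < \<epsilon>"
  shows "bohr_limits x h \<noteq> {}"
proof -
  \<comment> \<open>A pair \<open>(\<alpha>, k)\<close> stands for the constraint at
    \<open>\<alpha>\<close> with tolerance \<open>1 / (k + 1)\<close>, so that uniting finite sets
    of pairs joins the constraints.\<close>
  define N where "N D = {n::int. \<forall>(\<alpha>, k)\<in>D. cmod (circ (of_int n * \<alpha>) - circ (h \<alpha>)) < 1 / real (Suc k)}" for D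
  define cl where "cl D = T closure_of ((\<lambda>n. x [^] n) ` N D)" for D
  define \<C> where "\<C> = cl ` {D. finite D}"
  have "\<Inter>\<F> \<noteq> {}" if \<F>: "finite \<F>" "\<F> \<subseteq> \<C>" for \<F>
  proof -
    obtain \<D> where \<D>: "\<D> \<subseteq> {D. finite D}" "finite \<D>" "\<F> = cl ` \<D>"
      using finite_subset_image[OF \<F>(1) \<F>(2)[unfolded \<C>_def]] by blast
    define D where "D = \<Union>\<D>"
    have D: "finite D" using \<D> by (auto simp: D_def)
    define \<epsilon> where "\<epsilon> = Min (insert 1 ((\<lambda>(\<alpha>, k). 1 / real (Suc k)) ` D))"
    have "\<epsilon> > 0" using D by (auto simp: \<epsilon>_def)
    then obtain n :: int where n: "\<And>\<alpha>. \<alpha> \<in> fst ` D \<Longrightarrow> cmod (circ (of_int n * \<alpha>) - circ (h \<alpha>)) < \<epsilon>"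
      using approx[of "fst ` D" \<epsilon>] D by auto
    have "cmod (circ (of_int n * \<alpha>) - circ (h \<alpha>)) < 1 / real (Suc k)" if "(\<alpha>, k) \<in> D" for \<alpha> k
    proof -
      have "\<epsilon> \<le> 1 / real (Suc k)"
        unfolding \<epsilon>_def using D that by (intro Min_le) force+
      moreover have "\<alpha> \<in> fst ` D" using that by force
      ultimately show ?thesis using n by fastforce
    qed
    then have "n \<in> N D'" if "D' \<in> \<D>" for D'
      using that by (auto simp: N_def D_def)
    then have "x [^] n \<in> cl D'" if "D' \<in> \<D>" for D'
      using that x closure_of_subset[of "(\<lambda>n. x [^] n) ` N D'" T]
      unfolding cl_def by (force simp: topspace_eq_carrier)
    then show ?thesis using \<D>(3) by auto
  qed
  moreover have "\<forall>C\<in>\<C>. closedin T C" by (auto simp: \<C>_def cl_def)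
  ultimately have "\<Inter>\<C> \<noteq> {}"
    using compact[unfolded compact_space_fip, rule_format, of \<C>] by blast
  then obtain y where y: "\<And>D. finite D \<Longrightarrow> y \<in> cl D" by (auto simp: \<C>_def)
  have "y \<in> bohr_limits x h"
    unfolding bohr_limits_def
  proof (intro CollectI conjI allI impI)
    show "y \<in> carrier G" using y[of "{}"] closure_of_subset_topspace unfolding cl_def by (metis finite.emptyI subsetD topspace_eq_carrier)
    fix A :: "real set" and \<epsilon> :: real and U assume *: "finite A" "\<epsilon> > 0" "openin T U" "y \<in> U"
    obtain k where k: "1 / real (Suc k) < \<epsilon>" using *(2) nat_approx_posE by blast
    have "y \<in> cl (A \<times> {k})" using y * by simp
    then obtain n where "n \<in> N (A \<times> {k})" "x [^] n \<in> U"
      using * unfolding cl_def in_closure_of by blast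
    then show "\<exists>n::int. (\<forall>\<alpha>\<in>A. cmod (circ (of_int n * \<alpha>) - circ (h \<alpha>)) < \<epsilon>) \<and> x [^] n \<in> U"
      using k by (intro exI[of _ n]) (force simp: N_def)
  qed
  then show ?thesis by blast
qed

end

section \<open>The sequence obtained from an element of infinite order\<close>

context compact_topological_group
begin

text \<open>Finitely many values other than \<open>\<one>\<close> form a closed set that a sequence
  tending to \<open>\<one>\<close> eventually leaves, so a value not yet used is always available
  arbitrarily far out.\<close>

lemma escaping_subsequence:
  fixes y :: "nat \<Rightarrow> 'a" and g :: "nat \<Rightarrow> nat"
  assumes y: "\<And>k. y k \<in> carrier G" "\<And>k. y k \<noteq> \<one>"
    and lim: "\<And>U. openin T U \<Longrightarrow> \<one> \<in> U \<Longrightarrow> eventually (\<lambda>k. y k \<in> U) sequentially"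
  shows "\<exists>s. (\<forall>n. s n \<ge> g n) \<and> inj (\<lambda>n. y (s n))"
proof -
  have avoid: "\<exists>k\<ge>m. y k \<notin> F" if "finite F" "F \<subseteq> range y" for F m
  proof -
    have "closedin T F"
      using Hausdorff that y(1) by (intro closedin_Hausdorff_finite) (auto simp: topspace_eq_carrier)
    moreover have "\<one> \<notin> F" using y(2) that(2) by (metis imageE subsetD)
    ultimately have "eventually (\<lambda>k. y k \<in> carrier G - F) sequentially"
      by (intro lim openin_diff) auto
    then show ?thesis
      by (metis DiffD2 eventually_sequentially nle_le)
  qed
  \<comment> \<open>The choice of an index depends on all previous ones, so the recursion produces
    growing lists; \<open>s n\<close> is the last entry of \<open>t (Suc n)\<close>.\<close>
  have "\<exists>t. \<forall>n. (length (t n) = n \<and> distinct (map y (t n)) \<and> (\<forall>i<n. t n ! i \<ge> g i)) \<and>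
      (\<exists>k. t (Suc n) = t n @ [k])"
  proof (rule dependent_nat_choice)
    show "\<exists>t. length t = 0 \<and> distinct (map y t) \<and> (\<forall>i<0. t ! i \<ge> g i)" by simp
    fix t :: "nat list" and n
    assume t: "length t = n \<and> distinct (map y t) \<and> (\<forall>i<n. t ! i \<ge> g i)"
    obtain k where "k \<ge> g n" "y k \<notin> set (map y t)"
      using avoid[of "set (map y t)" "g n"] by auto
    then show "\<exists>t'. (length t' = Suc n \<and> distinct (map y t') \<and> (\<forall>i<Suc n. t' ! i \<ge> g i)) \<and> (\<exists>k. t' = t @ [k])"
      using t by (intro exI[of _ "t @ [k]"]) (auto simp: nth_append less_Suc_eq)
  qed
  then obtain t where t: "\<And>n. length (t n) = n" "\<And>n. distinct (map y (t n))"
    "\<And>n i. i < n \<Longrightarrow> t n ! i \<ge> g i" "\<And>n. \<exists>k. t (Suc n) = t n @ [k]" by metis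
  define s where "s n = t (Suc n) ! n" for n
  have nth: "t n ! i = s i" if "i < n" for i n
    using that
  proof (induction n)
    case (Suc n)
    then show ?case
      using t(4)[of n] t(1)[of n] by (auto simp: nth_append s_def less_Suc_eq)
  qed simp
  have "y (s i) \<noteq> y (s j)" if "i < j" for i j
    using nth_eq_iff_index_eq[OF t(2)[of "Suc j"], of i j] that nth[of i "Suc j"] nth[of j "Suc j"] t(1)[of "Suc j"]
    by simp
  then have "inj (\<lambda>n. y (s n))" by (metis injI linorder_neqE_nat)
  moreover have "s n \<ge> g n" for n using t(3)[of n "Suc n"] by (simp add: s_def)
  ultimately show ?thesis by blast
qed

theorem infinite_order_sequence:
  assumes x: "x \<in> carrier G" and ord: "\<And>n::nat. n > 0 \<Longrightarrow> x [^] n \<noteq> \<one>"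
  shows "\<exists>a. range a \<subseteq> carrier G \<and> inj a \<and> small_tails G T f a"
proof -
  obtain H :: "real set" and c :: "real \<Rightarrow> real \<Rightarrow> real" where Hc: "rational_coordinates H c"
    using rational_coordinates_exist by blast
  then have H: "1 \<in> H"
    "\<And>D u. finite D \<Longrightarrow> D \<subseteq> H \<Longrightarrow> (\<Sum>d\<in>D. of_int (u d) * d) = 0 \<Longrightarrow> \<forall>d\<in>D. u d = (0::int)"
    unfolding rational_coordinates_def by blast+
  \<comment> \<open>For fixed \<open>b \<noteq> 1\<close> these sets form the image of the
    one-parameter group of Bohr points attached to the coordinate at \<open>b\<close>.\<close>
  define C where "C b t = bohr_limits x (\<lambda>\<alpha>. t * c \<alpha> b)" for b t
  have C_nonempty: "C b0 t \<noteq> {}" if b0: "b0 \<in> H - {1}" for b0 t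
    unfolding C_def
  proof (rule bohr_limits_nonempty[OF x])
    fix A :: "real set" and \<epsilon> :: real assume A: "finite A" "\<epsilon> > 0"
    obtain B q where Bq: "finite B" "B \<subseteq> H - {1}" "q > (0::int)"
      "\<And>\<alpha>. \<alpha> \<in> A \<Longrightarrow> \<alpha> = c \<alpha> 1 + (\<Sum>b\<in>B. c \<alpha> b * b)"
      "\<And>\<alpha> b. \<alpha> \<in> A \<Longrightarrow> of_int q * c \<alpha> b \<in> \<int>"
      "\<And>\<alpha> b. \<alpha> \<in> A \<Longrightarrow> b \<noteq> 1 \<Longrightarrow> b \<notin> B \<Longrightarrow> c \<alpha> b = 0"
    proof goal_cases
      case 1
      show ?case by (rule rational_coordinatesE[OF Hc A(1)]) (rule 1, assumption+)
    qed
    \<comment> \<open>If \<open>k * b\<close> is close to \<open>\<theta> b\<close> modulo 1 for all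
      \<open>b\<close>, then, because \<open>q\<close> clears the denominators,
      \<open>q * k * \<alpha>\<close> is close modulo 1 to
      \<open>q * c \<alpha> b0 * (t / q)\<close>, which is the target
      \<open>t * c \<alpha> b0\<close>.\<close>
    define \<theta> where "\<theta> b = (if b = b0 then t / of_int q else 0)" for b
    define F where "F \<alpha> w = circ (\<Sum>b\<in>B. of_int q * c \<alpha> b * (\<theta> b + w b))" for \<alpha> :: real and w :: "real \<Rightarrow> real"
    \<comment> \<open>The coefficients multiplying the Kronecker errors sum to less than
      \<open>K\<close> for every \<open>\<alpha>\<close> in \<open>A\<close>; the summand 1 keeps
      the inequality strict and \<open>K\<close> positive.\<close>
    define K where "K = 1 + (\<Sum>\<alpha>\<in>A. \<Sum>b\<in>B. \<bar>of_int q * c \<alpha> b\<bar>)"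
    have K: "K > 0" unfolding K_def by (intro add_pos_nonneg sum_nonneg) auto
    have "\<exists>\<delta>>0. \<forall>s. dist s 0 < \<delta> \<longrightarrow> dist (circ s) (circ 0) < \<epsilon>"
      using continuous_circ[of 0] A(2) unfolding continuous_at_eps_delta by blast
    then obtain \<delta> where \<delta>: "\<delta> > 0" "\<And>s. \<bar>s\<bar> < \<delta> \<Longrightarrow> cmod (circ s - 1) < \<epsilon>"
      by (auto simp: dist_norm)
    obtain k :: int and m :: "real \<Rightarrow> int" where k: "\<And>b. b \<in> B \<Longrightarrow> \<bar>of_int k * b - of_int (m b) - \<theta> b\<bar> < \<delta> / K"
      
    proof -
      have "1 \<notin> B" "insert 1 B \<subseteq> H" using Bq(2) H(1) by auto
      then have "\<exists>k::int. \<exists>m :: real \<Rightarrow> int. \<forall>b\<in>B. \<bar>of_int k * b - of_int (m b) - \<theta> b\<bar> < \<delta> / K"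
        using H(2) \<delta>(1) K Bq(1) by (intro kronecker_finite_set) (auto intro: subset_trans)
      then show thesis using that by blast
    qed
    have "cmod (circ (of_int (q * k) * \<alpha>) - circ (t * c \<alpha> b0)) < \<epsilon>" if \<alpha>: "\<alpha> \<in> A" for \<alpha>
    proof -
      define e where "e b = of_int k * b - of_int (m b) - \<theta> b" for b
      define s where "s = (\<Sum>b\<in>B. of_int q * c \<alpha> b * e b)"
      define z where "z = of_int k * (of_int q * c \<alpha> 1) + (\<Sum>b\<in>B. of_int q * c \<alpha> b * of_int (m b))"
      have z: "z \<in> \<int>" unfolding z_def 
        by (intro Ints_add Ints_sum Ints_mult[OF Ints_of_int Bq(5)[OF \<alpha>]] Ints_mult[OF Bq(5)[OF \<alpha>] Ints_of_int])
      have t: "t * c \<alpha> b0 = (\<Sum>b\<in>B. of_int q * c \<alpha> b * \<theta> b)"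
      proof -
        have "(\<Sum>b\<in>B. of_int q * c \<alpha> b * \<theta> b) = (\<Sum>b\<in>B. if b = b0 then t * c \<alpha> b0 else 0)"
          using Bq(3) by (intro sum.cong) (auto simp: \<theta>_def)
        also have "\<dots> = t * c \<alpha> b0"
          using Bq(1) Bq(6)[OF \<alpha>, of b0] b0 by auto
        finally show ?thesis by simp
      qed
      have "of_int (q * k) * \<alpha> = of_int k * (of_int q * c \<alpha> 1) + (\<Sum>b\<in>B. of_int q * c \<alpha> b * (of_int k * b))"
        by (subst Bq(4)[OF \<alpha>]) (simp add: algebra_simps sum_distrib_left)
      also have "(\<Sum>b\<in>B. of_int q * c \<alpha> b * (of_int k * b)) =
          (\<Sum>b\<in>B. of_int q * c \<alpha> b * of_int (m b) + of_int q * c \<alpha> b * \<theta> b + of_int q * c \<alpha> b * e b)"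
        by (intro sum.cong refl) (simp add: e_def algebra_simps)
      finally have sum: "of_int (q * k) * \<alpha> = z + t * c \<alpha> b0 + s"
        unfolding t z_def s_def by (simp add: sum.distrib)
      have "circ z = 1" using z circ_eq_1_iff by blast
      then have eq: "circ (of_int (q * k) * \<alpha>) = circ (t * c \<alpha> b0) * circ s"
        by (simp only: sum circ_add mult_1_left)
      have each: "\<bar>of_int q * c \<alpha> b * e b\<bar> \<le> \<bar>of_int q * c \<alpha> b\<bar> * (\<delta> / K)" if "b \<in> B" for b
        unfolding abs_mult[of "of_int q * c \<alpha> b" "e b"]
        by (rule mult_left_mono) (use k[OF that] in \<open>auto simp: e_def\<close>)
      have "\<bar>s\<bar> \<le> (\<Sum>b\<in>B. \<bar>of_int q * c \<alpha> b\<bar> * (\<delta> / K))"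
        unfolding s_def by (rule order_trans[OF sum_abs sum_mono]) (rule each)
      also have "\<dots> = (\<Sum>b\<in>B. \<bar>of_int q * c \<alpha> b\<bar>) * (\<delta> / K)" by (rule sum_distrib_right[symmetric])
      also have "\<dots> < K * (\<delta> / K)"
      proof (rule mult_strict_right_mono)
        have "(\<Sum>b\<in>B. \<bar>of_int q * c \<alpha> b\<bar>) \<le> (\<Sum>\<alpha>\<in>A. \<Sum>b\<in>B. \<bar>of_int q * c \<alpha> b\<bar>)"
          using A(1) \<alpha> by (intro member_le_sum[of \<alpha> A "\<lambda>\<alpha>. \<Sum>b\<in>B. \<bar>of_int q * c \<alpha> b\<bar>"]) (auto intro: sum_nonneg)
        then show "(\<Sum>b\<in>B. \<bar>of_int q * c \<alpha> b\<bar>) < K" by (simp add: K_def)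
      qed (use K \<delta> in simp)
      finally have "\<bar>s\<bar> < \<delta>" using K by simp
      moreover have "circ (of_int (q * k) * \<alpha>) - circ (t * c \<alpha> b0) = circ (t * c \<alpha> b0) * (circ s - 1)"
        unfolding eq by (simp add: algebra_simps)
      ultimately show ?thesis using \<delta>(2) by (simp add: norm_mult)
    qed
    then show "\<exists>n::int. \<forall>\<alpha>\<in>A. cmod (circ (of_int n * \<alpha>) - circ (t * c \<alpha> b0)) < \<epsilon>" by blast
  qed
  show ?thesis
  proof (cases "\<exists>b\<in>H - {1}. \<exists>t. \<exists>y\<in>C b t. y \<noteq> \<one>")
    case True
    then obtain b t y where b: "b \<in> H - {1}" and y: "y \<in> C b t" "y \<noteq> \<one>" by blast
    have "\<forall>k. \<exists>u. u \<in> C b (t / 2 ^ k)" using C_nonempty[OF b] by blast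
    then obtain u where u: "\<And>k::nat. u k \<in> C b (t / 2 ^ k)" by metis
    have uc: "u k \<in> carrier G" for k using u bohr_limits_carrier unfolding C_def by blast
    \<comment> \<open>The power of \<open>u k\<close> with exponent \<open>2 ^ k\<close> lies in
      \<open>C b t\<close>, where \<open>y\<close> is the only element; hence
      \<open>u k = \<one>\<close> would force \<open>y = \<one>\<close>.\<close>
    have u1: "u k \<noteq> \<one>" for k
    proof
      assume "u k = \<one>"
      then have "\<one> [^] (2 ^ k :: nat) \<in> bohr_limits x (\<lambda>\<alpha>. of_nat (2 ^ k) * (t / 2 ^ k * c \<alpha> b))"
        using bohr_limits_nat_pow[OF x u[of k, unfolded C_def], of "2 ^ k"] by simp
      then have "\<one> \<in> bohr_limits x (\<lambda>\<alpha>. t * c \<alpha> b)" by simp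
      from bohr_limits_mult[OF x y(1)[unfolded C_def] bohr_limits_inv[OF x this]]
      have "y = \<one>"
        using bohr_limits_trivial[OF x] bohr_limits_carrier[OF y(1)[unfolded C_def]] by simp
      then show False using y(2) by simp
    qed
    have small: "\<exists>\<delta>>0. \<forall>\<tau> w. \<bar>\<tau>\<bar> < \<delta> \<longrightarrow> w \<in> C b \<tau> \<longrightarrow> w \<in> U" if U: "openin T U" "\<one> \<in> U" for U
    proof -
      obtain A :: "real set" where A: "finite A"
        "\<And>h y. y \<in> bohr_limits x h \<Longrightarrow> (\<And>\<alpha>. \<alpha> \<in> A \<Longrightarrow> cmod (circ (h \<alpha>) - 1) < 1/4) \<Longrightarrow> y \<in> U"
        using bohr_limits_nhd[OF x U] by metis
      have "eventually (\<lambda>\<tau>. \<forall>\<alpha>\<in>A. cmod (circ (\<tau> * c \<alpha> b) - 1) < 1/4) (nhds 0)"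
      proof (intro eventually_ball_finite A ballI)
        fix \<alpha>
        have "((\<lambda>\<tau>. cmod (circ (\<tau> * c \<alpha> b) - 1)) \<longlongrightarrow> cmod (circ (0 * c \<alpha> b) - 1)) (nhds 0)"
          by (intro tendsto_intros filterlim_ident)
        then show "eventually (\<lambda>\<tau>. cmod (circ (\<tau> * c \<alpha> b) - 1) < 1/4) (nhds 0)"
          by (rule order_tendstoD(2)) simp
      qed
      then obtain d where d: "d > 0" "\<And>\<tau> \<alpha>. dist \<tau> 0 < d \<Longrightarrow> \<alpha> \<in> A \<Longrightarrow> cmod (circ (\<tau> * c \<alpha> b) - 1) < 1/4"
        unfolding eventually_nhds_metric by blast
      then show ?thesis
        using A(2) unfolding C_def by (intro exI[of _ d]) (auto simp: dist_norm)
    qed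
    \<comment> \<open>Since \<open>f n \<le> 2 ^ f n\<close>, the part \<open>f n\<close> of the
      exponent of 2 absorbs the allowed powers, and the part \<open>n\<close> leaves the summable
      bound \<open>\<bar>t\<bar> * (1 / 2) ^ n\<close>.\<close>
    have "\<exists>s. (\<forall>n. s n \<ge> n + f n) \<and> inj (\<lambda>n. u (s n))"
    proof (rule escaping_subsequence[OF uc u1])
      fix U assume "openin T U" "\<one> \<in> U"
      then obtain \<delta> where \<delta>: "\<delta> > 0" "\<And>\<tau> w. \<bar>\<tau>\<bar> < \<delta> \<Longrightarrow> w \<in> C b \<tau> \<Longrightarrow> w \<in> U" using small by blast
      have "(\<lambda>k. \<bar>t / 2 ^ k\<bar>) \<longlonglongrightarrow> 0"
        using tendsto_mult_right_zero[OF LIMSEQ_divide_realpow_zero[of 2 1], of "\<bar>t\<bar>"] by (simp add: abs_mult)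
      then have "eventually (\<lambda>k. \<bar>t / 2 ^ k\<bar> < \<delta>) sequentially"
        using \<delta>(1) by (rule order_tendstoD(2))
      then show "eventually (\<lambda>k. u k \<in> U) sequentially"
        by eventually_elim (use \<delta>(2) u in blast)
    qed
    then obtain s where s: "\<And>n. s n \<ge> n + f n" "inj (\<lambda>n. u (s n))" by blast
    define a where "a n = u (s n)" for n
    have "small_tails G T f a"
      unfolding small_tails_def
    proof (intro allI impI)
      fix U assume U: "openin T U \<and> \<one> \<in> U"
      then obtain \<delta> where \<delta>: "\<delta> > 0" "\<And>\<tau> w. \<bar>\<tau>\<bar> < \<delta> \<Longrightarrow> w \<in> C b \<tau> \<Longrightarrow> w \<in> U" using small by blast
      define g :: "nat \<Rightarrow> real" where "g n = \<bar>t\<bar> * (1 / 2) ^ n" for n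
      have g: "summable g" "\<And>n. g n \<ge> 0" unfolding g_def by (auto intro: summable_geometric)
      obtain m where m: "\<And>n. norm (sum g {m..<n}) < \<delta>"
        using g(1)[unfolded summable_Cauchy, rule_format, OF \<delta>(1)] by blast
      have "lprod G (\<lambda>n. a n [^] z n) ns \<in> U"
        if z: "\<forall>n. \<bar>z n\<bar> \<le> int (f n)" and ns: "distinct ns" "set ns \<subseteq> {m..}" for z :: "nat \<Rightarrow> int" and ns
      proof (rule \<delta>(2))
        \<comment> \<open>Parameters add when elements are multiplied, so the product lies over a
          sum of reals; its order no longer matters and its size is bounded by a tail of a geometric
          series.\<close>
        let ?\<tau> = "\<lambda>ns. \<Sum>n\<leftarrow>ns. of_int (z n) * (t / 2 ^ s n)"
        show "lprod G (\<lambda>n. a n [^] z n) ns \<in> C b (?\<tau> ns)"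
        proof (induction ns)
          case Nil
          then show ?case using bohr_limits_one[OF x] by (simp add: C_def)
        next
          case (Cons n ns)
          show ?case
            using bohr_limits_mult[OF x bohr_limits_int_pow[OF x u[of "s n", unfolded C_def], of "z n"] Cons[unfolded C_def]]
            by (simp add: C_def a_def algebra_simps)
        qed
        have bound: "\<bar>of_int (z n) * (t / 2 ^ s n)\<bar> \<le> g n" for n
        proof -
          have "real_of_int \<bar>z n\<bar> \<le> real (f n)" using z by (metis of_int_le_iff of_int_of_nat_eq)
          also have "real (f n) \<le> 2 ^ f n" using of_nat_less_two_power[of "f n"] by (simp add: less_imp_le)
          finally have zf: "\<bar>real_of_int (z n)\<bar> \<le> 2 ^ f n" by simp
          have "\<bar>of_int (z n) * (t / 2 ^ s n)\<bar> = \<bar>real_of_int (z n)\<bar> * (\<bar>t\<bar> / 2 ^ s n)"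
            by (simp add: abs_mult)
          also have "\<dots> \<le> 2 ^ f n * (\<bar>t\<bar> / 2 ^ (n + f n))"
            using zf s(1)[of n] by (intro mult_mono divide_left_mono power_increasing) auto
          also have "\<dots> = g n" by (simp add: g_def power_add power_one_over field_simps)
          finally show ?thesis .
        qed
        have "\<bar>?\<tau> ns\<bar> = \<bar>\<Sum>n\<in>set ns. of_int (z n) * (t / 2 ^ s n)\<bar>"
          using ns(1) by (simp add: sum_list_distinct_conv_sum_set)
        also have "\<dots> \<le> (\<Sum>n\<in>set ns. g n)"
          by (rule order_trans[OF sum_abs sum_mono]) (rule bound)
        also have "\<dots> \<le> sum g {m..<Suc (Max (insert 0 (set ns)))}"
          using ns(2) g(2) by (intro sum_mono2) (auto simp: less_Suc_eq_le)
        also have "\<dots> < \<delta>" using m by (metis abs_ge_self le_less_trans real_norm_def)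
        finally show "\<bar>?\<tau> ns\<bar> < \<delta>" .
      qed
      then show "\<exists>m. \<forall>z :: nat \<Rightarrow> int. \<forall>ns. (\<forall>n. \<bar>z n\<bar> \<le> int (f n)) \<longrightarrow> distinct ns \<longrightarrow> set ns \<subseteq> {m..} \<longrightarrow>
        lprod G (\<lambda>n. a n [^] z n) ns \<in> U" by blast
    qed
    moreover have "inj a" "range a \<subseteq> carrier G" using s(2) uc by (auto simp: a_def[abs_def])
    ultimately show ?thesis by blast
  next
    case False
    have one: "\<one> \<in> C b t" if b: "b \<in> H - {1}" for b t
    proof -
      obtain y where "y \<in> C b t" using C_nonempty[OF b, of t] by blast
      moreover from this have "y = \<one>" using False b by blast
      ultimately show ?thesis by simp
    qed
    \<comment> \<open>Every \<open>q\<close> divides almost all factorials, so the sequence enters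
      each group generated by some \<open>x [^] q\<close>. The shift by \<open>Suc\<close> avoids
      the repetition of 1 at the factorials of 0 and 1.\<close>
    define a where "a n = x [^] (fact (Suc n) :: nat)" for n
    have "inj a"
    proof -
      have "a i \<noteq> a j" if "i < j" for i j
      proof
        assume "a i = a j"
        have lt: "fact (Suc i) < (fact (Suc j) :: nat)" using that by (intro fact_less_mono_nat) auto
        then have "x [^] (fact (Suc j) :: nat) = x [^] (fact (Suc i) :: nat) \<otimes> x [^] (fact (Suc j) - fact (Suc i) :: nat)"
          using x by (simp add: nat_pow_mult del: fact_Suc)
        then have "x [^] (fact (Suc j) - fact (Suc i) :: nat) = \<one>"
          using \<open>a i = a j\<close> x unfolding a_def by (metis nat_pow_closed l_cancel_one)
        then show False using ord lt by simp
      qed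
      then show ?thesis by (metis injI linorder_neqE_nat)
    qed
    moreover have "range a \<subseteq> carrier G" using x by (auto simp: a_def)
    moreover have "small_tails G T f a"
    proof (rule small_tails_subgroups)
      fix U assume U: "openin T U" "\<one> \<in> U"
      obtain A :: "real set" where A: "finite A"
        "\<And>h y. y \<in> bohr_limits x h \<Longrightarrow> (\<And>\<alpha>. \<alpha> \<in> A \<Longrightarrow> cmod (circ (h \<alpha>) - 1) < 1/4) \<Longrightarrow> y \<in> U"
        using bohr_limits_nhd[OF x U] by metis
      obtain B q where Bq: "finite B" "B \<subseteq> H - {1}" "q > (0::int)"
        "\<And>\<alpha>. \<alpha> \<in> A \<Longrightarrow> \<alpha> = c \<alpha> 1 + (\<Sum>b\<in>B. c \<alpha> b * b)"
        "\<And>\<alpha> b. \<alpha> \<in> A \<Longrightarrow> of_int q * c \<alpha> b \<in> \<int>"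
      proof goal_cases
        case 1
        show ?case by (rule rational_coordinatesE[OF Hc A(1)]) (rule 1, assumption+)
      qed
      define K where "K = (\<lambda>n. x [^] (q * n)) ` (UNIV :: int set)"
      have "subgroup K G"
      proof (rule subgroupI)
        show "K \<subseteq> carrier G" "K \<noteq> {}" using x by (auto simp: K_def)
        show "inv y \<in> K" if "y \<in> K" for y
        proof -
          obtain n where "y = x [^] (q * n)" using \<open>y \<in> K\<close> unfolding K_def by (elim imageE)
          then have "inv y = x [^] (q * (- n))" using x int_pow_neg[of x "q * n"] by simp
          then show ?thesis unfolding K_def by blast
        qed
        show "y \<otimes> w \<in> K" if "y \<in> K" "w \<in> K" for y w
        proof -
          obtain n m where "y = x [^] (q * n)" "w = x [^] (q * m)"
            using \<open>y \<in> K\<close> \<open>w \<in> K\<close> unfolding K_def by (elim imageE)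
          then have "y \<otimes> w = x [^] (q * (n + m))" using x by (simp add: int_pow_mult distrib_left)
          then show ?thesis unfolding K_def by blast
        qed
      qed
      moreover have "K \<subseteq> U"
      proof
        fix y assume "y \<in> K"
        then obtain k where y: "y = x [^] (q * k)" by (auto simp: K_def)
        define n where "n = q * k"
        \<comment> \<open>As all one-parameter groups are trivial, \<open>\<one>\<close> lies over
          the irrational part of the parameter of \<open>x [^] n\<close>. Subtracting that part
          leaves \<open>k * (q * c \<alpha> 1)\<close>, an integer for every \<open>\<alpha>\<close>
          in \<open>A\<close>.\<close>
        have "\<one> \<in> bohr_limits x (\<lambda>\<alpha>. \<Sum>b\<in>B. of_int n * b * c \<alpha> b)"
          using Bq(1,2)
        proof (induction B rule: finite_induct)
          case empty
          then show ?case using bohr_limits_one[OF x] by simp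
        next
          case (insert b B)
          then show ?case
            using bohr_limits_mult[OF x one[of b "of_int n * b", unfolded C_def] insert.IH] by simp
        qed
        from bohr_limits_mult[OF x bohr_limits_pow[OF x, of n] bohr_limits_inv[OF x this]]
        have "y \<in> bohr_limits x (\<lambda>\<alpha>. of_int n * \<alpha> + - (\<Sum>b\<in>B. of_int n * b * c \<alpha> b))"
          using x by (simp add: y n_def)
        then show "y \<in> U"
        proof (rule A(2))
          fix \<alpha> assume \<alpha>: "\<alpha> \<in> A"
          have "of_int n * \<alpha> + - (\<Sum>b\<in>B. of_int n * b * c \<alpha> b) = of_int k * (of_int q * c \<alpha> 1)"
            by (subst Bq(4)[OF \<alpha>]) (simp add: n_def algebra_simps sum_distrib_left)
          also have "\<dots> \<in> \<int>" by (rule Ints_mult[OF Ints_of_int Bq(5)[OF \<alpha>]])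
          finally have "circ (of_int n * \<alpha> + - (\<Sum>b\<in>B. of_int n * b * c \<alpha> b)) = 1"
            by (simp only: circ_eq_1_iff)
          then show "cmod (circ (of_int n * \<alpha> + - (\<Sum>b\<in>B. of_int n * b * c \<alpha> b)) - 1) < 1/4" by simp
        qed
      qed
      moreover have "a n \<in> K" if "n \<ge> nat q" for n
      proof -
        have "nat q dvd fact (Suc n)" using that Bq(3) by (intro dvd_fact) auto
        then obtain k where "fact (Suc n) = nat q * k" by blast
        then have "int (fact (Suc n)) = q * int k" using Bq(3) by (metis int_nat_eq less_imp_le of_nat_mult)
        then have "a n = x [^] (q * int k)" unfolding a_def by (metis int_pow_int)
        then show ?thesis by (simp add: K_def)
      qed
      ultimately show "\<exists>H. subgroup H G \<and> H \<subseteq> U \<and> eventually (\<lambda>n. a n \<in> H) sequentially"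
        by (auto simp: eventually_sequentially)
    qed fact
    ultimately show ?thesis by blast
  qed
qed

end

section \<open>The invariant mean of a compact group\<close>

lemma continuous_map_realI:
  fixes f :: "'a \<Rightarrow> real"
  assumes "\<And>x \<epsilon>. x \<in> topspace X \<Longrightarrow> \<epsilon> > 0 \<Longrightarrow> \<exists>V. openin X V \<and> x \<in> V \<and> (\<forall>y\<in>V. \<bar>f y - f x\<bar> < \<epsilon>)"
  shows "continuous_map X euclideanreal f"
  unfolding continuous_map_def
proof (intro conjI allI impI)
  fix U assume "openin euclideanreal U"
  then have "open U" by simp
  show "openin X {x \<in> topspace X. f x \<in> U}"
  proof (subst openin_subopen, intro ballI)
    fix x assume x: "x \<in> {x \<in> topspace X. f x \<in> U}"
    then obtain \<epsilon> where \<epsilon>: "\<epsilon> > 0" "ball (f x) \<epsilon> \<subseteq> U" using \<open>open U\<close> by (auto simp: open_contains_ball)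
    then obtain V where V: "openin X V" "x \<in> V" "\<forall>y\<in>V. \<bar>f y - f x\<bar> < \<epsilon>" using assms[of x \<epsilon>] x by auto
    then have "V \<subseteq> {x \<in> topspace X. f x \<in> U}"
      using \<epsilon>(2) openin_subset[OF V(1)] by (auto simp: subset_iff dist_real_def abs_minus_commute)
    then show "\<exists>V. openin X V \<and> x \<in> V \<and> V \<subseteq> {x \<in> topspace X. f x \<in> U}" using V by blast
  qed
qed simp

text \<open>The tube lemma, applied to the compact slice over \<open>y0\<close> inside the open set
  where the kernel differs little from its values on the slice.\<close>

lemma continuous_map_uniform_near:
  fixes k :: "'a \<Rightarrow> 'b \<Rightarrow> real"
  assumes k: "continuous_map (prod_topology X Y) euclideanreal (\<lambda>(x, y). k x y)"
    and X: "compact_space X" and y0: "y0 \<in> topspace Y" and "\<epsilon> > 0"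
  obtains V where "openin Y V" "y0 \<in> V" "\<And>x y. x \<in> topspace X \<Longrightarrow> y \<in> V \<Longrightarrow> \<bar>k x y - k x y0\<bar> < \<epsilon>"
proof -
  let ?P = "prod_topology X Y"
  define W where "W = {z \<in> topspace ?P. (\<lambda>z. \<bar>k (fst z) (snd z) - k (fst z) y0\<bar>) z \<in> {..<\<epsilon>}}"
  have k': "continuous_map ?P euclideanreal (\<lambda>z. k (fst z) (snd z))"
    using k by (simp add: case_prod_beta')
  have "continuous_map ?P ?P (\<lambda>z. (fst z, y0))"
    using y0 by (intro continuous_map_pairedI continuous_map_fst) auto
  from continuous_map_compose[OF this k'] have "continuous_map ?P euclideanreal (\<lambda>z. k (fst z) y0)"
    by (simp add: o_def)
  with k' have "continuous_map ?P euclideanreal (\<lambda>z. \<bar>k (fst z) (snd z) - k (fst z) y0\<bar>)"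
    by (intro continuous_intros)
  then have "openin ?P W" unfolding W_def by (rule openin_continuous_map_preimage) auto
  moreover have "topspace X \<times> {y0} \<subseteq> W" using y0 \<open>\<epsilon> > 0\<close> by (auto simp: W_def)
  ultimately obtain U V where UV: "openin X U" "openin Y V" "topspace X \<subseteq> U" "{y0} \<subseteq> V" "U \<times> V \<subseteq> W"
    using Wallace_theorem_prod_topology[of X "topspace X" Y "{y0}" W] X y0 by (auto simp: compact_space_def)
  show thesis
  proof (rule that[OF UV(2)])
    show "\<bar>k x y - k x y0\<bar> < \<epsilon>" if "x \<in> topspace X" "y \<in> V" for x y
    proof -
      have "(x, y) \<in> W" using UV that by blast
      then show ?thesis by (simp add: W_def)
    qed
  qed (use UV in auto)
qed

section \<open>Finite averages over left and right translates\<close>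

context group
begin

text \<open>Averages are operators rather than functions, so that one of them can be applied to
  several functions and, by associativity, commuted with right averages.\<close>

inductive_set averages :: "(('a \<Rightarrow> real) \<Rightarrow> 'a \<Rightarrow> real) set" where
  base: "finite S \<Longrightarrow> S \<noteq> {} \<Longrightarrow> S \<subseteq> carrier G \<Longrightarrow> (\<lambda>f x. (\<Sum>g\<in>S. f (g \<otimes> x)) / card S) \<in> averages"
| comp: "P \<in> averages \<Longrightarrow> Q \<in> averages \<Longrightarrow> (\<lambda>f. P (Q f)) \<in> averages"

inductive_set right_averages :: "(('a \<Rightarrow> real) \<Rightarrow> 'a \<Rightarrow> real) set" where
  base: "finite S \<Longrightarrow> S \<noteq> {} \<Longrightarrow> S \<subseteq> carrier G \<Longrightarrow> (\<lambda>f x. (\<Sum>g\<in>S. f (x \<otimes> g)) / card S) \<in> right_averages"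
| comp: "P \<in> right_averages \<Longrightarrow> Q \<in> right_averages \<Longrightarrow> (\<lambda>f. P (Q f)) \<in> right_averages"

lemma averages_cong:
  "P \<in> averages \<Longrightarrow> (\<And>x. x \<in> carrier G \<Longrightarrow> f x = f' x) \<Longrightarrow> x \<in> carrier G \<Longrightarrow> P f x = P f' x"
proof (induction arbitrary: f f' x rule: averages.induct)
  case (base S)
  have "(\<Sum>g\<in>S. f (g \<otimes> x)) = (\<Sum>g\<in>S. f' (g \<otimes> x))"
    by (intro sum.cong refl base.prems(1) m_closed) (use base.hyps(3) base.prems(2) in blast)+
  then show ?case by simp
next
  case (comp P Q)
  show ?case by (rule comp.IH(1)[OF comp.IH(2)[OF comp.prems(1)] comp.prems(2)])
qed

lemma averages_add: "P \<in> averages \<Longrightarrow> P (\<lambda>x. f x + g x) = (\<lambda>x. P f x + P g x)"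
  by (induction arbitrary: f g rule: averages.induct) (simp_all add: sum.distrib add_divide_distrib)

lemma averages_scale: "P \<in> averages \<Longrightarrow> P (\<lambda>x. c * f x) = (\<lambda>x. c * P f x)"
  by (induction arbitrary: f rule: averages.induct) (simp_all add: sum_distrib_left[symmetric])

lemma averages_const: "P \<in> averages \<Longrightarrow> P (\<lambda>x. c) = (\<lambda>x. c)"
  by (induction rule: averages.induct) simp_all

lemma averages_le:
  "P \<in> averages \<Longrightarrow> (\<And>x. x \<in> carrier G \<Longrightarrow> f x \<le> b) \<Longrightarrow> x \<in> carrier G \<Longrightarrow> P f x \<le> b"
proof (induction arbitrary: f x rule: averages.induct)
  case (base S)
  then have "(\<Sum>g\<in>S. f (g \<otimes> x)) \<le> of_nat (card S) * b"
    by (intro sum_bounded_above) auto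
  moreover have "card S > 0" using base by (simp add: card_gt_0_iff)
  ultimately show ?case by (simp add: divide_le_eq mult.commute)
next
  case (comp P Q)
  show ?case by (rule comp.IH(1)) (use comp in auto)
qed

lemma averages_mono:
  assumes "P \<in> averages" "\<And>x. x \<in> carrier G \<Longrightarrow> f x \<le> g x" "x \<in> carrier G"
  shows "P f x \<le> P g x"
proof -
  have "P (\<lambda>x. f x + (- 1) * g x) x \<le> 0"
    using averages_le[OF assms(1), of "\<lambda>x. f x + (- 1) * g x" 0 x] assms(2,3) by simp
  then show ?thesis unfolding averages_add[OF assms(1)] averages_scale[OF assms(1)] by simp
qed

lemma averages_dist:
  assumes "P \<in> averages" "\<And>x. x \<in> carrier G \<Longrightarrow> \<bar>f x - g x\<bar> \<le> b" "x \<in> carrier G"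
  shows "\<bar>P f x - P g x\<bar> \<le> b"
proof -
  have *: "f x \<le> g x + b" "g x + (- b) \<le> f x" if "x \<in> carrier G" for x
    using assms(2)[OF that] by (simp_all add: abs_le_iff)
  have "P f x \<le> P (\<lambda>x. g x + b) x" "P (\<lambda>x. g x + (- b)) x \<le> P f x"
    by (rule averages_mono[OF assms(1) _ assms(3)], fact *)+
  then show ?thesis
    unfolding averages_add[OF assms(1)] averages_const[OF assms(1)] by linarith
qed

lemma averages_dist_const:
  assumes "P \<in> averages" "\<And>x. x \<in> carrier G \<Longrightarrow> \<bar>f x - c\<bar> \<le> b" "x \<in> carrier G"
  shows "\<bar>P f x - c\<bar> \<le> b"
  using averages_dist[OF assms(1), of f "\<lambda>_. c" b x] assms(2,3) averages_const[OF assms(1)] by simp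

lemma averages_right_translate:
  "P \<in> averages \<Longrightarrow> h \<in> carrier G \<Longrightarrow> x \<in> carrier G \<Longrightarrow> P (\<lambda>x. f (x \<otimes> h)) x = P f (x \<otimes> h)"
proof (induction arbitrary: f x rule: averages.induct)
  case (base S)
  have "(\<Sum>g\<in>S. f (g \<otimes> x \<otimes> h)) = (\<Sum>g\<in>S. f (g \<otimes> (x \<otimes> h)))"
    using base by (intro sum.cong refl) (simp add: m_assoc subset_iff)
  then show ?case by simp
next
  case (comp P Q)
  have "P (Q (\<lambda>x. f (x \<otimes> h))) x = P (\<lambda>x. Q f (x \<otimes> h)) x"
    by (rule averages_cong) (use comp in auto)
  also have "\<dots> = P (Q f) (x \<otimes> h)" using comp by simp
  finally show ?case .
qed

text \<open>Inversion exchanges left and right translations, so statements about left averages need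
  to be proved only once.\<close>

lemma right_averages_via_inv:
  "P \<in> averages \<Longrightarrow> \<exists>Q\<in>right_averages. \<forall>f. \<forall>x\<in>carrier G. Q f x = P (\<lambda>y. f (inv y)) (inv x)"
proof (induction rule: averages.induct)
  case (base S)
  let ?S = "m_inv G ` S"
  have inj: "inj_on (m_inv G) S" 
  proof (rule inj_onI)
    fix a b assume "a \<in> S" "b \<in> S" "inv a = inv b"
    moreover from this have "inv (inv a) = inv (inv b)" by simp
    ultimately show "a = b" using base(3) by (metis inv_inv subsetD)
  qed
  have A: "(\<lambda>f x. (\<Sum>g\<in>?S. f (x \<otimes> g)) / card ?S) \<in> right_averages"
    using base by (intro right_averages.base) auto
  have B: "(\<Sum>g\<in>?S. f (x \<otimes> g)) / card ?S = (\<Sum>g\<in>S. f (inv (g \<otimes> inv x))) / card S"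
    if x: "x \<in> carrier G" for f x
  proof -
    have "(\<Sum>g\<in>?S. f (x \<otimes> g)) = (\<Sum>g\<in>S. f (x \<otimes> inv g))"
      using inj by (simp add: sum.reindex)
    also have "\<dots> = (\<Sum>g\<in>S. f (inv (g \<otimes> inv x)))"
      using base(3) x by (intro sum.cong refl) (simp add: inv_mult_group subset_iff)
    finally show ?thesis using inj by (simp add: card_image)
  qed
  show ?case by (rule bexI[OF _ A]) (intro allI ballI B)
next
  case (comp P1 P2)
  then obtain Q1 Q2 where Q: "Q1 \<in> right_averages" "Q2 \<in> right_averages"
    "\<And>f x. x \<in> carrier G \<Longrightarrow> Q1 f x = P1 (\<lambda>y. f (inv y)) (inv x)"
    "\<And>f x. x \<in> carrier G \<Longrightarrow> Q2 f x = P2 (\<lambda>y. f (inv y)) (inv x)" by metis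
  have "Q1 (Q2 f) x = P1 (P2 (\<lambda>y. f (inv y))) (inv x)" if "x \<in> carrier G" for f x
    unfolding Q(3)[OF that] by (rule averages_cong[OF comp.hyps(1)]) (use Q(4) that in auto)
  then show ?case using right_averages.comp[OF Q(1,2)] by (intro bexI[of _ "\<lambda>f. Q1 (Q2 f)"]) auto
qed

lemma right_averages_cong:
  "P \<in> right_averages \<Longrightarrow> (\<And>x. x \<in> carrier G \<Longrightarrow> f x = f' x) \<Longrightarrow> x \<in> carrier G \<Longrightarrow> P f x = P f' x"
proof (induction arbitrary: f f' x rule: right_averages.induct)
  case (base S)
  have "(\<Sum>g\<in>S. f (x \<otimes> g)) = (\<Sum>g\<in>S. f' (x \<otimes> g))"
    by (intro sum.cong refl base.prems(1) m_closed) (use base.hyps(3) base.prems(2) in blast)+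
  then show ?case by simp
next
  case (comp P Q)
  show ?case by (rule comp.IH(1)[OF comp.IH(2)[OF comp.prems(1)] comp.prems(2)])
qed

lemma right_averages_dist_const:
  "P \<in> right_averages \<Longrightarrow> (\<And>x. x \<in> carrier G \<Longrightarrow> \<bar>f x - c\<bar> \<le> b) \<Longrightarrow> x \<in> carrier G \<Longrightarrow> \<bar>P f x - c\<bar> \<le> b"
proof (induction arbitrary: f x rule: right_averages.induct)
  case (base S)
  have S: "card S > 0" using base by (simp add: card_gt_0_iff)
  have "\<bar>\<Sum>g\<in>S. (f (x \<otimes> g) - c)\<bar> \<le> (\<Sum>g\<in>S. b)"
    using base by (intro order_trans[OF sum_abs] sum_mono) auto
  moreover have "(\<Sum>g\<in>S. f (x \<otimes> g)) / card S - c = (\<Sum>g\<in>S. (f (x \<otimes> g) - c)) / card S"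
    using S by (simp add: sum_subtractf field_simps)
  ultimately show ?case using S by (simp add: divide_le_eq mult.commute)
next
  case (comp P Q)
  show ?case by (rule comp.IH(1)) (use comp in auto)
qed

lemma right_averages_commute_base:
  assumes "Q \<in> right_averages" "finite S" "S \<noteq> {}" "S \<subseteq> carrier G" "x \<in> carrier G"
  shows "Q (\<lambda>x. (\<Sum>g\<in>S. f (g \<otimes> x)) / card S) x = (\<Sum>g\<in>S. Q f (g \<otimes> x)) / card S"
  using assms
proof (induction arbitrary: f x rule: right_averages.induct)
  case (base R)
  have "(\<Sum>h\<in>R. (\<Sum>g\<in>S. f (g \<otimes> (x \<otimes> h))) / card S) / card R = (\<Sum>h\<in>R. \<Sum>g\<in>S. f (g \<otimes> (x \<otimes> h)) / card S / card R)"
    by (simp add: sum_divide_distrib)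
  also have "\<dots> = (\<Sum>g\<in>S. \<Sum>h\<in>R. f (g \<otimes> (x \<otimes> h)) / card S / card R)"
    by (rule sum.swap)
  also have "\<dots> = (\<Sum>g\<in>S. \<Sum>h\<in>R. f (g \<otimes> x \<otimes> h) / card R / card S)"
    using base by (intro sum.cong refl) (auto simp: subset_iff m_assoc field_simps)
  also have "\<dots> = (\<Sum>g\<in>S. (\<Sum>h\<in>R. f (g \<otimes> x \<otimes> h)) / card R) / card S"
    by (simp add: sum_divide_distrib)
  finally show ?case .
next
  case (comp P Q)
  have "P (Q (\<lambda>x. (\<Sum>g\<in>S. f (g \<otimes> x)) / card S)) x = P (\<lambda>x. (\<Sum>g\<in>S. Q f (g \<otimes> x)) / card S) x"
    by (rule right_averages_cong[OF comp.hyps(1)]) (use comp in auto)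
  also have "\<dots> = (\<Sum>g\<in>S. P (Q f) (g \<otimes> x)) / card S" using comp by auto
  finally show ?case .
qed

lemma averages_commute:
  "P \<in> averages \<Longrightarrow> Q \<in> right_averages \<Longrightarrow> x \<in> carrier G \<Longrightarrow> Q (P f) x = P (Q f) x"
proof (induction arbitrary: f x rule: averages.induct)
  case (base S)
  then show ?case by (intro right_averages_commute_base)
next
  case (comp P1 P2)
  have "Q (P1 (P2 f)) x = P1 (Q (P2 f)) x" using comp by auto
  also have "\<dots> = P1 (P2 (Q f)) x" by (rule averages_cong) (use comp in auto)
  finally show ?case .
qed

end

section \<open>Existence, uniqueness and positivity of the invariant mean\<close>

context compact_topological_group
begin

lemma averages_continuous:
  "P \<in> averages \<Longrightarrow> continuous_map T euclideanreal f \<Longrightarrow> continuous_map T euclideanreal (P f)"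
proof (induction arbitrary: f rule: averages.induct)
  case (base S)
  have "continuous_map T euclideanreal (\<lambda>x. f (g \<otimes> x))" if "g \<in> S" for g
    using continuous_map_compose[OF continuous_map_left base(4)] base(3) that by (auto simp: o_def)
  moreover have "card S \<noteq> 0" using base by simp
  ultimately show ?case using base(1) by (intro continuous_intros) auto
next
  case (comp P Q)
  show ?case by (rule comp.IH(1)[OF comp.IH(2)[OF comp.prems]])
qed

text \<open>Left averaging commutes with right translations, so all averages of \<open>f\<close>
  share one modulus of continuity; this keeps the contraction factor in
  \<open>averages_contract\<close> constant.\<close>

lemma averages_modulus:
  "P \<in> averages \<Longrightarrow> u \<in> carrier G \<Longrightarrow> (\<And>x. x \<in> carrier G \<Longrightarrow> \<bar>f (x \<otimes> u) - f x\<bar> \<le> \<epsilon>) \<Longrightarrow> x \<in> carrier G \<Longrightarrow>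
    \<bar>P f (x \<otimes> u) - P f x\<bar> \<le> \<epsilon>"
  using averages_dist[of P "\<lambda>x. f (x \<otimes> u)" f \<epsilon> x] averages_right_translate[of P u x f] by simp

lemma right_uniform_continuity:
  assumes f: "continuous_map T euclideanreal f" and "\<epsilon> > 0"
  obtains U where "openin T U" "\<one> \<in> U" "\<And>x u. x \<in> carrier G \<Longrightarrow> u \<in> U \<Longrightarrow> \<bar>f (x \<otimes> u) - f x\<bar> < \<epsilon>"
proof -
  have "continuous_map (prod_topology T T) euclideanreal (\<lambda>(x, y). f (x \<otimes> y))"
    using continuous_map_compose[OF continuous_mult f] by (simp add: o_def case_prod_beta')
  from continuous_map_uniform_near[OF this compact _ assms(2), of \<one>]
  show thesis using that by (auto simp: topspace_eq_carrier)
qed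

lemma continuous_map_bounded:
  assumes f: "continuous_map T euclideanreal f"
  obtains B where "B \<ge> 0" "\<And>x. x \<in> carrier G \<Longrightarrow> \<bar>f x\<bar> \<le> B"
proof -
  have "compact (f ` carrier G)"
    using image_compactin[OF compact[unfolded compact_space_def] f] by (simp add: topspace_eq_carrier)
  then have "bounded (f ` carrier G)" by (rule compact_imp_bounded)
  then obtain B where B: "\<And>x. x \<in> carrier G \<Longrightarrow> \<bar>f x\<bar> \<le> B" by (auto simp: bounded_iff)
  have "B \<ge> 0" by (rule order_trans[OF abs_ge_zero B[OF one_closed]])
  then show thesis using that B by blast
qed

lemma continuous_map_attains_inf:
  assumes f: "continuous_map T euclideanreal f"
  obtains x0 where "x0 \<in> carrier G" "\<And>x. x \<in> carrier G \<Longrightarrow> f x0 \<le> f x"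
proof -
  have "compact (f ` carrier G)"
    using image_compactin[OF compact[unfolded compact_space_def] f] by (simp add: topspace_eq_carrier)
  then obtain s where "s \<in> f ` carrier G" "\<forall>t\<in>f ` carrier G. s \<le> t"
    using compact_attains_inf[of "f ` carrier G"] by blast
  then show thesis using that by blast
qed

lemma finite_translates_cover:
  assumes U: "openin T U" "\<one> \<in> U"
  obtains Y where "finite Y" "Y \<noteq> {}" "Y \<subseteq> carrier G" "\<And>x. x \<in> carrier G \<Longrightarrow> \<exists>y\<in>Y. \<exists>u\<in>U. x = y \<otimes> u"
proof -
  have "compactin T (carrier G)"
    using compact by (simp add: compact_space_def topspace_eq_carrier)
  moreover have "carrier G \<subseteq> \<Union>((\<lambda>g. (\<lambda>w. g \<otimes> w) ` U) ` carrier G)"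
    using U(2) by (force intro: image_eqI[of _ _ \<one>])
  ultimately have "\<exists>\<F>. finite \<F> \<and> \<F> \<subseteq> (\<lambda>g. (\<lambda>w. g \<otimes> w) ` U) ` carrier G \<and> carrier G \<subseteq> \<Union>\<F>"
    using U(1) openin_left_translate by (intro compactinD) auto
  then obtain Y where Y: "Y \<subseteq> carrier G" "finite Y" "carrier G \<subseteq> \<Union>((\<lambda>g. (\<lambda>w. g \<otimes> w) ` U) ` Y)"
    by (metis finite_subset_image)
  moreover have "Y \<noteq> {}" using Y(3) one_closed by auto
  ultimately show thesis by (intro that[of Y]) auto
qed

text \<open>The oscillation is contracted repeatedly. If finitely many translates of a neighbourhood
  of \<open>\<one>\<close> cover the group, averaging over \<open>m\<close> suitable translations
  makes every point sample at least one value near the minimum, which lowers the maximum by a fixed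
  proportion.\<close>

lemma averages_contract:
  assumes f: "continuous_map T euclideanreal f" and \<epsilon>: "\<epsilon> > 0"
  shows "\<exists>P\<in>averages. \<forall>x\<in>carrier G. \<forall>y\<in>carrier G. P f x - P f y \<le> \<epsilon>"
proof -
  define \<epsilon>' where "\<epsilon>' = \<epsilon> / 2"
  have \<epsilon>': "\<epsilon>' > 0" using \<epsilon> by (simp add: \<epsilon>'_def)
  obtain U where U: "openin T U" "\<one> \<in> U" "\<And>x u. x \<in> carrier G \<Longrightarrow> u \<in> U \<Longrightarrow> \<bar>f (x \<otimes> u) - f x\<bar> < \<epsilon>'"
    using right_uniform_continuity[OF f \<epsilon>'] by blast
  have Uc: "U \<subseteq> carrier G" using U(1) openin_carrier by blast
  obtain Y where Y: "finite Y" "Y \<noteq> {}" "Y \<subseteq> carrier G" "\<And>x. x \<in> carrier G \<Longrightarrow> \<exists>y\<in>Y. \<exists>u\<in>U. x = y \<otimes> u"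
    using finite_translates_cover[OF U(1,2)] by metis
  define m where "m = card Y"
  have m: "m > 0" using Y by (simp add: m_def card_gt_0_iff)
  obtain B where B: "B \<ge> 0" "\<And>x. x \<in> carrier G \<Longrightarrow> \<bar>f x\<bar> \<le> B"
    using continuous_map_bounded[OF f] by blast
  \<comment> \<open>One of \<open>m\<close> samples is within \<open>\<epsilon>'\<close> of the
    minimum and the others exceed it by at most \<open>D\<close>, so the new oscillation is at most
    \<open>(\<epsilon>' + (m - 1) * D) / m\<close>. Its fixed point is \<open>\<epsilon>'\<close>,
    and the excess over it shrinks by \<open>\<rho>\<close>.\<close>
  define \<rho> where "\<rho> = 1 - 1 / real m"
  have \<rho>: "0 \<le> \<rho>" "\<rho> < 1" using m by (auto simp: \<rho>_def)
  have "\<exists>P\<in>averages. \<forall>x\<in>carrier G. \<forall>y\<in>carrier G. P f x - P f y \<le> \<epsilon>' + \<rho> ^ k * (2 * B)" for k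
  proof (induction k)
    case 0
    have A: "(\<lambda>f x. (\<Sum>g\<in>{\<one>}. f (g \<otimes> x)) / card {\<one>}) \<in> averages"
      by (rule averages.base) auto
    have "f x - f y \<le> \<epsilon>' + 2 * B" if "x \<in> carrier G" "y \<in> carrier G" for x y
      using B(2)[OF that(1)] B(2)[OF that(2)] \<epsilon>' by linarith
    then show ?case by (intro bexI[OF _ A]) simp
  next
    case (Suc k)
    then obtain P where P: "P \<in> averages" "\<And>x y. x \<in> carrier G \<Longrightarrow> y \<in> carrier G \<Longrightarrow> P f x - P f y \<le> \<epsilon>' + \<rho> ^ k * (2 * B)"
      by blast
    define h where "h = P f"
    define D where "D = \<epsilon>' + \<rho> ^ k * (2 * B)"
    have h: "continuous_map T euclideanreal h" unfolding h_def using P(1) f by (rule averages_continuous)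
    have mod: "\<bar>h (x \<otimes> u) - h x\<bar> \<le> \<epsilon>'" if "x \<in> carrier G" "u \<in> U" for x u
      unfolding h_def by (rule averages_modulus[OF P(1)]) (use U(3) that Uc in \<open>auto intro: less_imp_le\<close>)
    obtain x0 where x0: "x0 \<in> carrier G" "\<And>x. x \<in> carrier G \<Longrightarrow> h x0 \<le> h x"
      using continuous_map_attains_inf[OF h] by blast
    \<comment> \<open>If \<open>x = y \<otimes> u\<close> with \<open>u\<close> in \<open>U\<close>,
      then translation by \<open>x0 \<otimes> inv y\<close> moves \<open>x\<close> to
      \<open>x0 \<otimes> u\<close>, next to the minimum point.\<close>
    define S where "S = (\<lambda>y. x0 \<otimes> inv y) ` Y"
    have inj: "inj_on (\<lambda>y. x0 \<otimes> inv y) Y"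
    proof (rule inj_onI)
      fix y z assume "y \<in> Y" "z \<in> Y" "x0 \<otimes> inv y = x0 \<otimes> inv z"
      then show "y = z" using Y(3) x0(1) by (metis Units_eq Units_l_cancel inv_closed inv_inv subsetD)
    qed
    have S: "finite S" "S \<noteq> {}" "S \<subseteq> carrier G" "card S = m"
      using Y x0(1) inj by (auto simp: S_def m_def card_image)
    define A where "A = (\<lambda>f x. (\<Sum>g\<in>S. f (g \<otimes> x)) / real (card S))"
    have A: "A \<in> averages" unfolding A_def using S by (intro averages.base)
    have upper: "A h x \<le> h x0 + (\<epsilon>' + \<rho> ^ Suc k * (2 * B))" if x: "x \<in> carrier G" for x
    proof -
      obtain y u where yu: "y \<in> Y" "u \<in> U" "x = y \<otimes> u" using Y(4)[OF x] by blast
      define g where "g = x0 \<otimes> inv y"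
      have carr: "y \<in> carrier G" "u \<in> carrier G" using yu Y(3) Uc by auto
      have "g \<otimes> x = x0 \<otimes> u"
        unfolding g_def yu(3) using carr x0(1) by (simp add: m_assoc) (simp add: m_assoc[symmetric])
      then have g: "g \<in> S" "h (g \<otimes> x) \<le> h x0 + \<epsilon>'"
        using mod[OF x0(1) yu(2)] yu by (auto simp: S_def g_def abs_le_iff)
      have "(\<Sum>g\<in>S. h (g \<otimes> x)) = h (g \<otimes> x) + (\<Sum>g\<in>S - {g}. h (g \<otimes> x))"
        using S(1) g(1) by (rule sum.remove)
      also have "(\<Sum>g\<in>S - {g}. h (g \<otimes> x)) \<le> of_nat (card (S - {g})) * (h x0 + D)"
      proof (rule sum_bounded_above)
        fix i assume "i \<in> S - {g}"
        then have "i \<otimes> x \<in> carrier G" using S(3) x by auto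
        from P(2)[OF this x0(1)] show "h (i \<otimes> x) \<le> h x0 + D" by (simp add: h_def D_def)
      qed
      also have "of_nat (card (S - {g})) = real m - 1"
        using S g m by (simp add: card_Diff_singleton of_nat_diff)
      finally have "(\<Sum>g\<in>S. h (g \<otimes> x)) \<le> real m * h x0 + \<epsilon>' + (real m - 1) * D"
        using g(2) by (simp add: algebra_simps)
      then have "A h x \<le> (real m * h x0 + \<epsilon>' + (real m - 1) * D) / real m"
        unfolding A_def S(4) using m by (intro divide_right_mono) auto
      also have "\<dots> = h x0 + (\<epsilon>' + \<rho> ^ Suc k * (2 * B))"
        using m by (simp add: D_def \<rho>_def field_simps)
      finally show ?thesis .
    qed
    have "- A h x \<le> - h x0" if x: "x \<in> carrier G" for x
      using averages_mono[OF A, of "\<lambda>_. h x0" h x] x0(2) x averages_const[OF A] by simp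
    then have "A h x - A h y \<le> \<epsilon>' + \<rho> ^ Suc k * (2 * B)" if "x \<in> carrier G" "y \<in> carrier G" for x y
      using upper[OF that(1)] that by force
    then show ?case unfolding h_def by (intro bexI[OF _ averages.comp[OF A P(1)]] ballI)
  qed
  moreover have "\<exists>k. \<rho> ^ k * (2 * B) \<le> \<epsilon>'"
  proof -
    have "(\<lambda>k. \<rho> ^ k * (2 * B)) \<longlonglongrightarrow> 0 * (2 * B)"
      using \<rho> by (intro tendsto_mult LIMSEQ_realpow_zero tendsto_const)
    then have "eventually (\<lambda>k. \<rho> ^ k * (2 * B) < \<epsilon>') sequentially"
      using \<epsilon>' by (intro order_tendstoD(2)) auto
    then show ?thesis using eventually_happens'[OF sequentially_bot] less_imp_le by blast
  qed
  ultimately obtain k P where "P \<in> averages" and k: "\<rho> ^ k * (2 * B) \<le> \<epsilon>'"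
    and PP: "\<And>x y. x \<in> carrier G \<Longrightarrow> y \<in> carrier G \<Longrightarrow> P f x - P f y \<le> \<epsilon>' + \<rho> ^ k * (2 * B)" by blast
  have "P f x - P f y \<le> \<epsilon>" if "x \<in> carrier G" "y \<in> carrier G" for x y
    using PP[OF that] k by (simp add: \<epsilon>'_def)
  with \<open>P \<in> averages\<close> show ?thesis by blast
qed

lemma right_averages_contract:
  assumes f: "continuous_map T euclideanreal f" and \<epsilon>: "\<epsilon> > 0"
  obtains Q v where "Q \<in> right_averages" "\<And>x. x \<in> carrier G \<Longrightarrow> \<bar>Q f x - v\<bar> \<le> \<epsilon>"
proof -
  have "continuous_map T euclideanreal (\<lambda>x. f (inv x))"
    using continuous_map_compose[OF continuous_inv f] by (simp add: o_def)
  then obtain P where P: "P \<in> averages" "\<And>x y. x \<in> carrier G \<Longrightarrow> y \<in> carrier G \<Longrightarrow> P (\<lambda>x. f (inv x)) x - P (\<lambda>x. f (inv x)) y \<le> \<epsilon>"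
    using averages_contract[OF _ \<epsilon>] by metis
  obtain Q where Q: "Q \<in> right_averages" "\<And>x. x \<in> carrier G \<Longrightarrow> Q f x = P (\<lambda>y. f (inv y)) (inv x)"
    using right_averages_via_inv[OF P(1)] by metis
  have "\<bar>Q f x - Q f \<one>\<bar> \<le> \<epsilon>" if "x \<in> carrier G" for x
    using P(2)[of "inv x" \<one>] P(2)[of \<one> "inv x"] that by (simp add: Q(2) abs_le_iff)
  then show thesis using that Q(1) by blast
qed

definition is_mean :: "('a \<Rightarrow> real) \<Rightarrow> real \<Rightarrow> bool" where
  "is_mean f c \<longleftrightarrow> (\<forall>\<epsilon>>0. \<exists>P\<in>averages. \<forall>x\<in>carrier G. \<bar>P f x - c\<bar> \<le> \<epsilon>)"

definition mean :: "('a \<Rightarrow> real) \<Rightarrow> real" where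
  "mean f = (THE c. is_mean f c)"

text \<open>\<open>P\<close> and \<open>Q\<close> commute, and averaging keeps a function near a
  constant; the common value \<open>Q (P f) \<one>\<close> is therefore near both constants.\<close>

lemma average_near_right_average:
  assumes "P \<in> averages" "Q \<in> right_averages"
    and "\<And>x. x \<in> carrier G \<Longrightarrow> \<bar>P f x - c\<bar> \<le> \<epsilon>" "\<And>x. x \<in> carrier G \<Longrightarrow> \<bar>Q f x - v\<bar> \<le> \<delta>"
  shows "\<bar>c - v\<bar> \<le> \<epsilon> + \<delta>"
proof -
  have "\<bar>Q (P f) \<one> - c\<bar> \<le> \<epsilon>" by (rule right_averages_dist_const[OF assms(2,3) one_closed])
  moreover have "\<bar>P (Q f) \<one> - v\<bar> \<le> \<delta>" by (rule averages_dist_const[OF assms(1,4) one_closed])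
  ultimately show ?thesis using averages_commute[OF assms(1,2) one_closed, of f] by linarith
qed

text \<open>All nearly constant left averages have values near that of one nearly constant right
  average, which makes the sequence of values Cauchy. The same comparison gives uniqueness.\<close>

lemma is_mean_exists:
  assumes f: "continuous_map T euclideanreal f"
  shows "\<exists>c. is_mean f c"
proof -
  have "\<exists>P\<in>averages. \<forall>x\<in>carrier G. \<forall>y\<in>carrier G. P f x - P f y \<le> 1 / real (Suc n)" for n
    by (rule averages_contract[OF f]) simp
  then obtain P where P: "\<And>n. P n \<in> averages"
    "\<And>n x y. x \<in> carrier G \<Longrightarrow> y \<in> carrier G \<Longrightarrow> P n f x - P n f y \<le> 1 / real (Suc n)" by metis
  define p where "p n = P n f \<one>" for n
  have Pp: "\<bar>P n f x - p n\<bar> \<le> 1 / real (Suc n)" if "x \<in> carrier G" for n x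
    using P(2)[OF that one_closed, of n] P(2)[OF one_closed that, of n] unfolding p_def by linarith
  have "Cauchy p"
  proof (rule metric_CauchyI)
    fix e :: real assume e: "e > 0"
    obtain Q v where Q: "Q \<in> right_averages" "\<And>x. x \<in> carrier G \<Longrightarrow> \<bar>Q f x - v\<bar> \<le> e / 8"
      using right_averages_contract[OF f, of "e / 8"] e by auto
    obtain N where N: "1 / real (Suc N) < e / 8" using nat_approx_posE[of "e / 8"] e by auto
    have "\<bar>p n - v\<bar> \<le> e / 4" if "n \<ge> N" for n
    proof -
      have "1 / real (Suc n) \<le> 1 / real (Suc N)" using that by (intro divide_left_mono) auto
      moreover have "\<bar>p n - v\<bar> \<le> 1 / real (Suc n) + e / 8"
        by (rule average_near_right_average[OF P(1) Q(1) Pp Q(2)])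
      ultimately show ?thesis using N by linarith
    qed
    note near = this
    have "dist (p m) (p n) < e" if "m \<ge> N" "n \<ge> N" for m n
      using near[OF that(1)] near[OF that(2)] e unfolding dist_real_def by linarith
    then show "\<exists>M. \<forall>m\<ge>M. \<forall>n\<ge>M. dist (p m) (p n) < e" by blast
  qed
  then obtain c where c: "p \<longlonglongrightarrow> c" by (auto simp: Cauchy_convergent_iff convergent_def)
  have "is_mean f c"
    unfolding is_mean_def
  proof (intro allI impI)
    fix \<epsilon> :: real assume \<epsilon>: "\<epsilon> > 0"
    have "eventually (\<lambda>n. \<bar>p n - c\<bar> < \<epsilon> / 2) sequentially"
      using tendstoD[OF c, of "\<epsilon> / 2"] \<epsilon> by (simp add: dist_real_def)
    moreover have "eventually (\<lambda>n. 1 / real (Suc n) < \<epsilon> / 2) sequentially"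
    proof (rule order_tendstoD(2))
      show "(\<lambda>n. 1 / real (Suc n)) \<longlonglongrightarrow> 0"
        using LIMSEQ_inverse_real_of_nat by (simp add: inverse_eq_divide)
    qed (use \<epsilon> in simp)
    ultimately have "eventually (\<lambda>n. \<bar>p n - c\<bar> < \<epsilon> / 2 \<and> 1 / real (Suc n) < \<epsilon> / 2) sequentially"
      by (rule eventually_conj)
    then obtain n where n: "\<bar>p n - c\<bar> < \<epsilon> / 2" "1 / real (Suc n) < \<epsilon> / 2"
      using eventually_happens'[OF sequentially_bot] by blast
    have "\<bar>P n f x - c\<bar> \<le> \<epsilon>" if "x \<in> carrier G" for x
      using Pp[OF that, of n] n by linarith
    then show "\<exists>P\<in>averages. \<forall>x\<in>carrier G. \<bar>P f x - c\<bar> \<le> \<epsilon>" using P(1) by blast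
  qed
  then show ?thesis by blast
qed

lemma is_mean_unique:
  assumes f: "continuous_map T euclideanreal f" and "is_mean f c" "is_mean f d"
  shows "c = d"
proof (rule ccontr)
  assume "c \<noteq> d"
  define \<epsilon> where "\<epsilon> = \<bar>c - d\<bar> / 8"
  have \<epsilon>: "\<epsilon> > 0" using \<open>c \<noteq> d\<close> by (simp add: \<epsilon>_def)
  obtain P where P: "P \<in> averages" "\<And>x. x \<in> carrier G \<Longrightarrow> \<bar>P f x - c\<bar> \<le> \<epsilon>" using assms(2) \<epsilon> unfolding is_mean_def by blast
  obtain P' where P': "P' \<in> averages" "\<And>x. x \<in> carrier G \<Longrightarrow> \<bar>P' f x - d\<bar> \<le> \<epsilon>" using assms(3) \<epsilon> unfolding is_mean_def by blast
  obtain Q v where Q: "Q \<in> right_averages" "\<And>x. x \<in> carrier G \<Longrightarrow> \<bar>Q f x - v\<bar> \<le> \<epsilon>"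
    using right_averages_contract[OF f \<epsilon>] by blast
  have "\<bar>c - v\<bar> \<le> \<epsilon> + \<epsilon>" by (rule average_near_right_average[OF P(1) Q(1) P(2) Q(2)])
  moreover have "\<bar>d - v\<bar> \<le> \<epsilon> + \<epsilon>" by (rule average_near_right_average[OF P'(1) Q(1) P'(2) Q(2)])
  moreover have "\<bar>c - d\<bar> \<le> \<bar>c - v\<bar> + \<bar>d - v\<bar>" by linarith
  ultimately show False using \<epsilon> unfolding \<epsilon>_def by linarith
qed

lemma is_mean_mean: "continuous_map T euclideanreal f \<Longrightarrow> is_mean f (mean f)"
  unfolding mean_def using is_mean_exists is_mean_unique by (metis theI)

lemma mean_eqI: "continuous_map T euclideanreal f \<Longrightarrow> is_mean f c \<Longrightarrow> mean f = c"
  using is_mean_mean is_mean_unique by blast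

lemma meanE:
  assumes "continuous_map T euclideanreal f" "\<epsilon> > 0"
  obtains P where "P \<in> averages" "\<And>x. x \<in> carrier G \<Longrightarrow> \<bar>P f x - mean f\<bar> \<le> \<epsilon>"
  using is_mean_mean[OF assms(1)] assms(2) unfolding is_mean_def by blast

lemma mean_averages:
  assumes f: "continuous_map T euclideanreal f" and P: "P \<in> averages"
  shows "mean (P f) = mean f"
proof -
  have "is_mean f (mean (P f))"
    unfolding is_mean_def
  proof (intro allI impI)
    fix \<epsilon> :: real assume "\<epsilon> > 0"
    then obtain P1 where "P1 \<in> averages" "\<And>x. x \<in> carrier G \<Longrightarrow> \<bar>P1 (P f) x - mean (P f)\<bar> \<le> \<epsilon>"
      using meanE[OF averages_continuous[OF P f]] by blast
    then show "\<exists>P'\<in>averages. \<forall>x\<in>carrier G. \<bar>P' f x - mean (P f)\<bar> \<le> \<epsilon>"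
      by (intro bexI[OF _ averages.comp[OF \<open>P1 \<in> averages\<close> P]] ballI)
  qed
  then show ?thesis using mean_eqI[OF f] by simp
qed

lemma mean_left_translate:
  assumes f: "continuous_map T euclideanreal f" and g: "g \<in> carrier G"
  shows "mean (\<lambda>x. f (g \<otimes> x)) = mean f"
proof -
  have "(\<lambda>f x. (\<Sum>g\<in>{g}. f (g \<otimes> x)) / card {g}) \<in> averages" using g by (intro averages.base) auto
  from mean_averages[OF f this] show ?thesis by simp
qed

lemma mean_const: "mean (\<lambda>x. c) = c"
proof (rule mean_eqI)
  have "(\<lambda>f x. (\<Sum>g\<in>{\<one>}. f (g \<otimes> x)) / card {\<one>}) \<in> averages" by (intro averages.base) auto
  from averages_const[OF this, of c] this show "is_mean (\<lambda>x. c) c"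
    unfolding is_mean_def by (intro allI impI bexI[where x="\<lambda>f x. (\<Sum>g\<in>{\<one>}. f (g \<otimes> x)) / card {\<one>}"]) simp_all
qed simp

text \<open>After \<open>P\<close> has made \<open>f\<close> nearly constant, a further average
  \<open>P1\<close> can flatten \<open>P g\<close> without spoiling \<open>P f\<close>.\<close>

lemma mean_add:
  assumes f: "continuous_map T euclideanreal f" and g: "continuous_map T euclideanreal g"
  shows "mean (\<lambda>x. f x + g x) = mean f + mean g"
proof (rule mean_eqI)
  show "continuous_map T euclideanreal (\<lambda>x. f x + g x)" using f g by (intro continuous_intros)
  show "is_mean (\<lambda>x. f x + g x) (mean f + mean g)"
    unfolding is_mean_def
  proof (intro allI impI)
    fix \<epsilon> :: real assume \<epsilon>: "\<epsilon> > 0"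
    obtain P where P: "P \<in> averages" "\<And>x. x \<in> carrier G \<Longrightarrow> \<bar>P f x - mean f\<bar> \<le> \<epsilon> / 2"
      using meanE[OF f, of "\<epsilon> / 2"] \<epsilon> by auto
    obtain P1 where P1: "P1 \<in> averages" "\<And>x. x \<in> carrier G \<Longrightarrow> \<bar>P1 (P g) x - mean g\<bar> \<le> \<epsilon> / 2"
      using meanE[OF averages_continuous[OF P(1) g], of "\<epsilon> / 2"] \<epsilon> mean_averages[OF g P(1)] by auto
    have "\<bar>P1 (P f) x - mean f\<bar> \<le> \<epsilon> / 2" if "x \<in> carrier G" for x
      using averages_dist_const[OF P1(1) P(2) that] .
    note near = this
    have "\<bar>P1 (P (\<lambda>x. f x + g x)) x - (mean f + mean g)\<bar> \<le> \<epsilon>" if "x \<in> carrier G" for x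
      unfolding averages_add[OF P(1)] averages_add[OF P1(1)] using P1(2)[OF that] near[OF that] by linarith
    then show "\<exists>P\<in>averages. \<forall>x\<in>carrier G. \<bar>P (\<lambda>x. f x + g x) x - (mean f + mean g)\<bar> \<le> \<epsilon>"
      by (intro bexI[OF _ averages.comp[OF P1(1) P(1)]] ballI)
  qed
qed

lemma mean_scale:
  assumes f: "continuous_map T euclideanreal f"
  shows "mean (\<lambda>x. c * f x) = c * mean f"
proof (rule mean_eqI)
  show "continuous_map T euclideanreal (\<lambda>x. c * f x)" using f by (intro continuous_intros) auto
  show "is_mean (\<lambda>x. c * f x) (c * mean f)"
    unfolding is_mean_def
  proof (intro allI impI)
    fix \<epsilon> :: real assume \<epsilon>: "\<epsilon> > 0"
    obtain P where P: "P \<in> averages" "\<And>x. x \<in> carrier G \<Longrightarrow> \<bar>P f x - mean f\<bar> \<le> \<epsilon> / (\<bar>c\<bar> + 1)"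
      using meanE[OF f, of "\<epsilon> / (\<bar>c\<bar> + 1)"] \<epsilon> by auto
    have "\<bar>P (\<lambda>x. c * f x) x - c * mean f\<bar> \<le> \<epsilon>" if "x \<in> carrier G" for x
    proof -
      have "\<bar>c\<bar> * \<bar>P f x - mean f\<bar> \<le> \<bar>c\<bar> * (\<epsilon> / (\<bar>c\<bar> + 1))"
        using P(2)[OF that] by (intro mult_left_mono) auto
      also have "\<dots> \<le> \<epsilon>" using \<epsilon> by (simp add: divide_le_eq algebra_simps)
      finally show ?thesis
        unfolding averages_scale[OF P(1)] by (simp add: abs_mult[symmetric] right_diff_distrib)
    qed
    then show "\<exists>P\<in>averages. \<forall>x\<in>carrier G. \<bar>P (\<lambda>x. c * f x) x - c * mean f\<bar> \<le> \<epsilon>" using P(1) by blast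
  qed
qed

lemma mean_ge:
  assumes f: "continuous_map T euclideanreal f" and "\<And>x. x \<in> carrier G \<Longrightarrow> f x \<ge> b"
  shows "mean f \<ge> b"
proof (rule field_le_epsilon)
  fix e :: real assume "e > 0"
  then obtain P where P: "P \<in> averages" "\<And>x. x \<in> carrier G \<Longrightarrow> \<bar>P f x - mean f\<bar> \<le> e" using meanE[OF f] by blast
  have "P (\<lambda>x. b) \<one> \<le> P f \<one>" using averages_mono[OF P(1)] assms(2) by auto
  then show "b \<le> mean f + e" using P(2)[OF one_closed] averages_const[OF P(1)] by (simp add: abs_le_iff)
qed

lemma mean_mono:
  assumes f: "continuous_map T euclideanreal f" and g: "continuous_map T euclideanreal g"
    and "\<And>x. x \<in> carrier G \<Longrightarrow> f x \<le> g x"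
  shows "mean f \<le> mean g"
proof -
  have c: "continuous_map T euclideanreal (\<lambda>x. (- 1) * f x)" using f by (rule continuous_map_real_mult_left)
  have "continuous_map T euclideanreal (\<lambda>x. g x + (- 1) * f x)" using g c by (rule continuous_map_add)
  then have "0 \<le> mean (\<lambda>x. g x + (- 1) * f x)" by (rule mean_ge) (use assms(3) in simp)
  then show ?thesis unfolding mean_add[OF g c] mean_scale[OF f] by simp
qed

lemma mean_cong:
  assumes f: "continuous_map T euclideanreal f" and g: "continuous_map T euclideanreal g"
    and "\<And>x. x \<in> carrier G \<Longrightarrow> f x = g x"
  shows "mean f = mean g"
  using mean_mono[OF f g] mean_mono[OF g f] assms(3) by (intro antisym) simp_all

lemma mean_dist:
  assumes f: "continuous_map T euclideanreal f" and g: "continuous_map T euclideanreal g"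
    and b: "\<And>x. x \<in> carrier G \<Longrightarrow> \<bar>f x - g x\<bar> \<le> b"
  shows "\<bar>mean f - mean g\<bar> \<le> b"
proof -
  have "mean f \<le> mean (\<lambda>x. g x + b)"
    by (rule mean_mono) (use f g b in \<open>auto simp: abs_le_iff add.commute intro!: continuous_map_add, force\<close>)
  moreover have "mean g \<le> mean (\<lambda>x. f x + b)"
    by (rule mean_mono) (use f g b in \<open>auto simp: abs_le_iff add.commute intro!: continuous_map_add, force\<close>)
  ultimately show ?thesis
    using mean_add[OF f, of "\<lambda>_. b"] mean_add[OF g, of "\<lambda>_. b"] mean_const by (simp add: abs_le_iff)
qed

text \<open>The translations that move an arbitrary point close to \<open>x0\<close> give an average
  that is bounded below by a positive constant.\<close>

lemma mean_pos:
  assumes f: "continuous_map T euclideanreal f" and nonneg: "\<And>x. x \<in> carrier G \<Longrightarrow> f x \<ge> 0"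
    and x0: "x0 \<in> carrier G" "f x0 > 0"
  shows "mean f > 0"
proof -
  obtain U where U: "openin T U" "\<one> \<in> U" "\<And>x u. x \<in> carrier G \<Longrightarrow> u \<in> U \<Longrightarrow> \<bar>f (x \<otimes> u) - f x\<bar> < f x0 / 2"
    using right_uniform_continuity[OF f, of "f x0 / 2"] x0 by auto
  have Uc: "U \<subseteq> carrier G" using U(1) openin_carrier by blast
  obtain Y where Y: "finite Y" "Y \<noteq> {}" "Y \<subseteq> carrier G" "\<And>x. x \<in> carrier G \<Longrightarrow> \<exists>y\<in>Y. \<exists>u\<in>U. x = y \<otimes> u"
    using finite_translates_cover[OF U(1,2)] by metis
  define S where "S = (\<lambda>y. x0 \<otimes> inv y) ` Y"
  have S: "finite S" "S \<noteq> {}" "S \<subseteq> carrier G" using Y x0(1) by (auto simp: S_def)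
  then have card: "card S > 0" by (simp add: card_gt_0_iff)
  define A where "A = (\<lambda>f x. (\<Sum>g\<in>S. f (g \<otimes> x)) / real (card S))"
  have A: "A \<in> averages" unfolding A_def using S by (intro averages.base)
  have "A f x \<ge> f x0 / 2 / card S" if x: "x \<in> carrier G" for x
  proof -
    obtain y u where yu: "y \<in> Y" "u \<in> U" "x = y \<otimes> u" using Y(4)[OF x] by blast
    define g where "g = x0 \<otimes> inv y"
    have carr: "y \<in> carrier G" "u \<in> carrier G" using yu Y(3) Uc by auto
    have "g \<otimes> x = x0 \<otimes> u"
      unfolding g_def yu(3) using carr x0(1) by (simp add: m_assoc) (simp add: m_assoc[symmetric])
    moreover have "f (x0 \<otimes> u) \<ge> f x0 / 2"
      using U(3)[OF x0(1) yu(2)] by linarith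
    ultimately have "f (g \<otimes> x) \<ge> f x0 / 2" by simp
    moreover have "f (g \<otimes> x) \<le> (\<Sum>g\<in>S. f (g \<otimes> x))"
      using yu(1) S(1,3) x nonneg by (intro member_le_sum[of g S "\<lambda>g. f (g \<otimes> x)"]) (auto simp: S_def g_def)
    ultimately show ?thesis unfolding A_def using card by (intro divide_right_mono) auto
  qed
  then have "mean (A f) \<ge> f x0 / 2 / card S"
    by (intro mean_ge averages_continuous[OF A f])
  moreover have "f x0 / 2 / card S > 0" using x0(2) card by simp
  ultimately show ?thesis using mean_averages[OF f A] by simp
qed

lemma mean_sum:
  assumes "finite S" "\<And>s. s \<in> S \<Longrightarrow> continuous_map T euclideanreal (f s)"
  shows "mean (\<lambda>x. \<Sum>s\<in>S. f s x) = (\<Sum>s\<in>S. mean (f s))"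
  using assms
proof (induction S rule: finite_induct)
  case empty
  then show ?case using mean_const[of 0] by simp
next
  case (insert s S)
  then show ?case using mean_add[of "f s" "\<lambda>x. \<Sum>s\<in>S. f s x"] by (simp add: continuous_map_sum)
qed

section \<open>Interchange of two means for continuous kernels\<close>

definition kernel :: "('a \<Rightarrow> 'a \<Rightarrow> real) \<Rightarrow> bool" where
  "kernel k \<longleftrightarrow> continuous_map (prod_topology T T) euclideanreal (\<lambda>(x, y). k x y)"

lemma kernel_compose:
  assumes "kernel k" "continuous_map X T u" "continuous_map X T v"
  shows "continuous_map X euclideanreal (\<lambda>x. k (u x) (v x))"
  using continuous_map_compose[OF continuous_map_pairedI[OF assms(2,3)] assms(1)[unfolded kernel_def]]
  by (simp add: o_def)

lemma kernel_left: "kernel k \<Longrightarrow> y \<in> carrier G \<Longrightarrow> continuous_map T euclideanreal (\<lambda>x. k x y)"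
  by (rule kernel_compose) (auto intro: continuous_map_id' simp: topspace_eq_carrier)

lemma kernel_right: "kernel k \<Longrightarrow> x \<in> carrier G \<Longrightarrow> continuous_map T euclideanreal (\<lambda>y. k x y)"
  by (rule kernel_compose) (auto intro: continuous_map_id' simp: topspace_eq_carrier)

lemma kernel_swap:
  assumes "kernel k"
  shows "kernel (\<lambda>x y. k y x)"
  unfolding kernel_def case_prod_beta'
  by (rule kernel_compose[OF assms]) (auto intro: continuous_map_fst continuous_map_snd)

lemma kernel_near_right:
  assumes k: "kernel k" and y0: "y0 \<in> carrier G" and "\<epsilon> > 0"
  obtains V where "openin T V" "y0 \<in> V" "\<And>x y. x \<in> carrier G \<Longrightarrow> y \<in> V \<Longrightarrow> \<bar>k x y - k x y0\<bar> < \<epsilon>"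
  using continuous_map_uniform_near[OF k[unfolded kernel_def] compact _ assms(3), of y0] y0 that
  by (auto simp: topspace_eq_carrier)

lemma kernel_averages: "P \<in> averages \<Longrightarrow> kernel k \<Longrightarrow> kernel (\<lambda>x y. P (\<lambda>x. k x y) x)"
proof (induction arbitrary: k rule: averages.induct)
  case (base S)
  have "continuous_map (prod_topology T T) euclideanreal (\<lambda>z. k (g \<otimes> fst z) (snd z))" if "g \<in> S" for g
    by (rule kernel_compose[OF base.prems])
       (use that base.hyps(3) in \<open>auto intro!: continuous_map_mult continuous_map_const' continuous_map_fst continuous_map_snd\<close>)
  moreover have "card S \<noteq> 0" using base by simp
  ultimately show ?case unfolding kernel_def case_prod_beta' using base.hyps(1)
    by (intro continuous_map_real_divide continuous_map_sum) auto
next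
  case (comp P Q)
  show ?case by (rule comp.IH(1)[OF comp.IH(2)[OF comp.prems]])
qed

lemma kernel_mean_continuous:
  assumes k: "kernel k"
  shows "continuous_map T euclideanreal (\<lambda>y. mean (\<lambda>x. k x y))"
proof (rule continuous_map_realI)
  fix y0 and \<epsilon> :: real assume "y0 \<in> topspace T" and \<epsilon>: "\<epsilon> > 0"
  then have y0: "y0 \<in> carrier G" by (simp add: topspace_eq_carrier)
  obtain V where V: "openin T V" "y0 \<in> V" "\<And>x y. x \<in> carrier G \<Longrightarrow> y \<in> V \<Longrightarrow> \<bar>k x y - k x y0\<bar> < \<epsilon> / 2"
    using kernel_near_right[OF k y0, of "\<epsilon> / 2"] \<epsilon> by auto
  have "\<bar>mean (\<lambda>x. k x y) - mean (\<lambda>x. k x y0)\<bar> < \<epsilon>" if "y \<in> V" for y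
  proof -
    have "\<bar>mean (\<lambda>x. k x y) - mean (\<lambda>x. k x y0)\<bar> \<le> \<epsilon> / 2"
      using V(3)[OF _ that] openin_carrier[OF V(1)] that y0
      by (intro mean_dist kernel_left k) (auto intro: less_imp_le)
    then show ?thesis using \<epsilon> by linarith
  qed
  then show "\<exists>V. openin T V \<and> y0 \<in> V \<and> (\<forall>y\<in>V. \<bar>mean (\<lambda>x. k x y) - mean (\<lambda>x. k x y0)\<bar> < \<epsilon>)"
    using V(1,2) by blast
qed

lemma mean_averages_commute:
  "P \<in> averages \<Longrightarrow> kernel k \<Longrightarrow> x \<in> carrier G \<Longrightarrow>
    mean (\<lambda>y. P (\<lambda>x. k x y) x) = P (\<lambda>x. mean (\<lambda>y. k x y)) x"
proof (induction arbitrary: k x rule: averages.induct)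
  case (base S)
  have c: "continuous_map T euclideanreal (\<lambda>y. k (g \<otimes> x) y)" if "g \<in> S" for g
    using base that by (intro kernel_right) auto
  have "mean (\<lambda>y. (\<Sum>g\<in>S. k (g \<otimes> x) y) / card S) = mean (\<lambda>y. (1 / card S) * (\<Sum>g\<in>S. k (g \<otimes> x) y))"
    by simp
  also have "\<dots> = (1 / card S) * mean (\<lambda>y. \<Sum>g\<in>S. k (g \<otimes> x) y)"
    using base.hyps(1) c by (intro mean_scale continuous_map_sum) auto
  also have "mean (\<lambda>y. \<Sum>g\<in>S. k (g \<otimes> x) y) = (\<Sum>g\<in>S. mean (\<lambda>y. k (g \<otimes> x) y))"
    using base.hyps(1) c by (rule mean_sum)
  finally show ?case by simp
next
  case (comp P Q)
  have "mean (\<lambda>y. P (Q (\<lambda>x. k x y)) x) = P (\<lambda>x. mean (\<lambda>y. Q (\<lambda>x. k x y) x)) x"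
    by (rule comp.IH(1)[OF kernel_averages[OF comp.hyps(2) comp.prems(1)] comp.prems(2)])
  also have "\<dots> = P (Q (\<lambda>x. mean (\<lambda>y. k x y))) x"
    by (rule averages_cong[OF comp.hyps(1) comp.IH(2)[OF comp.prems(1)] comp.prems(2)])
  finally show ?case .
qed

text \<open>By compactness finitely many columns \<open>k _ y\<close> approximate all others
  uniformly. These columns are flattened one after another, since later averages preserve earlier
  estimates.\<close>

lemma uniform_average:
  assumes k: "kernel k" and \<epsilon>: "\<epsilon> > 0"
  obtains P where "P \<in> averages"
    "\<And>x y. x \<in> carrier G \<Longrightarrow> y \<in> carrier G \<Longrightarrow> \<bar>P (\<lambda>x. k x y) x - mean (\<lambda>x. k x y)\<bar> \<le> \<epsilon>"
proof -
  have "\<exists>P\<in>averages. \<forall>x\<in>carrier G. \<forall>y\<in>Y. \<bar>P (\<lambda>x. k x y) x - mean (\<lambda>x. k x y)\<bar> \<le> \<epsilon> / 3"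
    if "finite Y" "Y \<subseteq> carrier G" for Y
    using that
  proof (induction Y rule: finite_induct)
    case empty
    have "(\<lambda>f x. (\<Sum>g\<in>{\<one>}. f (g \<otimes> x)) / card {\<one>}) \<in> averages" by (intro averages.base) auto
    then show ?case by blast
  next
    case (insert y Y)
    then obtain P where P: "P \<in> averages" "\<And>x y. x \<in> carrier G \<Longrightarrow> y \<in> Y \<Longrightarrow> \<bar>P (\<lambda>x. k x y) x - mean (\<lambda>x. k x y)\<bar> \<le> \<epsilon> / 3"
      by auto
    have ky: "continuous_map T euclideanreal (\<lambda>x. k x y)" using insert k by (intro kernel_left) auto
    obtain P1 where P1: "P1 \<in> averages"
      "\<And>x. x \<in> carrier G \<Longrightarrow> \<bar>P1 (P (\<lambda>x. k x y)) x - mean (P (\<lambda>x. k x y))\<bar> \<le> \<epsilon> / 3"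
      using meanE[OF averages_continuous[OF P(1) ky], of "\<epsilon> / 3"] \<epsilon> by auto
    have "\<bar>P1 (P (\<lambda>x. k x z)) x - mean (\<lambda>x. k x z)\<bar> \<le> \<epsilon> / 3" if x: "x \<in> carrier G" and z: "z \<in> insert y Y" for x z
    proof (cases "z = y")
      case True
      then show ?thesis using P1(2)[OF x] mean_averages[OF ky P(1)] by simp
    next
      case False
      then have "z \<in> Y" using z by simp
      show ?thesis by (rule averages_dist_const[OF P1(1) P(2)[OF _ \<open>z \<in> Y\<close>] x])
    qed
    then show ?case by (intro bexI[OF _ averages.comp[OF P1(1) P(1)]] ballI)
  qed
  note fin = this
  have "\<forall>y\<in>carrier G. \<exists>V. openin T V \<and> y \<in> V \<and> (\<forall>x\<in>carrier G. \<forall>z\<in>V. \<bar>k x z - k x y\<bar> < \<epsilon> / 3)"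
    using kernel_near_right[OF k, of _ "\<epsilon> / 3"] \<epsilon> by (metis divide_pos_pos zero_less_numeral)
  then obtain V where V: "\<And>y. y \<in> carrier G \<Longrightarrow> openin T (V y)" "\<And>y. y \<in> carrier G \<Longrightarrow> y \<in> V y"
    "\<And>x y z. y \<in> carrier G \<Longrightarrow> x \<in> carrier G \<Longrightarrow> z \<in> V y \<Longrightarrow> \<bar>k x z - k x y\<bar> < \<epsilon> / 3" by metis
  have "compactin T (carrier G)"
    using compact by (simp add: compact_space_def topspace_eq_carrier)
  then have "\<exists>\<F>. finite \<F> \<and> \<F> \<subseteq> V ` carrier G \<and> carrier G \<subseteq> \<Union>\<F>"
    by (rule compactinD) (use V(1,2) in auto)
  then obtain Y where Y: "Y \<subseteq> carrier G" "finite Y" "carrier G \<subseteq> \<Union>(V ` Y)"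
    by (metis finite_subset_image)
  obtain P where P: "P \<in> averages" "\<And>x y. x \<in> carrier G \<Longrightarrow> y \<in> Y \<Longrightarrow> \<bar>P (\<lambda>x. k x y) x - mean (\<lambda>x. k x y)\<bar> \<le> \<epsilon> / 3"
    using fin[OF Y(2,1)] by blast
  show thesis
  proof (rule that[OF P(1)])
    fix x z assume x: "x \<in> carrier G" and z: "z \<in> carrier G"
    then obtain y where y: "y \<in> Y" "z \<in> V y" using Y by blast
    then have yc: "y \<in> carrier G" using Y by blast
    have near: "\<bar>k w z - k w y\<bar> \<le> \<epsilon> / 3" if "w \<in> carrier G" for w
      using V(3)[OF yc that y(2)] by simp
    have "\<bar>P (\<lambda>x. k x z) x - P (\<lambda>x. k x y) x\<bar> \<le> \<epsilon> / 3"
      by (rule averages_dist[OF P(1) near x])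
    moreover have "\<bar>mean (\<lambda>x. k x z) - mean (\<lambda>x. k x y)\<bar> \<le> \<epsilon> / 3"
      by (rule mean_dist[OF kernel_left[OF k z] kernel_left[OF k yc] near])
    ultimately show "\<bar>P (\<lambda>x. k x z) x - mean (\<lambda>x. k x z)\<bar> \<le> \<epsilon>"
      using P(2)[OF x y(1)] by linarith
  qed
qed

text \<open>One average in \<open>x\<close> flattens all columns simultaneously and commutes with
  the mean in \<open>y\<close>; hence the iterated mean on the right satisfies the characterization
  of the one on the left.\<close>

lemma mean_swap:
  assumes k: "kernel k"
  shows "mean (\<lambda>x. mean (\<lambda>y. k x y)) = mean (\<lambda>y. mean (\<lambda>x. k x y))"
proof -
  have q: "continuous_map T euclideanreal (\<lambda>x. mean (\<lambda>y. k x y))"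
    using kernel_mean_continuous[OF kernel_swap[OF k]] by simp
  have m: "continuous_map T euclideanreal (\<lambda>y. mean (\<lambda>x. k x y))"
    by (rule kernel_mean_continuous[OF k])
  have "is_mean (\<lambda>x. mean (\<lambda>y. k x y)) (mean (\<lambda>y. mean (\<lambda>x. k x y)))"
    unfolding is_mean_def
  proof (intro allI impI)
    fix \<epsilon> :: real assume "\<epsilon> > 0"
    then obtain P where P: "P \<in> averages"
      "\<And>x y. x \<in> carrier G \<Longrightarrow> y \<in> carrier G \<Longrightarrow> \<bar>P (\<lambda>x. k x y) x - mean (\<lambda>x. k x y)\<bar> \<le> \<epsilon>"
      using uniform_average[OF k] by metis
    have "\<bar>P (\<lambda>x. mean (\<lambda>y. k x y)) x - mean (\<lambda>y. mean (\<lambda>x. k x y))\<bar> \<le> \<epsilon>" if x: "x \<in> carrier G" for x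
      unfolding mean_averages_commute[OF P(1) k x, symmetric]
      by (rule mean_dist[OF kernel_right[OF kernel_averages[OF P(1) k] x] m P(2)[OF x]])
    then show "\<exists>P\<in>averages. \<forall>x\<in>carrier G. \<bar>P (\<lambda>x. mean (\<lambda>y. k x y)) x - mean (\<lambda>y. mean (\<lambda>x. k x y))\<bar> \<le> \<epsilon>"
      using P(1) by blast
  qed
  then show ?thesis by (rule mean_eqI[OF q])
qed

end

section \<open>An eigenspace of a convolution operator\<close>

context compact_topological_group
begin

abbreviation cfun :: "('a \<Rightarrow> real) \<Rightarrow> bool" where
  "cfun f \<equiv> continuous_map T euclideanreal f"

definition ip :: "('a \<Rightarrow> real) \<Rightarrow> ('a \<Rightarrow> real) \<Rightarrow> real" where
  "ip f g = mean (\<lambda>x. f x * g x)"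

definition nrm :: "('a \<Rightarrow> real) \<Rightarrow> real" where
  "nrm f = sqrt (ip f f)"

lemma cfun_mult: "cfun f \<Longrightarrow> cfun g \<Longrightarrow> cfun (\<lambda>x. f x * g x)"
  by (rule continuous_map_real_mult)

lemma cfun_add: "cfun f \<Longrightarrow> cfun g \<Longrightarrow> cfun (\<lambda>x. f x + g x)"
  by (rule continuous_map_add)

lemma cfun_diff: "cfun f \<Longrightarrow> cfun g \<Longrightarrow> cfun (\<lambda>x. f x - g x)"
  by (rule continuous_map_diff)

lemma cfun_scale: "cfun f \<Longrightarrow> cfun (\<lambda>x. c * f x)"
  by (rule continuous_map_real_mult_left)

lemma cfun_left_translate: "cfun f \<Longrightarrow> g \<in> carrier G \<Longrightarrow> cfun (\<lambda>x. f (g \<otimes> x))"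
  using continuous_map_compose[OF continuous_map_left, of g euclideanreal f] by (simp add: o_def)

lemma mean_diff:
  assumes "cfun f" "cfun g"
  shows "mean (\<lambda>x. f x - g x) = mean f - mean g"
  using mean_add[OF assms(1) cfun_scale[OF assms(2), of "- 1"]] mean_scale[OF assms(2), of "- 1"] by simp

lemma ip_commute: "ip f g = ip g f"
  by (simp add: ip_def mult.commute)

lemma ip_add_left: "cfun f \<Longrightarrow> cfun g \<Longrightarrow> cfun h \<Longrightarrow> ip (\<lambda>x. f x + g x) h = ip f h + ip g h"
  unfolding ip_def distrib_right by (intro mean_add cfun_mult)

lemma ip_scale_left: "cfun f \<Longrightarrow> cfun h \<Longrightarrow> ip (\<lambda>x. c * f x) h = c * ip f h"
  unfolding ip_def mult.assoc by (intro mean_scale cfun_mult)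

lemma ip_add_right: "cfun f \<Longrightarrow> cfun g \<Longrightarrow> cfun h \<Longrightarrow> ip h (\<lambda>x. f x + g x) = ip h f + ip h g"
  using ip_add_left by (simp add: ip_commute)

lemma ip_scale_right: "cfun f \<Longrightarrow> cfun h \<Longrightarrow> ip h (\<lambda>x. c * f x) = c * ip h f"
  using ip_scale_left by (simp add: ip_commute)

lemma ip_nonneg: "cfun f \<Longrightarrow> 0 \<le> ip f f"
  unfolding ip_def by (intro mean_ge cfun_mult) auto

lemma nrm_nonneg: "cfun f \<Longrightarrow> 0 \<le> nrm f"
  by (simp add: nrm_def ip_nonneg)

lemma nrm_sq: "cfun f \<Longrightarrow> (nrm f)\<^sup>2 = ip f f"
  by (simp add: nrm_def ip_nonneg)

lemma nrm_pos: "cfun f \<Longrightarrow> x \<in> carrier G \<Longrightarrow> f x \<noteq> 0 \<Longrightarrow> 0 < nrm f"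
  unfolding nrm_def ip_def real_sqrt_gt_0_iff
  by (rule mean_pos[OF cfun_mult]) (auto simp: zero_less_mult_iff linorder_neq_iff)

lemma nrm_scale: "cfun f \<Longrightarrow> nrm (\<lambda>x. c * f x) = \<bar>c\<bar> * nrm f"
  by (simp add: nrm_def ip_scale_left ip_scale_right cfun_scale real_sqrt_mult mult.assoc[symmetric])

lemma ip_cong:
  assumes "cfun f" "cfun f'" "cfun g" "cfun g'" "\<And>x. x \<in> carrier G \<Longrightarrow> f x = f' x" "\<And>x. x \<in> carrier G \<Longrightarrow> g x = g' x"
  shows "ip f g = ip f' g'"
  unfolding ip_def by (rule mean_cong) (use assms in \<open>auto intro: cfun_mult\<close>)

lemma nrm_cong:
  assumes "cfun f" "cfun f'" "\<And>x. x \<in> carrier G \<Longrightarrow> f x = f' x"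
  shows "nrm f = nrm f'"
  using ip_cong[OF assms(1,2,1,2,3,3)] by (simp add: nrm_def)

lemma ip_sum_square:
  assumes "cfun f" "cfun g"
  shows "ip (\<lambda>x. a * f x + b * g x) (\<lambda>x. a * f x + b * g x) = a\<^sup>2 * ip f f + 2 * a * b * ip f g + b\<^sup>2 * ip g g"
  using assms
  by (simp add: ip_add_left ip_add_right ip_scale_left ip_scale_right cfun_add cfun_scale ip_commute[of g f]
      power2_eq_square algebra_simps)

lemma cauchy_schwarz:
  assumes "cfun f" "cfun g"
  shows "\<bar>ip f g\<bar> \<le> nrm f * nrm g"
proof -
  have "(ip f g)\<^sup>2 \<le> ip f f * ip g g"
  proof (cases "ip g g = 0")
    case True
    have "ip f g = 0"
    proof (rule ccontr)
      assume ne: "ip f g \<noteq> 0"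
      \<comment> \<open>Chosen so that the square norm of \<open>f + b * g\<close>, which is affine
        in \<open>b\<close> when \<open>ip g g = 0\<close>, would equal -1.\<close>
      define b where "b = - (ip f f + 1) / (2 * ip f g)"
      have "0 \<le> ip f f + 2 * b * ip f g"
        using ip_nonneg[OF cfun_add[OF cfun_scale cfun_scale], OF assms, of 1 b] ip_sum_square[OF assms, of 1 b] True by simp
      moreover have "2 * b * ip f g = - (ip f f + 1)" using ne by (simp add: b_def)
      ultimately show False by simp
    qed
    then show ?thesis using True by simp
  next
    case False
    then have pos: "ip g g > 0" using ip_nonneg[OF assms(2)] by simp
    have "0 \<le> (ip g g)\<^sup>2 * ip f f + 2 * ip g g * (- ip f g) * ip f g + (- ip f g)\<^sup>2 * ip g g"
      using ip_nonneg[OF cfun_add[OF cfun_scale cfun_scale], OF assms, of "ip g g" "- ip f g"]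
        ip_sum_square[OF assms, of "ip g g" "- ip f g"] by simp
    also have "\<dots> = ip g g * (ip f f * ip g g - (ip f g)\<^sup>2)"
      by (simp add: power2_eq_square algebra_simps)
    finally show ?thesis using pos by (simp add: zero_le_mult_iff)
  qed
  then have "sqrt ((ip f g)\<^sup>2) \<le> sqrt (ip f f * ip g g)" by (rule real_sqrt_le_mono)
  then show ?thesis by (simp add: nrm_def real_sqrt_mult)
qed

lemma nrm_triangle:
  assumes "cfun f" "cfun g"
  shows "nrm (\<lambda>x. f x + g x) \<le> nrm f + nrm g"
proof -
  have "(nrm (\<lambda>x. f x + g x))\<^sup>2 = (nrm f)\<^sup>2 + 2 * ip f g + (nrm g)\<^sup>2"
    using ip_sum_square[OF assms, of 1 1] assms by (simp add: nrm_sq cfun_add)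
  also have "\<dots> \<le> (nrm f)\<^sup>2 + 2 * (nrm f * nrm g) + (nrm g)\<^sup>2"
    using cauchy_schwarz[OF assms] by simp
  also have "\<dots> = (nrm f + nrm g)\<^sup>2" by (simp add: power2_eq_square algebra_simps)
  finally show ?thesis
    by (rule power2_le_imp_le) (simp add: nrm_nonneg assms)
qed

lemma nrm_le:
  assumes "cfun f" "b \<ge> 0" "\<And>x. x \<in> carrier G \<Longrightarrow> \<bar>f x\<bar> \<le> b"
  shows "nrm f \<le> b"
proof -
  have "ip f f \<le> mean (\<lambda>x. b\<^sup>2)"
    unfolding ip_def using assms
    by (intro mean_mono cfun_mult) (auto simp: power2_eq_square[symmetric] abs_le_square_iff[symmetric])
  then have "sqrt (ip f f) \<le> sqrt (b\<^sup>2)" unfolding mean_const by (rule real_sqrt_le_mono)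
  then show ?thesis using assms(2) by (simp add: nrm_def)
qed

lemma abs_ip_le:
  assumes "cfun w" "cfun f" "b \<ge> 0" "\<And>x. x \<in> carrier G \<Longrightarrow> \<bar>w x\<bar> \<le> b"
  shows "\<bar>ip w f\<bar> \<le> b * nrm f"
  using cauchy_schwarz[OF assms(1,2)] mult_right_mono[OF nrm_le[OF assms(1,3,4)] nrm_nonneg[OF assms(2)]] by simp

lemma nrm_left_translate: "cfun f \<Longrightarrow> g \<in> carrier G \<Longrightarrow> nrm (\<lambda>x. f (g \<otimes> x)) = nrm f"
  unfolding nrm_def ip_def using mean_left_translate[OF cfun_mult, of f f g] by simp

end

section \<open>Convolution with a symmetric function as a compact self-adjoint operator\<close>

locale symmetric_kernel = compact_topological_group +
  fixes \<phi> :: "'a \<Rightarrow> real"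
  assumes cont: "continuous_map T euclideanreal \<phi>"
    and symmetric: "\<And>x. x \<in> carrier G \<Longrightarrow> \<phi> (inv x) = \<phi> x"
begin

text \<open>The kernel depends only on \<open>inv x \<otimes> y\<close>, so the operator commutes
  with left translations and its eigenspaces are invariant under them.\<close>

definition conv :: "('a \<Rightarrow> real) \<Rightarrow> 'a \<Rightarrow> real" where
  "conv f x = ip (\<lambda>y. \<phi> (inv x \<otimes> y)) f"

lemma kernel_conv: "kernel (\<lambda>x y. \<phi> (inv x \<otimes> y))"
proof -
  have "continuous_map (prod_topology T T) T (\<lambda>z. inv (fst z) \<otimes> snd z)"
    by (intro continuous_map_mult continuous_map_inv continuous_map_fst continuous_map_snd)
  from continuous_map_compose[OF this cont] show ?thesis
    by (simp add: kernel_def o_def case_prod_beta')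
qed

lemma cfun_row: "x \<in> carrier G \<Longrightarrow> cfun (\<lambda>y. \<phi> (inv x \<otimes> y))"
  by (rule kernel_right[OF kernel_conv])

text \<open>Only the kernel row depends on the point, so Cauchy-Schwarz makes the neighbourhood
  independent of \<open>f\<close>: the image of a norm ball is equicontinuous.\<close>

lemma row_near:
  assumes "x \<in> carrier G" "\<epsilon> > 0"
  obtains V where "openin T V" "x \<in> V"
    "\<And>f x'. x' \<in> V \<Longrightarrow> cfun f \<Longrightarrow> \<bar>conv f x' - conv f x\<bar> \<le> \<epsilon> * nrm f"
proof -
  obtain V where V: "openin T V" "x \<in> V" "\<And>y x'. y \<in> carrier G \<Longrightarrow> x' \<in> V \<Longrightarrow> \<bar>\<phi> (inv x' \<otimes> y) - \<phi> (inv x \<otimes> y)\<bar> < \<epsilon>"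
    using kernel_near_right[OF kernel_swap[OF kernel_conv] assms] by metis
  show thesis
  proof (rule that[OF V(1,2)])
    fix f x' assume x': "x' \<in> V" and f: "cfun f"
    have x'c: "x' \<in> carrier G" using x' openin_carrier[OF V(1)] by blast
    have "conv f x' - conv f x = ip (\<lambda>y. \<phi> (inv x' \<otimes> y) - \<phi> (inv x \<otimes> y)) f"
      using mean_diff[OF cfun_mult[OF cfun_row[OF x'c] f] cfun_mult[OF cfun_row[OF assms(1)] f]]
      by (simp add: conv_def ip_def left_diff_distrib)
    also have "\<bar>\<dots>\<bar> \<le> \<epsilon> * nrm f"
      using V(3)[OF _ x'] assms(2) by (intro abs_ip_le cfun_diff cfun_row x'c assms(1) f) (auto intro: less_imp_le)
    finally show "\<bar>conv f x' - conv f x\<bar> \<le> \<epsilon> * nrm f" .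
  qed
qed

lemma cfun_conv:
  assumes f: "cfun f"
  shows "cfun (conv f)"
proof (rule continuous_map_realI)
  fix x and \<epsilon> :: real assume "x \<in> topspace T" and \<epsilon>: "\<epsilon> > 0"
  then have x: "x \<in> carrier G" by (simp add: topspace_eq_carrier)
  define \<delta> where "\<delta> = \<epsilon> / (nrm f + 1)"
  have n: "nrm f \<ge> 0" by (rule nrm_nonneg[OF f])
  then have \<delta>: "\<delta> > 0" using \<epsilon> by (simp add: \<delta>_def)
  have "\<delta> * nrm f < \<epsilon>" using n \<epsilon> by (simp add: \<delta>_def field_simps)
  moreover obtain V where V: "openin T V" "x \<in> V" "\<And>f x'. x' \<in> V \<Longrightarrow> cfun f \<Longrightarrow> \<bar>conv f x' - conv f x\<bar> \<le> \<delta> * nrm f"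
    using row_near[OF x \<delta>] by metis
  ultimately have "\<bar>conv f y - conv f x\<bar> < \<epsilon>" if "y \<in> V" for y
    using V(3)[OF that f] by linarith
  then show "\<exists>V. openin T V \<and> x \<in> V \<and> (\<forall>y\<in>V. \<bar>conv f y - conv f x\<bar> < \<epsilon>)"
    using V(1,2) by blast
qed

definition bnd :: real where
  "bnd = (SOME b. b > 0 \<and> (\<forall>x\<in>carrier G. \<bar>\<phi> x\<bar> \<le> b))"

lemma bnd: "bnd > 0" "x \<in> carrier G \<Longrightarrow> \<bar>\<phi> x\<bar> \<le> bnd"
proof -
  obtain b where b: "b \<ge> 0" "\<And>x. x \<in> carrier G \<Longrightarrow> \<bar>\<phi> x\<bar> \<le> b"
    using continuous_map_bounded[OF cont] by blast
  have "\<bar>\<phi> x\<bar> \<le> b + 1" if "x \<in> carrier G" for x using b(2)[OF that] by simp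
  then have "\<exists>b. b > 0 \<and> (\<forall>x\<in>carrier G. \<bar>\<phi> x\<bar> \<le> b)"
    using b(1) by (intro exI[of _ "b + 1"]) auto
  from someI_ex[OF this] show "bnd > 0" "x \<in> carrier G \<Longrightarrow> \<bar>\<phi> x\<bar> \<le> bnd"
    by (simp_all add: bnd_def)
qed

lemma conv_bound: "cfun f \<Longrightarrow> x \<in> carrier G \<Longrightarrow> \<bar>conv f x\<bar> \<le> bnd * nrm f"
  unfolding conv_def using bnd by (intro abs_ip_le cfun_row) auto

lemma nrm_conv: "cfun f \<Longrightarrow> nrm (conv f) \<le> bnd * nrm f"
  using bnd(1) nrm_nonneg[of f] by (intro nrm_le cfun_conv conv_bound) auto

lemma conv_lin:
  "cfun f \<Longrightarrow> cfun g \<Longrightarrow> x \<in> carrier G \<Longrightarrow> conv (\<lambda>x. a * f x + b * g x) x = a * conv f x + b * conv g x"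
  unfolding conv_def by (simp add: ip_add_right ip_scale_right cfun_scale cfun_row)

lemma conv_cong:
  assumes "cfun f" "cfun g" "\<And>x. x \<in> carrier G \<Longrightarrow> f x = g x" "x \<in> carrier G"
  shows "conv f x = conv g x"
  unfolding conv_def by (rule ip_cong[OF cfun_row cfun_row assms(1,2) refl assms(3)]) (use assms in auto)

text \<open>The two means are interchanged, and symmetry of \<open>\<phi>\<close> turns
  \<open>inv x \<otimes> y\<close> into \<open>inv y \<otimes> x\<close>.\<close>

lemma conv_self_adjoint:
  assumes f: "cfun f" and h: "cfun h"
  shows "ip (conv f) h = ip f (conv h)"
proof -
  define k where "k x y = \<phi> (inv x \<otimes> y) * f y * h x" for x y
  have k: "kernel k"
  proof -
    have "continuous_map (prod_topology T T) euclideanreal (\<lambda>z. \<phi> (inv (fst z) \<otimes> snd z) * f (snd z) * h (fst z))"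
      using kernel_conv continuous_map_compose[OF continuous_map_snd f] continuous_map_compose[OF continuous_map_fst h]
      by (intro continuous_map_real_mult) (auto simp: kernel_def case_prod_beta' o_def)
    then show ?thesis by (simp add: kernel_def k_def case_prod_beta')
  qed
  have fx: "cfun (\<lambda>y. \<phi> (inv x \<otimes> y) * f y)" if "x \<in> carrier G" for x
    using that f by (intro cfun_mult cfun_row)
  have hy: "cfun (\<lambda>x. \<phi> (inv x \<otimes> y) * h x)" if "y \<in> carrier G" for y
    using that h kernel_left[OF kernel_conv] by (intro cfun_mult)
  have "ip (conv f) h = mean (\<lambda>x. mean (\<lambda>y. k x y))"
    unfolding ip_def
  proof (rule mean_cong)
    show "cfun (\<lambda>x. conv f x * h x)" using f h by (intro cfun_mult cfun_conv)
    show "cfun (\<lambda>x. mean (k x))" using kernel_mean_continuous[OF kernel_swap[OF k]] by simp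
    show "conv f x * h x = mean (k x)" if "x \<in> carrier G" for x
    proof -
      have "k x = (\<lambda>y. h x * (\<phi> (inv x \<otimes> y) * f y))" by (simp add: k_def fun_eq_iff)
      then show ?thesis using mean_scale[OF fx[OF that], of "h x"] by (simp add: conv_def ip_def mult.commute)
    qed
  qed
  also have "\<dots> = mean (\<lambda>y. mean (\<lambda>x. k x y))" by (rule mean_swap[OF k])
  also have "\<dots> = ip f (conv h)"
    unfolding ip_def
  proof (rule mean_cong)
    show "cfun (\<lambda>x. f x * conv h x)" using f h by (intro cfun_mult cfun_conv)
    show "cfun (\<lambda>y. mean (\<lambda>x. k x y))" by (rule kernel_mean_continuous[OF k])
    show "mean (\<lambda>x. k x y) = f y * conv h y" if y: "y \<in> carrier G" for y
    proof -
      have "conv h y = mean (\<lambda>x. \<phi> (inv x \<otimes> y) * h x)"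
        unfolding conv_def ip_def
      proof (rule mean_cong[OF cfun_mult[OF cfun_row[OF y] h] hy[OF y]])
        fix x assume x: "x \<in> carrier G"
        have "inv (inv x \<otimes> y) = inv y \<otimes> x" using x y by (simp add: inv_mult_group)
        then show "\<phi> (inv y \<otimes> x) * h x = \<phi> (inv x \<otimes> y) * h x"
          using symmetric[of "inv x \<otimes> y"] x y by simp
      qed
      then show ?thesis using mean_scale[OF hy[OF y], of "f y"] by (simp add: k_def mult_ac)
    qed
  qed
  finally show ?thesis .
qed

lemma conv_left_translate:
  assumes f: "cfun f" and g: "g \<in> carrier G" and x: "x \<in> carrier G"
  shows "conv (\<lambda>y. f (g \<otimes> y)) x = conv f (g \<otimes> x)"
proof -
  have gx: "g \<otimes> x \<in> carrier G" using g x by simp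
  have "conv f (g \<otimes> x) = mean (\<lambda>y. \<phi> (inv (g \<otimes> x) \<otimes> (g \<otimes> y)) * f (g \<otimes> y))"
    using mean_left_translate[OF cfun_mult[OF cfun_row[OF gx] f] g] by (simp add: conv_def ip_def)
  also have "\<dots> = conv (\<lambda>y. f (g \<otimes> y)) x"
    unfolding conv_def ip_def
  proof (rule mean_cong)
    show "cfun (\<lambda>y. \<phi> (inv (g \<otimes> x) \<otimes> (g \<otimes> y)) * f (g \<otimes> y))"
      using cfun_left_translate[OF cfun_mult[OF cfun_row[OF gx] f] g] .
    show "cfun (\<lambda>y. \<phi> (inv x \<otimes> y) * f (g \<otimes> y))"
      using x f g by (intro cfun_mult cfun_row cfun_left_translate)
    fix y assume y: "y \<in> carrier G"
    have "inv (g \<otimes> x) \<otimes> (g \<otimes> y) = inv x \<otimes> y"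
      using g x y by (simp add: inv_mult_group m_assoc) (simp add: m_assoc[symmetric])
    then show "\<phi> (inv (g \<otimes> x) \<otimes> (g \<otimes> y)) * f (g \<otimes> y) = \<phi> (inv x \<otimes> y) * f (g \<otimes> y)" by simp
  qed
  finally show ?thesis by simp
qed

text \<open>Self-adjointness tested against the constant 1. In particular the functions of mean zero
  are mapped to themselves, so the extremal problem can be posed on them.\<close>

lemma mean_conv:
  assumes f: "cfun f"
  shows "mean (conv f) = mean \<phi> * mean f"
proof -
  have "mean (conv f) = ip (conv f) (\<lambda>_. 1)" by (simp add: ip_def)
  also have "\<dots> = ip f (conv (\<lambda>_. 1))" using f by (rule conv_self_adjoint) simp
  also have "\<dots> = ip f (\<lambda>_. mean \<phi>)"
  proof (rule ip_cong)
    show "conv (\<lambda>_. 1) x = mean \<phi>" if "x \<in> carrier G" for x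
      using mean_left_translate[OF cont, of "inv x"] that by (simp add: conv_def ip_def)
  qed (use f in \<open>auto intro: cfun_conv\<close>)
  also have "\<dots> = mean \<phi> * mean f"
    using mean_scale[OF f, of "mean \<phi>"] by (simp add: ip_def mult.commute)
  finally show ?thesis .
qed

text \<open>Maximizing sequences converge to eigenvectors: if \<open>nrm (conv f)\<^sup>2\<close> approaches its supremum
  \<open>l\<close> on the unit sphere, then \<open>conv (conv f) - l * f\<close> tends to zero in norm, while a uniform limit of
  \<open>conv f\<close> exists by equicontinuity.\<close>

lemma eigenfunction_exists:
  assumes f0: "cfun f0" "mean f0 = 0" and x0: "x0 \<in> carrier G" "conv f0 x0 \<noteq> 0"
  shows "\<exists>l g. l > 0 \<and> cfun g \<and> mean g = 0 \<and> (\<forall>x\<in>carrier G. conv (conv g) x = l * g x) \<and> (\<exists>x\<in>carrier G. g x \<noteq> 0)"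
proof -
  \<comment> \<open>Mean zero excludes the constants; a nonzero eigenfunction in this space is
    therefore not constant.\<close>
  define V where "V = {f. cfun f \<and> mean f = 0 \<and> nrm f \<le> 1}"
  \<comment> \<open>Maximizing the square norm yields the top of the spectrum of \<open>conv\<close>
    applied twice, which is positive; an eigenvalue of \<open>conv\<close> itself could have either
    sign.\<close>
  define N where "N f = (nrm (conv f))\<^sup>2" for f
  define l where "l = Sup (N ` V)"
  have Vc: "cfun f" "mean f = 0" "nrm f \<le> 1" if "f \<in> V" for f using that by (auto simp: V_def)
  have Nb: "N f \<le> bnd\<^sup>2" if "f \<in> V" for f
  proof -
    have "nrm (conv f) \<le> bnd * 1"
      using nrm_conv[OF Vc(1)[OF that]] Vc(3)[OF that] bnd(1) by (meson less_imp_le mult_left_mono order_trans)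
    then show ?thesis unfolding N_def using nrm_nonneg[OF cfun_conv[OF Vc(1)[OF that]]] by (intro power_mono) auto
  qed
  then have bdd: "bdd_above (N ` V)" unfolding bdd_above_def by blast
  have Nl: "N f \<le> l" if "f \<in> V" for f unfolding l_def using that bdd by (intro cSUP_upper)
  have scale_V: "(\<lambda>x. (1 / nrm f) * f x) \<in> V" if "cfun f" "mean f = 0" "nrm f > 0" for f
    using that mean_scale[OF that(1), of "1 / nrm f"] nrm_scale[OF that(1), of "1 / nrm f"] cfun_scale[OF that(1), of "1 / nrm f"]
    by (simp add: V_def)
  have N_scale: "N (\<lambda>x. c * f x) = c\<^sup>2 * N f" if "cfun f" for f c
  proof -
    have "nrm (conv (\<lambda>x. c * f x)) = nrm (\<lambda>x. c * conv f x)"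
      using that conv_lin[OF that that, of _ c 0] by (intro nrm_cong cfun_conv cfun_scale) auto
    then show ?thesis using that by (simp add: N_def nrm_scale cfun_conv power_mult_distrib)
  qed
  have hom: "N f \<le> l * (nrm f)\<^sup>2" if "cfun f" "mean f = 0" for f
  proof (cases "nrm f > 0")
    case True
    have "(1 / nrm f)\<^sup>2 * N f \<le> l"
      using Nl[OF scale_V[OF that True]] unfolding N_scale[OF that(1)] .
    then show ?thesis using True by (simp add: power_divide divide_le_eq mult.commute)
  next
    case False
    then have "nrm f = 0" using nrm_nonneg[OF that(1)] by simp
    then have "nrm (conv f) = 0" using nrm_conv[OF that(1)] nrm_nonneg[OF cfun_conv[OF that(1)]] by simp
    then show ?thesis using \<open>nrm f = 0\<close> by (simp add: N_def)
  qed
  have l0: "l > 0"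
  proof -
    have "0 < nrm (conv f0)" by (rule nrm_pos[OF cfun_conv[OF f0(1)] x0])
    then have "0 < l * (nrm f0)\<^sup>2" using hom[OF f0] by (simp add: N_def) (smt (verit) zero_less_power)
    then show ?thesis by (simp add: zero_less_mult_iff)
  qed
  have "(\<lambda>_. 0) \<in> V" using nrm_scale[of "\<lambda>_. 0" 0] by (simp add: V_def mean_const)
  then have "V \<noteq> {}" by blast
  have "\<exists>f\<in>V. N f > l - 1 / real (Suc n)" for n
    using less_cSUP_iff[OF \<open>V \<noteq> {}\<close> bdd, of "l - 1 / real (Suc n)"] by (simp add: l_def)
  then obtain f where f: "\<And>n. f n \<in> V" "\<And>n. N (f n) > l - 1 / real (Suc n)" by metis
  note fc = Vc[OF f(1)]
  obtain \<U> :: "nat filter" where \<U>: "\<U> \<le> sequentially" "ultra \<U>"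
    using ultra_exists[of "sequentially"] by auto
  have \<U>bot: "\<U> \<noteq> bot" by (rule ultra_neq_bot[OF \<U>(2)])
  have cb: "\<bar>conv (f n) x\<bar> \<le> bnd" if "x \<in> carrier G" for n x
    using conv_bound[OF fc(1) that, of n] mult_left_mono[OF fc(3)[of n] less_imp_le[OF bnd(1)]] by simp
  \<comment> \<open>Ascoli's argument: pointwise limits along the ultrafilter, made uniform by
    equicontinuity and a finite cover.\<close>
  have "\<exists>y. x \<in> carrier G \<longrightarrow> ((\<lambda>n. conv (f n) x) \<longlongrightarrow> y) \<U>" for x
  proof (cases "x \<in> carrier G")
    case True
    then have "eventually (\<lambda>n. conv (f n) x \<in> {- bnd..bnd}) \<U>" using cb[OF True] by (simp add: abs_le_iff minus_le_iff)
    from ultra_tendsto_bounded[OF \<U>(2) this] show ?thesis by blast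
  qed auto
  then obtain g where g: "\<And>x. x \<in> carrier G \<Longrightarrow> ((\<lambda>n. conv (f n) x) \<longlongrightarrow> g x) \<U>" by metis
  have equi: "\<exists>V. openin T V \<and> x \<in> V \<and> (\<forall>x'\<in>V. (\<forall>n. \<bar>conv (f n) x' - conv (f n) x\<bar> \<le> \<epsilon>) \<and> \<bar>g x' - g x\<bar> \<le> \<epsilon>)"
    if x: "x \<in> carrier G" and \<epsilon>: "\<epsilon> > 0" for x \<epsilon>
  proof -
    obtain V where V: "openin T V" "x \<in> V" "\<And>h x'. x' \<in> V \<Longrightarrow> cfun h \<Longrightarrow> \<bar>conv h x' - conv h x\<bar> \<le> \<epsilon> * nrm h"
      using row_near[OF x \<epsilon>] by metis
    have near: "\<bar>conv (f n) x' - conv (f n) x\<bar> \<le> \<epsilon>" if "x' \<in> V" for n x'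
      using V(3)[OF that fc(1), of n] mult_left_mono[OF fc(3)[of n] less_imp_le[OF \<epsilon>]] by simp
    have "\<bar>g x' - g x\<bar> \<le> \<epsilon>" if x': "x' \<in> V" for x'
    proof (rule tendsto_upperbound)
      have "x' \<in> carrier G" using x' openin_carrier[OF V(1)] by blast
      then show "((\<lambda>n. \<bar>conv (f n) x' - conv (f n) x\<bar>) \<longlongrightarrow> \<bar>g x' - g x\<bar>) \<U>"
        by (intro tendsto_intros g x)
    qed (use near[OF x'] \<U>bot in auto)
    with V(1,2) near show ?thesis by (intro exI[of _ V]) simp
  qed
  have gc: "cfun g"
  proof (rule continuous_map_realI)
    fix x and \<epsilon> :: real assume "x \<in> topspace T" "\<epsilon> > 0"
    then obtain V where "openin T V" "x \<in> V" "\<forall>x'\<in>V. \<bar>g x' - g x\<bar> \<le> \<epsilon> / 2"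
      using equi[of x "\<epsilon> / 2"] by (auto simp: topspace_eq_carrier)
    then show "\<exists>V. openin T V \<and> x \<in> V \<and> (\<forall>y\<in>V. \<bar>g y - g x\<bar> < \<epsilon>)"
      using \<open>\<epsilon> > 0\<close> by (intro exI[of _ V]) fastforce
  qed
  have unif: "eventually (\<lambda>n. \<forall>x\<in>carrier G. \<bar>conv (f n) x - g x\<bar> \<le> \<epsilon>) \<U>" if \<epsilon>: "\<epsilon> > 0" for \<epsilon>
  proof -
    have "\<forall>x\<in>carrier G. \<exists>V. openin T V \<and> x \<in> V \<and> (\<forall>x'\<in>V. (\<forall>n. \<bar>conv (f n) x' - conv (f n) x\<bar> \<le> \<epsilon> / 3) \<and> \<bar>g x' - g x\<bar> \<le> \<epsilon> / 3)"
      by (intro ballI equi) (use \<epsilon> in auto)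
    then obtain W where W: "\<And>x. x \<in> carrier G \<Longrightarrow> openin T (W x)" "\<And>x. x \<in> carrier G \<Longrightarrow> x \<in> W x"
      "\<And>x x' n. x \<in> carrier G \<Longrightarrow> x' \<in> W x \<Longrightarrow> \<bar>conv (f n) x' - conv (f n) x\<bar> \<le> \<epsilon> / 3"
      "\<And>x x'. x \<in> carrier G \<Longrightarrow> x' \<in> W x \<Longrightarrow> \<bar>g x' - g x\<bar> \<le> \<epsilon> / 3" by metis
    have "compactin T (carrier G)"
      using compact by (simp add: compact_space_def topspace_eq_carrier)
    then have "\<exists>\<F>. finite \<F> \<and> \<F> \<subseteq> W ` carrier G \<and> carrier G \<subseteq> \<Union>\<F>"
      by (rule compactinD) (use W(1,2) in auto)
    then obtain Y where Y: "Y \<subseteq> carrier G" "finite Y" "carrier G \<subseteq> \<Union>(W ` Y)"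
      by (metis finite_subset_image)
    have "eventually (\<lambda>n. \<forall>y\<in>Y. \<bar>conv (f n) y - g y\<bar> < \<epsilon> / 3) \<U>"
    proof (intro eventually_ball_finite Y(2) ballI)
      fix y assume "y \<in> Y"
      then have "((\<lambda>n. conv (f n) y) \<longlongrightarrow> g y) \<U>" using Y(1) g by blast
      from tendstoD[OF this, of "\<epsilon> / 3"] show "eventually (\<lambda>n. \<bar>conv (f n) y - g y\<bar> < \<epsilon> / 3) \<U>"
        using \<epsilon> by (simp add: dist_real_def)
    qed
    then show ?thesis
    proof eventually_elim
      case (elim n)
      show ?case
      proof
        fix x assume "x \<in> carrier G"
        then obtain y where y: "y \<in> Y" "x \<in> W y" using Y(3) by blast
        then have yc: "y \<in> carrier G" and "\<bar>conv (f n) y - g y\<bar> < \<epsilon> / 3" using Y(1) elim by blast+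
        then show "\<bar>conv (f n) x - g x\<bar> \<le> \<epsilon>"
          using W(3)[OF yc y(2), of n] W(4)[OF yc y(2)] by linarith
      qed
    qed
  qed
  have nrm_lim: "((\<lambda>n. nrm (\<lambda>x. conv (f n) x - g x)) \<longlongrightarrow> 0) \<U>"
  proof (rule tendstoI)
    fix \<epsilon> :: real assume \<epsilon>: "\<epsilon> > 0"
    have "eventually (\<lambda>n. \<forall>x\<in>carrier G. \<bar>conv (f n) x - g x\<bar> \<le> \<epsilon> / 2) \<U>" by (rule unif) (use \<epsilon> in simp)
    then show "eventually (\<lambda>n. dist (nrm (\<lambda>x. conv (f n) x - g x)) 0 < \<epsilon>) \<U>"
    proof eventually_elim
      case (elim n)
      have c: "cfun (\<lambda>x. conv (f n) x - g x)" by (intro cfun_diff cfun_conv fc(1) gc)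
      have "nrm (\<lambda>x. conv (f n) x - g x) \<le> \<epsilon> / 2" using elim \<epsilon> by (intro nrm_le c) auto
      then show ?case using nrm_nonneg[OF c] \<epsilon> by simp
    qed
  qed
  have eventually_N: "((\<lambda>n. N (f n)) \<longlongrightarrow> l) \<U>"
  proof (rule tendsto_sandwich)
    show "eventually (\<lambda>n. l - 1 / real (Suc n) \<le> N (f n)) \<U>" using f(2) by (simp add: less_imp_le)
    show "eventually (\<lambda>n. N (f n) \<le> l) \<U>" using Nl[OF f(1)] by simp
    have "(\<lambda>n. l - 1 / real (Suc n)) \<longlonglongrightarrow> l - 0"
      using LIMSEQ_inverse_real_of_nat by (intro tendsto_diff tendsto_const) (simp add: inverse_eq_divide)
    then show "((\<lambda>n. l - 1 / real (Suc n)) \<longlongrightarrow> l) \<U>"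
      using \<U>(1) by (auto intro: tendsto_mono)
  qed simp
  define u where "u n x = conv (conv (f n)) x - l * f n x" for n x
  have uc: "cfun (u n)" for n unfolding u_def[abs_def] by (intro cfun_diff cfun_conv cfun_scale fc(1))
  \<comment> \<open>The expanded square has three terms, bounded by \<open>l * N (f n)\<close>, by
    \<open>- 2 * l * N (f n)\<close> and by the square of \<open>l\<close>; the first bound applies
    the maximality of \<open>l\<close> to \<open>conv (f n)\<close>, which again has mean
    zero.\<close>
  have usq: "(nrm (u n))\<^sup>2 \<le> 2 * l * (l - N (f n))" for n
  proof -
    have c: "cfun (conv (f n))" "cfun (conv (conv (f n)))" by (intro cfun_conv fc(1))+
    have "(nrm (u n))\<^sup>2 = ip (conv (conv (f n))) (conv (conv (f n))) - 2 * l * ip (conv (conv (f n))) (f n) + l\<^sup>2 * ip (f n) (f n)"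
      unfolding nrm_sq[OF uc] unfolding u_def[abs_def]
      using ip_sum_square[OF c(2) fc(1)[of n], of 1 "- l"] by simp
    also have "ip (conv (conv (f n))) (f n) = N (f n)"
      using conv_self_adjoint[OF c(1) fc(1)[of n]] nrm_sq[OF c(1)] by (simp add: N_def)
    also have "ip (conv (conv (f n))) (conv (conv (f n))) \<le> l * N (f n)"
      using hom[OF c(1)] mean_conv[OF fc(1)[of n]] fc(2)[of n] nrm_sq[OF c(2)] by (simp add: N_def)
    also have "l\<^sup>2 * ip (f n) (f n) \<le> l\<^sup>2 * 1"
    proof (rule mult_left_mono)
      have "(nrm (f n))\<^sup>2 \<le> 1\<^sup>2" using fc(3)[of n] nrm_nonneg[OF fc(1)[of n]] by (intro power_mono) auto
      then show "ip (f n) (f n) \<le> 1" by (simp add: nrm_sq[OF fc(1)])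
    qed simp
    finally have "(nrm (u n))\<^sup>2 \<le> l * N (f n) - 2 * l * N (f n) + l\<^sup>2" by simp
    also have "\<dots> \<le> 2 * l * (l - N (f n))"
      using Nl[OF f(1)[of n]] l0 by (simp add: power2_eq_square algebra_simps)
    finally show ?thesis .
  qed
  have u_lim: "((\<lambda>n. nrm (u n)) \<longlongrightarrow> 0) \<U>"
  proof -
    have "((\<lambda>n. (nrm (u n))\<^sup>2) \<longlongrightarrow> 0) \<U>"
    proof (rule tendsto_sandwich[of "\<lambda>_. 0"])
      have "((\<lambda>n. 2 * l * (l - N (f n))) \<longlongrightarrow> 2 * l * (l - l)) \<U>" by (intro tendsto_intros eventually_N)
      then show "((\<lambda>n. 2 * l * (l - N (f n))) \<longlongrightarrow> 0) \<U>" by simp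
    qed (use usq in auto)
    from tendsto_real_sqrt[OF this] show ?thesis using nrm_nonneg[OF uc] by simp
  qed
  have "conv (conv g) x = l * g x" if x: "x \<in> carrier G" for x
  proof -
    have A: "((\<lambda>n. conv (u n) x) \<longlongrightarrow> 0) \<U>"
    proof (rule tendsto_0_le[OF u_lim, of _ bnd])
      show "eventually (\<lambda>n. norm (conv (u n) x) \<le> norm (nrm (u n)) * bnd) \<U>"
        using conv_bound[OF uc x] nrm_nonneg[OF uc] by (simp add: mult.commute)
    qed
    \<comment> \<open>The functions \<open>f n\<close> themselves need not converge. One more
      application of \<open>conv\<close> expresses everything through \<open>conv (f n)\<close>,
      which tends to \<open>g\<close>.\<close>
    have eq: "conv (u n) x = conv (conv (conv (f n))) x - l * conv (f n) x" for n
      using conv_lin[OF cfun_conv[OF cfun_conv[OF fc(1)[of n]]] fc(1)[of n] x, of 1 "- l"] by (simp add: u_def[abs_def])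
    have B: "((\<lambda>n. conv (conv (conv (f n))) x) \<longlongrightarrow> conv (conv g) x) \<U>"
    proof (rule LIM_zero_cancel, rule tendsto_0_le[OF nrm_lim, of _ "bnd * bnd"])
      show "eventually (\<lambda>n. norm (conv (conv (conv (f n))) x - conv (conv g) x)
          \<le> norm (nrm (\<lambda>x. conv (f n) x - g x)) * (bnd * bnd)) \<U>"
      proof (rule always_eventually, rule allI)
        fix n
        define d where "d = (\<lambda>x. conv (f n) x - g x)"
        have c: "cfun (conv (f n))" by (intro cfun_conv fc(1))
        have d: "cfun d" unfolding d_def by (intro cfun_diff c gc)
        have "conv d y = conv (conv (f n)) y - conv g y" if "y \<in> carrier G" for y
          using conv_lin[OF c gc that, of 1 "- 1"] by (simp add: d_def)
        then have "conv (conv d) x = conv (\<lambda>y. 1 * conv (conv (f n)) y + (- 1) * conv g y) x"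
          by (intro conv_cong cfun_add cfun_scale cfun_conv c gc d x) simp
        also have "\<dots> = conv (conv (conv (f n))) x - conv (conv g) x"
          using conv_lin[OF cfun_conv[OF c] cfun_conv[OF gc] x, of 1 "- 1"] by simp
        finally have "\<bar>conv (conv (conv (f n))) x - conv (conv g) x\<bar> = \<bar>conv (conv d) x\<bar>" by simp
        also have "\<dots> \<le> bnd * nrm (conv d)" by (rule conv_bound[OF cfun_conv[OF d] x])
        also have "\<dots> \<le> bnd * (bnd * nrm d)" using nrm_conv[OF d] bnd(1) by (intro mult_left_mono) auto
        finally show "norm (conv (conv (conv (f n))) x - conv (conv g) x) \<le> norm (nrm (\<lambda>x. conv (f n) x - g x)) * (bnd * bnd)"
          using nrm_nonneg[OF d] by (simp add: d_def mult_ac)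
      qed
    qed
    have "((\<lambda>n. conv (u n) x) \<longlongrightarrow> conv (conv g) x - l * g x) \<U>"
      unfolding eq by (intro tendsto_intros B g x)
    then have "conv (conv g) x - l * g x = 0" using tendsto_unique[OF \<U>bot _ A] by blast
    then show ?thesis by simp
  qed
  moreover have "mean g = 0"
  proof -
    have "\<bar>mean g\<bar> \<le> \<epsilon>" if \<epsilon>: "\<epsilon> > 0" for \<epsilon>
    proof -
      obtain n where n: "\<forall>x\<in>carrier G. \<bar>conv (f n) x - g x\<bar> \<le> \<epsilon>"
        using eventually_happens'[OF \<U>bot unif[OF \<epsilon>]] by blast
      have "\<bar>mean (conv (f n)) - mean g\<bar> \<le> \<epsilon>"
        using n by (intro mean_dist cfun_conv fc(1) gc) auto
      then show ?thesis using mean_conv[OF fc(1)[of n]] fc(2)[of n] by simp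
    qed
    then show ?thesis by (metis abs_le_zero_iff field_le_epsilon add_0)
  qed
  moreover have "\<exists>x\<in>carrier G. g x \<noteq> 0"
  proof (rule ccontr)
    assume "\<not> ?thesis"
    then have "nrm (\<lambda>x. conv (f n) x - g x) = nrm (conv (f n))" for n
      by (intro nrm_cong cfun_diff cfun_conv fc(1) gc) auto
    then have "((\<lambda>n. N (f n)) \<longlongrightarrow> 0\<^sup>2) \<U>" unfolding N_def using nrm_lim by (intro tendsto_power) simp
    then show False using tendsto_unique[OF \<U>bot eventually_N] l0 by fastforce
  qed
  ultimately show ?thesis using l0 gc by blast
qed

end

section \<open>Compact torsion groups\<close>

context compact_topological_group
begin

lemma bump_function:
  assumes W: "openin T W" "\<one> \<in> W" and sym: "\<And>u. u \<in> W \<Longrightarrow> inv u \<in> W"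
  obtains \<phi> :: "'a \<Rightarrow> real" where "continuous_map T euclideanreal \<phi>" "\<And>x. x \<in> carrier G \<Longrightarrow> \<phi> (inv x) = \<phi> x"
    "\<phi> \<one> = 1" "\<And>x. x \<in> carrier G - W \<Longrightarrow> \<phi> x = 0"
proof -
  have "completely_regular_space T"
    using compact Hausdorff compact_Hausdorff_or_regular_imp_normal_space normal_imp_completely_regular_space by blast
  moreover have "closedin T (carrier G - W)" "\<one> \<in> topspace T - (carrier G - W)"
    using W closedin_diff[OF closedin_topspace W(1)] by (auto simp: topspace_eq_carrier)
  ultimately obtain \<psi> :: "'a \<Rightarrow> real" where \<psi>: "continuous_map T euclideanreal \<psi>" "\<psi> \<one> = 0" "\<psi> ` (carrier G - W) \<subseteq> {1}"
    unfolding completely_regular_space_alt by metis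
  define \<phi> where "\<phi> x = (1 - \<psi> x) * (1 - \<psi> (inv x))" for x
  have "continuous_map T euclideanreal (\<lambda>x. \<psi> (inv x))"
    using continuous_map_compose[OF continuous_inv \<psi>(1)] by (simp add: o_def)
  then have "continuous_map T euclideanreal \<phi>"
    unfolding \<phi>_def[abs_def] using \<psi>(1) by (intro continuous_map_real_mult continuous_map_diff) auto
  then show thesis
    by (rule that) (use \<psi> in \<open>auto simp: \<phi>_def\<close>)
qed

text \<open>For a bump \<open>\<phi>\<close> with small support, \<open>conv \<phi>\<close> is
  positive at \<open>\<one>\<close> and zero at \<open>x1\<close>, so the operator does not vanish
  on functions of mean zero and has a nonconstant eigenfunction. Eigenfunctions satisfy
  \<open>f = conv (conv f) / l\<close>, and translating such a function only translates the kernel,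
  which gives continuity in the norm, uniformly on the eigenspace.\<close>

lemma separating_eigenspace:
  assumes x1: "x1 \<in> carrier G" "x1 \<noteq> \<one>"
  obtains E g x where
    "\<And>f. f \<in> E \<Longrightarrow> cfun f"
    "\<And>f h a b. f \<in> E \<Longrightarrow> h \<in> E \<Longrightarrow> (\<lambda>x. a * f x + b * h x) \<in> E"
    "\<And>f a. f \<in> E \<Longrightarrow> a \<in> carrier G \<Longrightarrow> (\<lambda>x. f (a \<otimes> x)) \<in> E"
    "\<And>\<epsilon>. \<epsilon> > 0 \<Longrightarrow> \<exists>U. openin T U \<and> \<one> \<in> U \<and> (\<forall>a\<in>U. \<forall>f\<in>E. nrm (\<lambda>x. f (a \<otimes> x) - f x) \<le> \<epsilon> * nrm f)"
    "g \<in> E" "x \<in> carrier G" "g x \<noteq> g \<one>"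
proof -
  obtain V where V: "openin T V" "\<one> \<in> V" "x1 \<notin> V" using Hausdorff_separate_one[OF x1] by blast
  obtain W where W: "openin T W" "\<one> \<in> W" "W \<subseteq> V" "\<And>u. u \<in> W \<Longrightarrow> inv u \<in> W"
    "\<And>u v. u \<in> W \<Longrightarrow> v \<in> W \<Longrightarrow> u \<otimes> v \<in> V"
    using one_nhd_shrink[OF V(1,2)] by metis
  obtain \<phi> :: "'a \<Rightarrow> real" where \<phi>: "continuous_map T euclideanreal \<phi>" "\<And>x. x \<in> carrier G \<Longrightarrow> \<phi> (inv x) = \<phi> x"
    "\<phi> \<one> = 1" "\<And>x. x \<in> carrier G - W \<Longrightarrow> \<phi> x = 0"
    using bump_function[OF W(1,2,4)] by metis
  interpret symmetric_kernel G T \<phi>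
    by unfold_locales (use \<phi> in auto)
  have conv1: "conv \<phi> \<one> > 0"
  proof -
    have "conv \<phi> \<one> = ip \<phi> \<phi>"
      unfolding conv_def by (rule ip_cong[OF cfun_row]) (use \<phi>(1) in auto)
    also have "\<dots> > 0" unfolding ip_def by (rule mean_pos[OF cfun_mult[OF \<phi>(1,1)], of \<one>]) (use \<phi>(3) in auto)
    finally show ?thesis .
  qed
  have conv2: "conv \<phi> x1 = 0"
  proof -
    have "\<phi> (inv x1 \<otimes> y) * \<phi> y = 0" if y: "y \<in> carrier G" for y
    proof (rule ccontr)
      assume "\<phi> (inv x1 \<otimes> y) * \<phi> y \<noteq> 0"
      then have "y \<in> W" "inv x1 \<otimes> y \<in> W" using \<phi>(4)[of y] \<phi>(4)[of "inv x1 \<otimes> y"] y x1(1) by auto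
      then have "y \<otimes> inv (inv x1 \<otimes> y) \<in> V" using W(4,5) by blast
      moreover have "y \<otimes> inv (inv x1 \<otimes> y) = x1" using y x1(1) by (simp add: inv_mult_group m_assoc[symmetric])
      ultimately show False using V(3) by simp
    qed
    then have "conv \<phi> x1 = mean (\<lambda>y. 0)"
      unfolding conv_def ip_def by (intro mean_cong cfun_mult cfun_row x1(1) \<phi>(1)) auto
    then show ?thesis by (simp add: mean_const)
  qed
  \<comment> \<open>The projection of \<open>\<phi>\<close> to mean zero. It changes
    \<open>conv \<phi>\<close> by a constant, so \<open>conv f0\<close> still takes different values
    at \<open>\<one>\<close> and \<open>x1\<close> and is nonzero at one of them.\<close>
  define f0 where "f0 x = 1 * \<phi> x + (- mean \<phi>) * 1" for x
  have f0: "cfun f0" unfolding f0_def[abs_def] by (intro cfun_add cfun_scale \<phi>(1)) auto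
  have "mean f0 = 0"
    using mean_add[OF \<phi>(1), of "\<lambda>_. - mean \<phi>"] by (simp add: f0_def[abs_def] mean_const)
  have conv_f0: "conv f0 x = conv \<phi> x - mean \<phi> * mean \<phi>" if x: "x \<in> carrier G" for x
  proof -
    have "conv (\<lambda>_. 1) x = mean \<phi>"
      using mean_left_translate[OF \<phi>(1), of "inv x"] x by (simp add: conv_def ip_def)
    then show ?thesis
      using conv_lin[OF \<phi>(1) _ x, of "\<lambda>_. 1" 1 "- mean \<phi>"] by (simp add: f0_def[abs_def])
  qed
  have "conv f0 \<one> \<noteq> conv f0 x1"
    using conv_f0[OF one_closed] conv_f0[OF x1(1)] conv1 conv2 by simp
  then obtain x0 where x0: "x0 \<in> carrier G" "conv f0 x0 \<noteq> 0" using x1(1) by (metis one_closed)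
  obtain l g where lg: "l > 0" "cfun g" "mean g = 0" "\<And>x. x \<in> carrier G \<Longrightarrow> conv (conv g) x = l * g x"
    "\<exists>x\<in>carrier G. g x \<noteq> 0"
    using eigenfunction_exists[OF f0 \<open>mean f0 = 0\<close> x0] by blast
  define E where "E = {f. cfun f \<and> (\<forall>x\<in>carrier G. conv (conv f) x = l * f x)}"
  have Ec: "cfun f" and El: "\<And>x. x \<in> carrier G \<Longrightarrow> conv (conv f) x = l * f x" if "f \<in> E" for f
    using that by (auto simp: E_def)
  show thesis
  proof (rule that[of E g])
    show "cfun f" if "f \<in> E" for f using that by (rule Ec)
    show "(\<lambda>x. a * f x + b * h x) \<in> E" if fh: "f \<in> E" "h \<in> E" for f h a b
    proof -
      have c: "cfun (\<lambda>x. a * f x + b * h x)" by (intro cfun_add cfun_scale Ec fh)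
      have "conv (conv (\<lambda>x. a * f x + b * h x)) x = l * (a * f x + b * h x)" if x: "x \<in> carrier G" for x
      proof -
        have "conv (conv (\<lambda>x. a * f x + b * h x)) x = conv (\<lambda>x. a * conv f x + b * conv h x) x"
          by (rule conv_cong[OF cfun_conv[OF c] _ conv_lin[OF Ec[OF fh(1)] Ec[OF fh(2)]] x])
             (intro cfun_add cfun_scale cfun_conv Ec fh)
        also have "\<dots> = a * conv (conv f) x + b * conv (conv h) x"
          by (rule conv_lin[OF cfun_conv[OF Ec[OF fh(1)]] cfun_conv[OF Ec[OF fh(2)]] x])
        finally show ?thesis using El[OF fh(1) x] El[OF fh(2) x] by (simp add: algebra_simps)
      qed
      then show ?thesis using c by (simp add: E_def)
    qed
    show "(\<lambda>x. f (a \<otimes> x)) \<in> E" if f: "f \<in> E" and a: "a \<in> carrier G" for f a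
    proof -
      have c: "cfun (\<lambda>x. f (a \<otimes> x))" by (rule cfun_left_translate[OF Ec[OF f] a])
      have "conv (conv (\<lambda>x. f (a \<otimes> x))) x = l * f (a \<otimes> x)" if x: "x \<in> carrier G" for x
      proof -
        have "conv (conv (\<lambda>x. f (a \<otimes> x))) x = conv (\<lambda>x. conv f (a \<otimes> x)) x"
          by (rule conv_cong[OF cfun_conv[OF c] _ conv_left_translate[OF Ec[OF f] a] x])
             (rule cfun_left_translate[OF cfun_conv[OF Ec[OF f]] a])
        also have "\<dots> = conv (conv f) (a \<otimes> x)"
          by (rule conv_left_translate[OF cfun_conv[OF Ec[OF f]] a x])
        finally show ?thesis using El[OF f] a x by simp
      qed
      then show ?thesis using c by (simp add: E_def)
    qed
    show "\<exists>U. openin T U \<and> \<one> \<in> U \<and> (\<forall>a\<in>U. \<forall>f\<in>E. nrm (\<lambda>x. f (a \<otimes> x) - f x) \<le> \<epsilon> * nrm f)"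
      if \<epsilon>: "\<epsilon> > 0" for \<epsilon>
    proof -
      \<comment> \<open>A kernel change of at most \<open>\<delta>\<close> alters
        \<open>l * f\<close> by at most \<open>\<delta> * bnd * nrm f\<close>, which must equal
        \<open>l * \<epsilon> * nrm f\<close>.\<close>
      define \<delta> where "\<delta> = \<epsilon> * l / bnd"
      have \<delta>: "\<delta> > 0" using \<epsilon> lg(1) bnd(1) by (simp add: \<delta>_def)
      let ?P = "prod_topology T T"
      \<comment> \<open>Treating the pair of both kernel variables as a single point of a compact
        space gives a neighbourhood of \<open>\<one>\<close> that works for all \<open>x\<close> and
        \<open>y\<close>.\<close>
      define k where "k z a = \<phi> (inv (a \<otimes> fst z) \<otimes> snd z)" for z a
      have "continuous_map (prod_topology ?P T) T (\<lambda>w. inv (snd w \<otimes> fst (fst w)) \<otimes> snd (fst w))"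
      proof (intro continuous_map_mult continuous_map_inv continuous_map_snd)
        show "continuous_map (prod_topology ?P T) T (\<lambda>w. fst (fst w))"
          using continuous_map_compose[OF continuous_map_fst[of ?P T] continuous_map_fst[of T T]] by (simp add: o_def)
        show "continuous_map (prod_topology ?P T) T (\<lambda>w. snd (fst w))"
          using continuous_map_compose[OF continuous_map_fst[of ?P T] continuous_map_snd[of T T]] by (simp add: o_def)
      qed
      from continuous_map_compose[OF this \<phi>(1)]
      have k: "continuous_map (prod_topology ?P T) euclideanreal (\<lambda>(z, a). k z a)"
        by (simp add: k_def o_def case_prod_beta')
      have "compact_space ?P" using compact by (simp add: compact_space_prod_topology)
      then obtain U where U: "openin T U" "\<one> \<in> U" "\<And>z a. z \<in> topspace ?P \<Longrightarrow> a \<in> U \<Longrightarrow> \<bar>k z a - k z \<one>\<bar> < \<delta>"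
        using continuous_map_uniform_near[OF k _ _ \<delta>, of \<one>] by (auto simp: topspace_eq_carrier)
      have "nrm (\<lambda>x. f (a \<otimes> x) - f x) \<le> \<epsilon> * nrm f" if a: "a \<in> U" and f: "f \<in> E" for a f
      proof -
        have ac: "a \<in> carrier G" using a openin_carrier[OF U(1)] by blast
        have fc: "cfun f" by (rule Ec[OF f])
        have hc: "cfun (conv f)" by (rule cfun_conv[OF fc])
        have "\<bar>f (a \<otimes> x) - f x\<bar> \<le> \<epsilon> * nrm f" if x: "x \<in> carrier G" for x
        proof -
          have ax: "a \<otimes> x \<in> carrier G" using ac x by simp
          have "conv (conv f) (a \<otimes> x) - conv (conv f) x = ip (\<lambda>y. \<phi> (inv (a \<otimes> x) \<otimes> y) - \<phi> (inv x \<otimes> y)) (conv f)"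
            using mean_diff[OF cfun_mult[OF cfun_row[OF ax] hc] cfun_mult[OF cfun_row[OF x] hc]]
            by (simp add: conv_def[of "conv f"] ip_def left_diff_distrib)
          also have "\<bar>\<dots>\<bar> \<le> \<delta> * nrm (conv f)"
          proof (rule abs_ip_le[OF cfun_diff[OF cfun_row[OF ax] cfun_row[OF x]] hc])
            fix y assume y: "y \<in> carrier G"
            show "\<bar>\<phi> (inv (a \<otimes> x) \<otimes> y) - \<phi> (inv x \<otimes> y)\<bar> \<le> \<delta>"
              using U(3)[of "(x, y)" a] x y a by (simp add: k_def topspace_eq_carrier)
          qed (use \<delta> in simp)
          also have "\<dots> \<le> \<delta> * (bnd * nrm f)" using nrm_conv[OF fc] \<delta> by (intro mult_left_mono) auto
          also have "\<dots> = l * (\<epsilon> * nrm f)" using bnd(1) by (simp add: \<delta>_def)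
          finally have "\<bar>l * (f (a \<otimes> x) - f x)\<bar> \<le> l * (\<epsilon> * nrm f)"
            using El[OF f ax] El[OF f x] by (simp add: right_diff_distrib)
          then show ?thesis using lg(1) by (simp add: abs_mult)
        qed
        then show ?thesis
          using \<epsilon> nrm_nonneg[OF fc] by (intro nrm_le cfun_diff cfun_left_translate fc ac) auto
      qed
      then show ?thesis using U(1,2) by blast
    qed
    show "g \<in> E" using lg by (simp add: E_def)
    obtain x where x: "x \<in> carrier G" "g x \<noteq> 0" using lg(5) by blast
    have "\<exists>x\<in>carrier G. g x \<noteq> g \<one>"
    proof (rule ccontr)
      assume "\<not> ?thesis"
      then have const: "g y = g \<one>" if "y \<in> carrier G" for y using that by blast
      have "mean g = mean (\<lambda>_. g \<one>)" by (rule mean_cong[OF lg(2) _ const]) simp_all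
      then show False using lg(3) const[OF x(1)] x(2) by (simp add: mean_const)
    qed
    then show "(SOME x. x \<in> carrier G \<and> g x \<noteq> g \<one>) \<in> carrier G" "g (SOME x. x \<in> carrier G \<and> g x \<noteq> g \<one>) \<noteq> g \<one>"
      using someI_ex[of "\<lambda>x. x \<in> carrier G \<and> g x \<noteq> g \<one>"] by blast+
  qed
qed

end

text \<open>Pigeonhole: the unit interval meets only finitely many cells of length
  \<open>\<delta>\<close>, so two points of \<open>A\<close> share a cell.\<close>

lemma infinite_unit_interval_close:
  fixes A :: "real set"
  assumes "infinite A" "A \<subseteq> {0..1}" "\<delta> > 0"
  shows "\<exists>s\<in>A. \<exists>t\<in>A. s < t \<and> t - s < \<delta>"
proof -
  let ?h = "\<lambda>t. \<lfloor>t / \<delta>\<rfloor>"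
  have "?h ` A \<subseteq> {0..\<lfloor>1 / \<delta>\<rfloor>}"
  proof
    fix k assume "k \<in> ?h ` A"
    then obtain t where t: "t \<in> A" "k = ?h t" by blast
    then have "0 \<le> t / \<delta>" "t / \<delta> \<le> 1 / \<delta>" using assms(2,3) by (auto intro!: divide_right_mono)
    then show "k \<in> {0..\<lfloor>1 / \<delta>\<rfloor>}" unfolding t(2) by (simp add: floor_mono)
  qed
  then have "finite (?h ` A)" using finite_subset by blast
  then have "\<not> inj_on ?h A" using assms(1) finite_imageD by blast
  then obtain s t where "s \<in> A" "t \<in> A" "?h s = ?h t" "s < t"
    unfolding inj_on_def by (metis linorder_neqE_linordered_idom)
  moreover have "t / \<delta> - s / \<delta> < 1" using \<open>?h s = ?h t\<close> by linarith
  then have "t - s < \<delta>" using assms(3) by (simp add: diff_divide_distrib[symmetric] divide_less_eq)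
  ultimately show ?thesis by blast
qed

context hausdorff_topological_group
begin

lemma continuous_map_nat_pow: "continuous_map T T (\<lambda>x. x [^] (n::nat))"
proof (induction n)
  case 0
  then show ?case by (simp add: topspace_eq_carrier)
next
  case (Suc n)
  then show ?case by (simp add: continuous_map_mult continuous_map_id')
qed

lemma open_if_contains_nhd:
  assumes H: "subgroup H G" and U: "openin T U" "\<one> \<in> U" "U \<subseteq> H"
  shows "openin T H"
proof (subst openin_subopen, rule ballI)
  fix h assume h: "h \<in> H"
  then have hc: "h \<in> carrier G" using subgroup.mem_carrier[OF H] by blast
  have "(\<lambda>x. h \<otimes> x) ` U \<subseteq> H" using U(3) h subgroup.m_closed[OF H] by blast
  moreover have "h \<in> (\<lambda>x. h \<otimes> x) ` U" using U(2) hc by (intro image_eqI[of _ _ \<one>]) auto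
  ultimately show "\<exists>V. openin T V \<and> h \<in> V \<and> V \<subseteq> H"
    using openin_left_translate[OF U(1) hc] by blast
qed

end

context compact_topological_group
begin

text \<open>The displacement \<open>\<nu>\<close> of a norm-continuous isometric representation satisfies
  \<open>\<nu> (a [^] m) \<ge> m * \<nu> a / 2\<close> while \<open>m * \<nu> a \<le> 1\<close>. If its kernel is not open, normalized powers of
  elements with tiny displacement produce a curve \<open>t \<mapsto> p t\<close> along which all differences have
  positive displacement, although uncountably many \<open>p t\<close> would have to share an exponent.\<close>

lemma torsion_proper_open_subgroup:
  assumes tors: "\<And>x. x \<in> carrier G \<Longrightarrow> \<exists>n>0. x [^] (n::nat) = \<one>" and x1: "x1 \<in> carrier G" "x1 \<noteq> \<one>"
  shows "\<exists>H. subgroup H G \<and> openin T H \<and> H \<noteq> carrier G"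
proof -
  obtain E g x2 where Ec: "\<And>f. f \<in> E \<Longrightarrow> cfun f"
    and Elin: "\<And>f h a b. f \<in> E \<Longrightarrow> h \<in> E \<Longrightarrow> (\<lambda>x. a * f x + b * h x) \<in> E"
    and Etr: "\<And>f a. f \<in> E \<Longrightarrow> a \<in> carrier G \<Longrightarrow> (\<lambda>x. f (a \<otimes> x)) \<in> E"
    and Econt: "\<And>\<epsilon>. \<epsilon> > 0 \<Longrightarrow> \<exists>U. openin T U \<and> \<one> \<in> U \<and> (\<forall>a\<in>U. \<forall>f\<in>E. nrm (\<lambda>x. f (a \<otimes> x) - f x) \<le> \<epsilon> * nrm f)"
    and g: "g \<in> E" "x2 \<in> carrier G" "g x2 \<noteq> g \<one>"
  proof goal_cases
    case 1
    show ?case by (rule separating_eigenspace[OF x1]) (rule 1, assumption+)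
  qed
  define D where "D a f = (\<lambda>x. f (a \<otimes> x) - f x)" for a and f :: "'a \<Rightarrow> real"
  have DE: "D a f \<in> E" if "a \<in> carrier G" "f \<in> E" for a f
    using Elin[OF Etr[OF that(2,1)] that(2), of 1 "- 1"] by (simp add: D_def)
  have Dc: "cfun (D a f)" if "a \<in> carrier G" "f \<in> E" for a f using Ec DE that by blast
  have Dnrm: "nrm (D a f) \<le> 2 * nrm f" if a: "a \<in> carrier G" and f: "f \<in> E" for a f
  proof -
    have "nrm (D a f) \<le> nrm (\<lambda>x. f (a \<otimes> x)) + nrm (\<lambda>x. (- 1) * f x)"
      using nrm_triangle[OF Ec[OF Etr[OF f a]] cfun_scale[OF Ec[OF f]], of "- 1"] by (simp add: D_def)
    then show ?thesis using nrm_scale[OF Ec[OF f], of "- 1"] nrm_left_translate[OF Ec[OF f] a] by simp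
  qed
  define B where "B = {f \<in> E. nrm f \<le> 1}"
  \<comment> \<open>The operator norm on \<open>E\<close> of translation by \<open>a\<close> minus
    the identity.\<close>
  define \<nu> where "\<nu> a = Sup ((\<lambda>f. nrm (D a f)) ` B)" for a
  have zeroE: "(\<lambda>x. 0) \<in> E" using Elin[OF g(1) g(1), of 0 0] by simp
  have zeroB: "(\<lambda>x. 0) \<in> B" using zeroE nrm_scale[of "\<lambda>_. 0" 0] by (simp add: B_def)
  have bdd: "bdd_above ((\<lambda>f. nrm (D a f)) ` B)" if "a \<in> carrier G" for a
  proof -
    have "nrm (D a f) \<le> 2" if "f \<in> B" for f
      using Dnrm[OF \<open>a \<in> carrier G\<close>, of f] that by (simp add: B_def)
    then show ?thesis unfolding bdd_above_def by blast
  qed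
  have \<nu>_upper: "nrm (D a f) \<le> \<nu> a * nrm f" if a: "a \<in> carrier G" and f: "f \<in> E" for a f
  proof (cases "nrm f = 0")
    case True
    then show ?thesis using Dnrm[OF a f] by simp
  next
    case False
    then have pos: "nrm f > 0" using nrm_nonneg[OF Ec[OF f]] by simp
    define h where "h = (\<lambda>x. (1 / nrm f) * f x)"
    have "h \<in> E" using Elin[OF f f, of "1 / nrm f" 0] by (simp add: h_def)
    moreover have "nrm h \<le> 1" using nrm_scale[OF Ec[OF f], of "1 / nrm f"] pos by (simp add: h_def)
    ultimately have "nrm (D a h) \<le> \<nu> a" unfolding \<nu>_def by (intro cSUP_upper bdd a) (simp add: B_def)
    moreover have "D a h = (\<lambda>x. (1 / nrm f) * D a f x)" by (simp add: D_def h_def right_diff_distrib)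
    ultimately have "(1 / nrm f) * nrm (D a f) \<le> \<nu> a"
      using nrm_scale[OF Dc[OF a f], of "1 / nrm f"] pos by simp
    then show ?thesis using pos by (simp add: divide_le_eq mult.commute)
  qed
  have \<nu>_least: "\<nu> a \<le> r" if "r \<ge> 0" "\<And>f. f \<in> E \<Longrightarrow> nrm (D a f) \<le> r * nrm f" for a r
    unfolding \<nu>_def
  proof (rule cSUP_least)
    fix f assume "f \<in> B"
    then have "nrm (D a f) \<le> r * nrm f" "nrm f \<le> 1" using that(2) by (auto simp: B_def)
    then show "nrm (D a f) \<le> r" using mult_left_mono[of "nrm f" 1 r] that(1) by simp
  qed (use zeroB in blast)
  have \<nu>_nonneg: "\<nu> a \<ge> 0" if "a \<in> carrier G" for a
  proof -
    have "nrm (D a (\<lambda>x. 0)) \<le> \<nu> a" unfolding \<nu>_def by (intro cSUP_upper bdd that zeroB)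
    then show ?thesis using nrm_nonneg[OF Dc[OF that zeroE]] by linarith
  qed
  have \<nu>_mult: "\<nu> (a \<otimes> b) \<le> \<nu> a + \<nu> b" if a: "a \<in> carrier G" and b: "b \<in> carrier G" for a b
  proof (rule \<nu>_least)
    show "0 \<le> \<nu> a + \<nu> b" using \<nu>_nonneg a b by simp
    fix f assume f: "f \<in> E"
    have c: "cfun (\<lambda>x. D a f (b \<otimes> x))" by (rule cfun_left_translate[OF Dc[OF a f] b])
    have "nrm (D (a \<otimes> b) f) = nrm (\<lambda>x. D a f (b \<otimes> x) + D b f x)"
      by (rule nrm_cong[OF Dc cfun_add[OF c Dc]]) (use a b f in \<open>auto simp: D_def m_assoc\<close>)
    also have "\<dots> \<le> nrm (\<lambda>x. D a f (b \<otimes> x)) + nrm (D b f)" by (rule nrm_triangle[OF c Dc[OF b f]])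
    also have "\<dots> \<le> (\<nu> a + \<nu> b) * nrm f"
      using \<nu>_upper[OF a f] \<nu>_upper[OF b f] nrm_left_translate[OF Dc[OF a f] b] by (simp add: distrib_right)
    finally show "nrm (D (a \<otimes> b) f) \<le> (\<nu> a + \<nu> b) * nrm f" .
  qed
  have \<nu>_inv_le: "\<nu> (inv a) \<le> \<nu> a" if a: "a \<in> carrier G" for a
  proof (rule \<nu>_least)
    fix f assume f: "f \<in> E"
    have "nrm (D (inv a) f) = nrm (\<lambda>x. (- 1) * D a f (inv a \<otimes> x))"
      by (rule nrm_cong[OF Dc cfun_scale[OF cfun_left_translate[OF Dc]]])
         (use a f in \<open>auto simp: D_def m_assoc[symmetric]\<close>)
    also have "\<dots> = nrm (D a f)"
      using nrm_scale[OF cfun_left_translate[OF Dc[OF a f], of "inv a"], of "- 1"] nrm_left_translate[OF Dc[OF a f], of "inv a"] a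
      by simp
    finally show "nrm (D (inv a) f) \<le> \<nu> a * nrm f" using \<nu>_upper[OF a f] by simp
  qed (use \<nu>_nonneg a in blast)
  have \<nu>_inv: "\<nu> (inv a) = \<nu> a" if "a \<in> carrier G" for a
    using \<nu>_inv_le[OF that] \<nu>_inv_le[of "inv a"] that by simp
  have \<nu>_one: "\<nu> \<one> = 0"
  proof -
    have "nrm (D \<one> f) \<le> 0 * nrm f" if "f \<in> E" for f
    proof -
      have "nrm (D \<one> f) = nrm (\<lambda>x. 0 * f x)"
        by (rule nrm_cong[OF Dc cfun_scale]) (use that Ec in \<open>auto simp: D_def\<close>)
      then show ?thesis using nrm_scale[OF Ec[OF that], of 0] by simp
    qed
    then have "\<nu> \<one> \<le> 0" by (intro \<nu>_least) auto
    then show ?thesis using \<nu>_nonneg[of \<one>] by simp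
  qed
  have \<nu>_pow_le: "\<nu> (a [^] (m::nat)) \<le> m * \<nu> a" if a: "a \<in> carrier G" for a m
  proof (induction m)
    case 0
    then show ?case by (simp add: \<nu>_one)
  next
    case (Suc m)
    then show ?case using \<nu>_mult[of "a [^] m" a] a by (simp add: algebra_simps)
  qed
  have \<nu>_pow_ge: "\<nu> (a [^] (m::nat)) \<ge> m * \<nu> a / 2" if a: "a \<in> carrier G" and m: "m * \<nu> a \<le> 1" for a m
  proof (cases "m = 0")
    case True
    then show ?thesis by (simp add: \<nu>_one)
  next
    case False
    have "nrm (D a f) \<le> (2 / m * \<nu> (a [^] m)) * nrm f" if f: "f \<in> E" for f
    proof -
      define d where "d = D a f"
      have dE: "d \<in> E" unfolding d_def by (rule DE[OF a f])
      have dc: "cfun d" by (rule Ec[OF dE])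
      have pc: "cfun (D (a [^] i) f)" for i :: nat using Dc a f by blast
      \<comment> \<open>To first order, \<open>a [^] i\<close> displaces \<open>f\<close> by
        \<open>i\<close> times the displacement \<open>d\<close>. The error is quadratic in
        \<open>i\<close>; at \<open>i = m\<close> the hypothesis \<open>m * \<nu> a \<le> 1\<close>
        makes it at most half of the main term.\<close>
      have approx: "nrm (\<lambda>x. D (a [^] i) f x + (- real i) * d x) \<le> (real i)\<^sup>2 / 2 * \<nu> a * nrm d" for i :: nat
      proof (induction i)
        case 0
        have "nrm (\<lambda>x. D (a [^] (0::nat)) f x + (- real 0) * d x) = nrm (\<lambda>x. 0 * d x)"
          by (rule nrm_cong[OF cfun_add[OF pc cfun_scale[OF dc]] cfun_scale[OF dc]]) (auto simp: D_def)
        then show ?case using nrm_scale[OF dc, of 0] by simp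
      next
        case (Suc i)
        have ai: "a [^] i \<in> carrier G" using a by simp
        have c1: "cfun (\<lambda>x. D (a [^] i) f x + (- real i) * d x)" by (rule cfun_add[OF pc cfun_scale[OF dc]])
        have c2: "cfun (D (a [^] i) d)" by (rule Dc[OF ai dE])
        have comm: "a [^] i \<otimes> a = a \<otimes> a [^] i" using a by (metis nat_pow_Suc nat_pow_Suc2)
        have "nrm (\<lambda>x. D (a [^] Suc i) f x + (- real (Suc i)) * d x)
            = nrm (\<lambda>x. (D (a [^] i) f x + (- real i) * d x) + D (a [^] i) d x)"
        proof (rule nrm_cong[OF cfun_add[OF pc cfun_scale[OF dc]] cfun_add[OF c1 c2]])
          fix x assume x: "x \<in> carrier G"
          have "a [^] Suc i \<otimes> x = a \<otimes> (a [^] i \<otimes> x)" using a x ai comm by (simp add: m_assoc[symmetric])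
          then show "D (a [^] Suc i) f x + (- real (Suc i)) * d x = (D (a [^] i) f x + (- real i) * d x) + D (a [^] i) d x"
            by (simp add: D_def d_def algebra_simps)
        qed
        also have "\<dots> \<le> nrm (\<lambda>x. D (a [^] i) f x + (- real i) * d x) + nrm (D (a [^] i) d)"
          by (rule nrm_triangle[OF c1 c2])
        also have "nrm (D (a [^] i) d) \<le> (i * \<nu> a) * nrm d"
          using \<nu>_upper[OF ai dE] mult_right_mono[OF \<nu>_pow_le[OF a, of i] nrm_nonneg[OF dc]] by linarith
        also have "nrm (\<lambda>x. D (a [^] i) f x + (- real i) * d x) + (i * \<nu> a) * nrm d
            \<le> (real i)\<^sup>2 / 2 * \<nu> a * nrm d + (i * \<nu> a) * nrm d"
          using Suc by simp
        also have "\<dots> \<le> (real (Suc i))\<^sup>2 / 2 * \<nu> a * nrm d"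
        proof -
          have "0 \<le> \<nu> a * nrm d" using \<nu>_nonneg[OF a] nrm_nonneg[OF dc] by simp
          then have "((real i)\<^sup>2 / 2 + i) * (\<nu> a * nrm d) \<le> ((real (Suc i))\<^sup>2 / 2) * (\<nu> a * nrm d)"
            by (intro mult_right_mono) (simp_all add: power2_eq_square algebra_simps)
          then show ?thesis by (simp add: algebra_simps)
        qed
        finally show ?case by simp
      qed
      have "nrm (\<lambda>x. real m * d x) \<le> nrm (D (a [^] m) f) + nrm (\<lambda>x. (- 1) * (D (a [^] m) f x + (- real m) * d x))"
        using nrm_triangle[OF pc[of m] cfun_scale[OF cfun_add[OF pc[of m] cfun_scale[OF dc, of "- real m"]], of "- 1"]]
        by simp
      then have "m * nrm d \<le> nrm (D (a [^] m) f) + (real m)\<^sup>2 / 2 * \<nu> a * nrm d"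
        using nrm_scale[OF dc, of "real m"] approx[of m]
          nrm_scale[OF cfun_add[OF pc[of m] cfun_scale[OF dc, of "- real m"]], of "- 1"] by simp
      moreover have "(real m)\<^sup>2 / 2 * \<nu> a * nrm d \<le> m / 2 * nrm d"
      proof -
        have "(m / 2 * nrm d) * (m * \<nu> a) \<le> (m / 2 * nrm d) * 1"
          using m nrm_nonneg[OF dc] by (intro mult_left_mono) auto
        then show ?thesis by (simp add: power2_eq_square algebra_simps)
      qed
      moreover have "nrm (D (a [^] m) f) \<le> \<nu> (a [^] m) * nrm f" using \<nu>_upper a f by simp
      ultimately have "m / 2 * nrm d \<le> \<nu> (a [^] m) * nrm f" by linarith
      then show ?thesis using False by (simp add: d_def field_simps)
    qed
    then have "\<nu> a \<le> 2 / m * \<nu> (a [^] m)" using \<nu>_nonneg[of "a [^] m"] a by (intro \<nu>_least) auto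
    then show ?thesis using False by (simp add: field_simps)
  qed
  have \<nu>_cont: "\<exists>U. openin T U \<and> \<one> \<in> U \<and> (\<forall>a\<in>U. \<nu> a \<le> \<epsilon>)" if \<epsilon>: "\<epsilon> > 0" for \<epsilon>
  proof -
    obtain U where U: "openin T U" "\<one> \<in> U" "\<And>a f. a \<in> U \<Longrightarrow> f \<in> E \<Longrightarrow> nrm (\<lambda>x. f (a \<otimes> x) - f x) \<le> \<epsilon> * nrm f"
      using Econt[OF \<epsilon>] by metis
    have "\<nu> a \<le> \<epsilon>" if "a \<in> U" for a by (rule \<nu>_least) (use \<epsilon> U(3)[OF that] in \<open>auto simp: D_def\<close>)
    then show ?thesis using U(1,2) by blast
  qed
  define Z where "Z = {a \<in> carrier G. \<nu> a = 0}"
  have Z: "subgroup Z G"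
  proof (rule subgroupI)
    show "Z \<subseteq> carrier G" "Z \<noteq> {}" using \<nu>_one by (auto simp: Z_def)
    show "inv a \<in> Z" if "a \<in> Z" for a using that \<nu>_inv by (simp add: Z_def)
    show "a \<otimes> b \<in> Z" if "a \<in> Z" "b \<in> Z" for a b
      using that \<nu>_mult[of a b] \<nu>_nonneg[of "a \<otimes> b"] by (simp add: Z_def)
  qed
  have "x2 \<notin> Z"
  proof
    assume "x2 \<in> Z"
    then have "nrm (D x2 g) \<le> 0" using \<nu>_upper[OF g(2,1)] by (simp add: Z_def)
    moreover have "nrm (D x2 g) > 0"
      by (rule nrm_pos[OF Dc[OF g(2,1)] one_closed]) (use g in \<open>simp add: D_def\<close>)
    ultimately show False by simp
  qed
  have "openin T Z"
  proof (rule ccontr)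
    assume notopen: "\<not> openin T Z"
    \<comment> \<open>Were a neighbourhood of \<open>\<one>\<close> contained in the kernel
      \<open>Z\<close>, then \<open>Z\<close> would be open; so elements of positive displacement
      exist arbitrarily close to \<open>\<one>\<close>.\<close>
    have "\<exists>a\<in>carrier G. 0 < \<nu> a \<and> \<nu> a < 1 / real (Suc k)" for k
    proof -
      obtain U where U: "openin T U" "\<one> \<in> U" "\<And>a. a \<in> U \<Longrightarrow> \<nu> a \<le> 1 / real (Suc (Suc k))"
        using \<nu>_cont[of "1 / real (Suc (Suc k))"] by auto
      have "\<not> U \<subseteq> Z" using open_if_contains_nhd[OF Z U(1,2)] notopen by blast
      then obtain a where a: "a \<in> U" "a \<notin> Z" by blast
      then have ac: "a \<in> carrier G" using openin_carrier[OF U(1)] by blast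
      have "1 / real (Suc (Suc k)) < 1 / real (Suc k)" by (simp add: frac_less2)
      then show ?thesis using a ac U(3)[OF a(1)] \<nu>_nonneg[OF ac] by (intro bexI[of _ a]) (auto simp: Z_def)
    qed
    then obtain a where a: "\<And>k. a k \<in> carrier G" "\<And>k. 0 < \<nu> (a k)" "\<And>k. \<nu> (a k) < 1 / real (Suc k)" by metis
    obtain \<U> :: "nat filter" where \<U>: "\<U> \<le> sequentially" "ultra \<U>"
      using ultra_exists[of "sequentially"] by auto
    have \<U>bot: "\<U> \<noteq> bot" by (rule ultra_neq_bot[OF \<U>(2)])
    \<comment> \<open>The number of steps of size \<open>\<nu> (a k)\<close> that fit into the
      length \<open>t\<close>; the limit of \<open>a k [^] e k t\<close> is the point of the curve
      at time \<open>t\<close>.\<close>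
    define e where "e k t = nat \<lfloor>t / \<nu> (a k)\<rfloor>" for k t
    \<comment> \<open>The times whose curve point has an n-th power of displacement zero, expressed
      without choosing that point. Torsion puts every time in some \<open>A n\<close>.\<close>
    define A where "A n = {t \<in> {0<..1}. \<forall>\<epsilon>>0. eventually (\<lambda>k. \<nu> (a k [^] (n * e k t)) \<le> \<epsilon>) \<U>}" for n :: nat
    have cover: "{0<..1} \<subseteq> (\<Union>n\<in>{0<..}. A n)"
    proof
      fix t :: real assume t: "t \<in> {0<..1}"
      obtain y where y: "y \<in> carrier G" "limitin T (\<lambda>k. a k [^] e k t) y \<U>"
        using ultra_limitin[OF \<U>(2), of "\<lambda>k. a k [^] e k t"] a(1) by auto
      obtain n :: nat where n: "n > 0" "y [^] n = \<one>" using tors[OF y(1)] by blast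
      have "limitin T ((\<lambda>x. x [^] n) \<circ> (\<lambda>k. a k [^] e k t)) (y [^] n) \<U>"
        by (rule continuous_map_limit[OF continuous_map_nat_pow y(2)])
      then have lim: "limitin T (\<lambda>k. a k [^] (n * e k t)) \<one> \<U>"
        using n(2) a(1) by (simp add: o_def nat_pow_pow mult.commute)
      have "eventually (\<lambda>k. \<nu> (a k [^] (n * e k t)) \<le> \<epsilon>) \<U>" if \<epsilon>: "\<epsilon> > 0" for \<epsilon>
      proof -
        obtain U where U: "openin T U" "\<one> \<in> U" "\<And>a. a \<in> U \<Longrightarrow> \<nu> a \<le> \<epsilon>" using \<nu>_cont[OF \<epsilon>] by metis
        have "eventually (\<lambda>k. a k [^] (n * e k t) \<in> U) \<U>" using lim U(1,2) by (simp add: limitin_def)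
        then show ?thesis by eventually_elim (rule U(3))
      qed
      then show "t \<in> (\<Union>n\<in>{0<..}. A n)" using t n(1) by (auto simp: A_def)
    qed
    have "\<not> (\<forall>n\<in>{0<..}. countable (A n))"
    proof
      assume "\<forall>n\<in>{0<..}. countable (A n)"
      then have "countable (\<Union>n\<in>{0<..}. A n)" by (intro countable_UN) auto
      then have "countable {0<..1::real}" using cover countable_subset by blast
      then show False using uncountable_half_open_interval_2[of 0 "1::real"] by simp
    qed
    then obtain n where n: "n > 0" "infinite (A n)" using countable_finite by auto
    have "A n \<subseteq> {0..1}" by (auto simp: A_def)
    then obtain s t where st: "s \<in> A n" "t \<in> A n" "s < t" "t - s < 1 / (2 * real n)"
      using infinite_unit_interval_close[OF n(2), of "1 / (2 * real n)"] n(1) by auto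
    \<comment> \<open>The approximate length travelled between the two n-th powers; below 1/2, it
      lets the linear lower bound \<open>\<nu>_pow_ge\<close> apply.\<close>
    define \<delta> where "\<delta> = n * (t - s)"
    have \<delta>: "\<delta> > 0" "\<delta> < 1 / 2" using st(3,4) n(1) by (simp_all add: \<delta>_def field_simps)
    have "eventually (\<lambda>k. \<nu> (a k [^] (n * e k r)) \<le> \<delta> / 16) \<U>" if "r \<in> A n" for r
    proof -
      have all: "\<forall>\<epsilon>>0. eventually (\<lambda>k. \<nu> (a k [^] (n * e k r)) \<le> \<epsilon>) \<U>" using that by (simp add: A_def)
      show ?thesis by (rule all[rule_format]) (use \<delta>(1) in simp)
    qed
    note this[OF st(1)] this[OF st(2)]
    moreover have "eventually (\<lambda>k. n * \<nu> (a k) < \<delta> / 2) \<U>"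
    proof -
      have "(\<lambda>k. n * (1 / real (Suc k))) \<longlonglongrightarrow> real n * 0"
        using LIMSEQ_inverse_real_of_nat by (intro tendsto_mult tendsto_const) (simp add: inverse_eq_divide)
      then have "eventually (\<lambda>k. n * (1 / real (Suc k)) < \<delta> / 2) sequentially"
        using \<delta>(1) by (intro order_tendstoD(2)) auto
      then have "eventually (\<lambda>k. n * \<nu> (a k) < \<delta> / 2) sequentially"
      proof eventually_elim
        case (elim k)
        have "n * \<nu> (a k) \<le> n * (1 / real (Suc k))" using a(3)[of k] by (intro mult_left_mono) auto
        then show ?case using elim by linarith
      qed
      then show ?thesis using \<U>(1) filter_leD by blast
    qed
    ultimately have "eventually (\<lambda>k. \<nu> (a k [^] (n * e k s)) \<le> \<delta> / 16 \<and> \<nu> (a k [^] (n * e k t)) \<le> \<delta> / 16 \<and> n * \<nu> (a k) < \<delta> / 2) \<U>"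
      by (intro eventually_conj)
    then obtain k where k: "\<nu> (a k [^] (n * e k s)) \<le> \<delta> / 16" "\<nu> (a k [^] (n * e k t)) \<le> \<delta> / 16" "n * \<nu> (a k) < \<delta> / 2"
      using eventually_happens'[OF \<U>bot] by blast
    define v where "v = \<nu> (a k)"
    have v: "v > 0" using a(2) by (simp add: v_def)
    have pos: "0 < s" "0 < t" using st(1,2) by (auto simp: A_def)
    have e: "real (e k r) \<le> r / v" "r / v - 1 < real (e k r)" if "r > 0" for r
    proof -
      have "0 \<le> \<lfloor>r / v\<rfloor>" using that v by simp
      then have "real (e k r) = of_int \<lfloor>r / v\<rfloor>" by (simp add: e_def v_def)
      then show "real (e k r) \<le> r / v" "r / v - 1 < real (e k r)" by linarith+
    qed
    have le: "e k s \<le> e k t" unfolding e_def using st(3) a(2)[of k] by (intro nat_mono floor_mono divide_right_mono) auto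
    \<comment> \<open>\<open>m * \<nu> (a k)\<close> is \<open>\<delta>\<close> up to a rounding
      error of \<open>n * \<nu> (a k) < \<delta> / 2\<close>. Hence the displacement of
      \<open>a k [^] m\<close> is at least \<open>\<delta> / 4\<close>, while both n-th powers
      having displacement at most \<open>\<delta> / 16\<close> bounds it by
      \<open>\<delta> / 8\<close>.\<close>
    define m where "m = n * e k t - n * e k s"
    have mreal: "real m = n * (real (e k t) - real (e k s))"
      using le by (simp add: m_def of_nat_diff right_diff_distrib)
    have "real m * v \<le> n * (t / v - (s / v - 1)) * v"
      unfolding mreal using e(1)[OF pos(2)] e(2)[OF pos(1)] v by (intro mult_right_mono mult_left_mono) auto
    also have "\<dots> = \<delta> + n * v" using v by (simp add: \<delta>_def field_simps)
    finally have upper: "real m * v \<le> 1" using k(3) \<delta> by (simp add: v_def)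
    have "n * ((t / v - 1) - s / v) * v \<le> real m * v"
      unfolding mreal using e(2)[OF pos(2)] e(1)[OF pos(1)] v by (intro mult_right_mono mult_left_mono) auto
    moreover have eq: "n * ((t / v - 1) - s / v) * v = \<delta> - n * v" using v by (simp add: \<delta>_def field_simps)
    ultimately have "\<delta> - n * v \<le> real m * v" by (simp only: eq)
    moreover have "n * v < \<delta> / 2" using k(3) by (simp only: v_def)
    ultimately have lower: "\<delta> / 2 \<le> real m * v" by linarith
    have "\<delta> / 4 \<le> \<nu> (a k [^] m)"
      using \<nu>_pow_ge[OF a(1), of m k] upper lower by (simp add: v_def)
    moreover have "\<nu> (a k [^] m) \<le> \<delta> / 16 + \<delta> / 16"
    proof -
      have "a k [^] (n * e k t) = a k [^] m \<otimes> a k [^] (n * e k s)"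
        using a(1) le by (simp add: nat_pow_mult m_def)
      then have "a k [^] m = a k [^] (n * e k t) \<otimes> inv (a k [^] (n * e k s))"
        using a(1)[of k] by (simp add: m_assoc)
      then have "\<nu> (a k [^] m) \<le> \<nu> (a k [^] (n * e k t)) + \<nu> (inv (a k [^] (n * e k s)))"
        using \<nu>_mult a(1)[of k] by simp
      also have "\<nu> (inv (a k [^] (n * e k s))) = \<nu> (a k [^] (n * e k s))" using \<nu>_inv a(1) by simp
      finally show ?thesis using k(1,2) by linarith
    qed
    ultimately show False using \<delta>(1) by linarith
  qed
  then show ?thesis using Z \<open>x2 \<notin> Z\<close> g(2) by blast
qed

section \<open>Passage from the identity component to small open subgroups\<close>

lemma subgroup_connected_component: "subgroup (connected_component_of_set T \<one>) G"
proof (rule subgroupI)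
  let ?C = "connected_component_of_set T \<one>"
  have C: "connectedin T ?C" by (rule connectedin_connected_component_of)
  have sub: "?C \<subseteq> carrier G" using connected_component_of_subset_topspace topspace_eq_carrier by metis
  have one: "\<one> \<in> ?C" by (simp add: connected_component_of_refl topspace_eq_carrier)
  have *: "inv x \<otimes> y \<in> ?C" if "x \<in> ?C" "y \<in> ?C" for x y
  proof -
    have x: "x \<in> carrier G" using that sub by blast
    have "connectedin T ((\<lambda>z. inv x \<otimes> z) ` ?C)"
      by (rule connectedin_continuous_map_image[OF continuous_map_left C]) (use x in simp)
    moreover have "\<one> \<in> (\<lambda>z. inv x \<otimes> z) ` ?C" using that(1) x by (intro image_eqI[of _ _ x]) auto
    ultimately have "(\<lambda>z. inv x \<otimes> z) ` ?C \<subseteq> ?C" by (rule connected_component_of_maximal)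
    then show ?thesis using that(2) by blast
  qed
  show "?C \<subseteq> carrier G" by (rule sub)
  show "?C \<noteq> {}" using one by blast
  show inv: "inv x \<in> ?C" if "x \<in> ?C" for x
    using *[OF that one] sub that by (metis inv_closed r_one subsetD)
  show "x \<otimes> y \<in> ?C" if "x \<in> ?C" "y \<in> ?C" for x y
    using *[OF inv[OF that(1)] that(2)] sub that by (metis inv_inv subsetD)
qed

text \<open>The subgroup is the stabilizer of \<open>Q\<close> under left multiplication, contained
  in \<open>Q\<close> because \<open>\<one>\<close> is in \<open>Q\<close>. Compactness of
  \<open>Q\<close> and the tube lemma give a neighbourhood of \<open>\<one>\<close> that maps
  \<open>Q\<close> into itself, so the stabilizer is open.\<close>

lemma clopen_contains_open_subgroup:
  assumes Q: "closedin T Q" "openin T Q" "\<one> \<in> Q"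
  shows "\<exists>H. subgroup H G \<and> openin T H \<and> H \<subseteq> Q"
proof -
  have Qc: "Q \<subseteq> carrier G" by (rule openin_carrier[OF Q(2)])
  let ?W = "{z \<in> topspace (prod_topology T T). (case z of (x, y) \<Rightarrow> x \<otimes> y) \<in> Q}"
  have W: "openin (prod_topology T T) ?W"
    by (rule openin_continuous_map_preimage[OF continuous_mult Q(2)])
  have sub: "{\<one>} \<times> Q \<subseteq> ?W" using Qc by (auto simp: topspace_eq_carrier)
  have one: "compactin T {\<one>}" by (simp add: finite_imp_compactin topspace_eq_carrier)
  obtain U V where UV: "openin T U" "{\<one>} \<subseteq> U" "Q \<subseteq> V" "U \<times> V \<subseteq> ?W"
  proof goal_cases
    case 1
    show ?case by (rule Wallace_theorem_prod_topology[OF one closedin_compactin[OF Q(1)] W sub]) (rule 1, assumption+)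
  qed
  have UQ: "u \<otimes> q \<in> Q" if "u \<in> U" "q \<in> Q" for u q
  proof -
    have "(u, q) \<in> ?W" using UV(3,4) that by blast
    then show ?thesis by simp
  qed
  obtain V' where V': "openin T V'" "\<one> \<in> V'" "V' \<subseteq> U" "\<And>u. u \<in> V' \<Longrightarrow> inv u \<in> V'"
    using one_nhd_shrink[OF UV(1)] UV(2) by (metis insert_subset)
  define H where "H = {g \<in> carrier G. (\<forall>q\<in>Q. g \<otimes> q \<in> Q) \<and> (\<forall>q\<in>Q. inv g \<otimes> q \<in> Q)}"
  have "subgroup H G"
  proof (rule subgroupI)
    show "H \<subseteq> carrier G" by (auto simp: H_def)
    show "H \<noteq> {}" using Qc by (auto simp: H_def intro!: exI[of _ \<one>])
    show "inv g \<in> H" if "g \<in> H" for g using that by (simp add: H_def)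
    show "g \<otimes> h \<in> H" if "g \<in> H" "h \<in> H" for g h
      using that Qc by (auto simp: H_def m_assoc inv_mult_group subset_iff)
  qed
  moreover have "V' \<subseteq> H" using V' UQ openin_carrier[OF V'(1)] by (auto simp: H_def)
  moreover have "H \<subseteq> Q" using Q(3) by (auto simp: H_def)
  ultimately show ?thesis using open_if_contains_nhd[OF _ V'(1,2)] by blast
qed

lemma torsion_small_open_subgroups:
  assumes tors: "\<And>x. x \<in> carrier G \<Longrightarrow> \<exists>n>0. x [^] (n::nat) = \<one>" and U: "openin T U" "\<one> \<in> U"
  shows "\<exists>H. subgroup H G \<and> openin T H \<and> H \<subseteq> U"
proof -
  define C where "C = connected_component_of_set T \<one>"
  have C: "subgroup C G" unfolding C_def by (rule subgroup_connected_component)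
  have conn: "connectedin T C" unfolding C_def by (rule connectedin_connected_component_of)
  have "closedin T C" unfolding C_def by (rule closedin_connected_component_of)
  have "C = {\<one>}"
  proof (rule ccontr)
    assume "C \<noteq> {\<one>}"
    then obtain x1 where x1: "x1 \<in> C" "x1 \<noteq> \<one>" using subgroup.one_closed[OF C] by blast
    interpret C: compact_topological_group "G\<lparr>carrier := C\<rparr>" "subtopology T C"
      by (rule compact_subgroup[OF C closedin_compactin[OF \<open>closedin T C\<close>]])
    have "\<exists>n>0. x [^]\<^bsub>G\<lparr>carrier := C\<rparr>\<^esub> (n::nat) = \<one>\<^bsub>G\<lparr>carrier := C\<rparr>\<^esub>" if "x \<in> carrier (G\<lparr>carrier := C\<rparr>)" for x
      using tors[of x] subgroup.mem_carrier[OF C] that by (simp add: nat_pow_consistent[symmetric])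
    then obtain H where H: "subgroup H (G\<lparr>carrier := C\<rparr>)" "openin (subtopology T C) H" "H \<noteq> C"
      using C.torsion_proper_open_subgroup[of x1] x1 by auto
    have "closedin (subtopology T C) H" by (rule C.open_subgroup_closed[OF H(1,2)])
    moreover have "connected_space (subtopology T C)" using conn by (simp add: connectedin_def)
    moreover have "topspace (subtopology T C) = C" using C.topspace_eq_carrier by simp
    moreover have "H \<noteq> {}" using subgroup.one_closed[OF H(1)] by blast
    ultimately show False using H(2,3) unfolding connected_space_clopen_in by metis
  qed
  \<comment> \<open>With trivial component no connected set joins \<open>\<one>\<close> to the
    complement of \<open>U\<close>, and in a compact Hausdorff space this yields a clopen set
    between them.\<close>
  have "separated_between T {\<one>} (carrier G - U)"
  proof (rule cut_wire_fence_theorem[OF compact Hausdorff])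
    show "closedin T {\<one>}" using \<open>closedin T C\<close> \<open>C = {\<one>}\<close> by simp
    show "closedin T (carrier G - U)" using closedin_diff[OF closedin_topspace U(1)] by (simp add: topspace_eq_carrier)
    show "disjnt D {\<one>} \<or> disjnt D (carrier G - U)" if D: "connectedin T D" for D
    proof (cases "\<one> \<in> D")
      case True
      then have "D \<subseteq> C" unfolding C_def using D by (intro connected_component_of_maximal)
      then show ?thesis using \<open>C = {\<one>}\<close> U(2) by (auto simp: disjnt_def)
    qed (simp add: disjnt_def)
  qed
  then obtain Q where Q: "closedin T Q" "openin T Q" "\<one> \<in> Q" "carrier G - U \<subseteq> topspace T - Q"
    unfolding separated_between by auto
  then have "Q \<subseteq> U" using openin_carrier[OF Q(2)] by blast
  then show ?thesis using clopen_contains_open_subgroup[OF Q(1-3)] by blast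
qed

end

section \<open>Reduction to compact groups\<close>

lemma (in compact_topological_group) compact_sequence:
  assumes "infinite (carrier G)"
  shows "\<exists>a. unconditionally_f_productive G T f a"
proof (cases "\<forall>x\<in>carrier G. \<exists>n>0. x [^] (n::nat) = \<one>")
  case True
  then obtain a where a: "range a \<subseteq> carrier G" "inj a"
    "\<And>U. openin T U \<Longrightarrow> \<one> \<in> U \<Longrightarrow> \<exists>H. subgroup H G \<and> H \<subseteq> U \<and> eventually (\<lambda>n::nat. a n \<in> H) sequentially"
    using profinite_sequence[OF assms torsion_small_open_subgroups] by blast
  then show ?thesis
    using small_tails_imp_productive[OF small_tails_subgroups[OF a(1,3)] a(1,2)] by blast
next
  case False
  then obtain x where "x \<in> carrier G" "\<And>n::nat. n > 0 \<Longrightarrow> x [^] n \<noteq> \<one>" by blast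
  then show ?thesis using infinite_order_sequence small_tails_imp_productive by blast
qed

text \<open>The generated subgroup is exhausted by countably many stages, each adding all products
  of two elements of the previous stage.\<close>

lemma (in group) countable_generate:
  assumes "countable S"
  shows "countable (generate G S)"
proof -
  define step where "step X = X \<union> (\<lambda>(x, y). x \<otimes> y) ` (X \<times> X)" for X
  define X where "X n = (step ^^ n) (insert \<one> (S \<union> m_inv G ` S))" for n
  have "countable (X n)" for n
    by (induction n) (use assms in \<open>auto simp: X_def step_def\<close>)
  moreover have mono: "X m \<subseteq> X n" if "m \<le> n" for m n
    by (rule lift_Suc_mono_le[OF _ that]) (auto simp: X_def step_def)
  have "generate G S \<subseteq> (\<Union>n. X n)"
  proof
    fix h assume "h \<in> generate G S"
    then show "h \<in> (\<Union>n. X n)"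
    proof (induction rule: generate.induct)
      case (eng h1 h2)
      then obtain i j where "h1 \<in> X i" "h2 \<in> X j" by blast
      then have "h1 \<in> X (max i j)" "h2 \<in> X (max i j)" using mono[of i "max i j"] mono[of j "max i j"] by auto
      then have "h1 \<otimes> h2 \<in> X (Suc (max i j))" by (auto simp: X_def step_def)
      then show ?case by blast
    qed (auto simp: X_def intro!: exI[of _ 0])
  qed
  ultimately show ?thesis by (meson countable_UN countable_subset uncountable_def countableI_type)
qed

lemma (in hausdorff_topological_group) omega_bounded_sequence:
  assumes "omega_bounded G T" "infinite (carrier G)"
  shows "\<exists>a. unconditionally_f_productive G T f a"
proof -
  obtain S where S: "S \<subseteq> carrier G" "countable S" "infinite S"
    using assms(2) infinite_countable_subset' by blast
  define H where "H = generate G S"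
  have H: "subgroup H G" unfolding H_def using S(1) by (rule generate_is_subgroup)
  have SH: "S \<subseteq> H" unfolding H_def by (auto intro: generate.incl)
  define K where "K = T closure_of H"
  have K: "subgroup K G" unfolding K_def by (rule subgroup_closure_of[OF H])
  have "compactin T K"
    using assms(1) countable_generate[OF S(2)] subgroup.subset[OF H] by (simp add: omega_bounded_def K_def H_def)
  then interpret K: compact_topological_group "G\<lparr>carrier := K\<rparr>" "subtopology T K"
    by (rule compact_subgroup[OF K])
  have "H \<subseteq> K" unfolding K_def using subgroup.subset[OF H] by (simp add: closure_of_subset topspace_eq_carrier)
  from infinite_super[OF subset_trans[OF SH this] S(3)] have "infinite K" .
  then have "infinite (carrier (G\<lparr>carrier := K\<rparr>))" by simp
  then show ?thesis using K.compact_sequence productive_from_subgroup[OF K] by blast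
qed

theorem corollary7p6:
  fixes G :: "('a, 'b) monoid_scheme" and T :: "'a topology" and f :: "nat \<Rightarrow> nat"
  assumes "hausdorff_topological_group G T"
    and "infinite (carrier G)"
    and "\<forall>n. f n \<noteq> 0"
  shows "(omega_bounded G T \<longrightarrow> (\<exists>a. unconditionally_f_productive G T f a)) \<and>
         (compact_space T \<longrightarrow> (\<exists>a. unconditionally_f_productive G T f a))"
proof -
  interpret hausdorff_topological_group G T by fact
  show ?thesis
  proof (intro conjI impI)
    show "\<exists>a. unconditionally_f_productive G T f a" if "omega_bounded G T"
      using omega_bounded_sequence[OF that assms(2)] .
    show "\<exists>a. unconditionally_f_productive G T f a" if "compact_space T"
    proof -
      interpret compact_topological_group G T by unfold_locales fact
      show ?thesis by (rule compact_sequence[OF assms(2)])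
    qed
  qed
qed

end
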